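(* Let $k\ge1$ be fixed. For each $n\ge1$ let $(g_{i,j,n})_{1\le i\le k,\ j\ge1}$ be a jointly Gaussian family of $N(0,1)$ random variables with ${\rm E}[g_{i,j,n}g_{i,j',n}]=0$ whenever $j\ne j'$, and let $F_n=(F_{1,n},\ldots,F_{k,n})$ with $$F_{i,n}=\sum_{j=1}^\infty\lambda_{i,j,n}(g_{i,j,n}^2-1),\qquad \lambda_{i,j,n}\in\mathbb{R},\ \sum_{j=1}^\infty\lambda_{i,j,n}^2<\infty.$$ If $F_n$ converges in law as $n\to\infty$, then the limit law is the law of a random vector $\eta+F$, where $F=(F_1,\ldots,F_k)$ has the form $F_i=\sum_{j=1}^\infty\lambda_{i,j}(g_{i,j}^2-1)$ for some jointly Gaussian family $(g_{i,j})_{1\le i\le k, j\ge1}$ of $N(0,1)$ variables with ${\rm E}[g_{i,j}g_{i,j'}]=0$ for $j\ne j'$ and real $\lambda_{i,j}$ with $\sum_j\lambda_{i,j}^2<\infty$, and $\eta=(\eta_1,\ldots,\eta_k)$ is a centered Gaussian random vector independent of $F$. *)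

theory Defs
  imports "HOL-Probability.Probability"
begin

definition centered_gaussian_rv :: "'a measure \<Rightarrow> ('a \<Rightarrow> real) \<Rightarrow> bool" where
  "centered_gaussian_rv M X \<longleftrightarrow> X \<in> borel_measurable M \<and>
     ((AE \<omega> in M. X \<omega> = 0) \<or> (\<exists>\<sigma>>0. distributed M lborel X (normal_density 0 \<sigma>)))"

definition jointly_gaussian :: "'a measure \<Rightarrow> ('i \<Rightarrow> 'a \<Rightarrow> real) \<Rightarrow> bool" where
  "jointly_gaussian M g \<longleftrightarrow>
     (\<forall>I c. finite I \<longrightarrow> centered_gaussian_rv M (\<lambda>\<omega>. \<Sum>i\<in>I. c i * g i \<omega>))"

definition chaos_vector ::
  "'a measure \<Rightarrow> ('k \<times> nat \<Rightarrow> 'a \<Rightarrow> real) \<Rightarrow> ('k \<Rightarrow> nat \<Rightarrow> real) \<Rightarrow> ('k \<Rightarrow> 'a \<Rightarrow> real) \<Rightarrow> bool" where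
  "chaos_vector M g lam F \<longleftrightarrow>
     jointly_gaussian M g \<and>
     (\<forall>ij. distributed M lborel (g ij) (normal_density 0 1)) \<and>
     (\<forall>i j j'. j \<noteq> j' \<longrightarrow> integral\<^sup>L M (\<lambda>\<omega>. g (i, j) \<omega> * g (i, j') \<omega>) = 0) \<and>
     (\<forall>i. summable (\<lambda>j. (lam i j)\<^sup>2)) \<and>
     (\<forall>i. F i \<in> borel_measurable M) \<and>
     (\<forall>i. (\<lambda>N. \<integral>\<^sup>+ \<omega>. ennreal ((F i \<omega> - (\<Sum>j<N. lam i j * ((g (i, j) \<omega>)\<^sup>2 - 1)))\<^sup>2) \<partial>M)
            \<longlonglongrightarrow> 0)"

definition converges_in_law ::
  "(nat \<Rightarrow> 'a measure) \<Rightarrow> (nat \<Rightarrow> 'a \<Rightarrow> 'b::topological_space) \<Rightarrow> 'b measure \<Rightarrow> bool" where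
  "converges_in_law M X \<mu> \<longleftrightarrow> prob_space \<mu> \<and> sets \<mu> = sets borel \<and>
     (\<forall>f :: 'b \<Rightarrow> real. continuous_on UNIV f \<and> bounded (range f) \<longrightarrow>
        (\<lambda>n. \<integral>x. f x \<partial>(distr (M n) borel (X n))) \<longlonglongrightarrow> (\<integral>x. f x \<partial>\<mu>))"

end

theory Submission
  imports Defs "HOL-Library.Diagonal_Subsequence"
begin

text \<open>
  Only the law of each \<open>F n\<close> matters. Truncating the series, sorting \<open>\<bar>\<lambda>\<bar>\<close> decreasingly in \<open>j\<close> and taking a
  Cholesky factor \<open>L n\<close> of the covariance of \<open>g n\<close>, every \<open>F n\<close> becomes a quadratic polynomial in one and
  the same sequence of independent standard normal variables. Convergence in law and the bound
  \<open>E X^4 \<le> 27 (E X^2)^2\<close> on the second chaos bound the variances (Paley--Zygmund), so along a subsequence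
  all \<open>\<lambda>\<close>'s and all entries of \<open>L n\<close> converge, and their limits define \<open>F\<close>.

  For \<open>N \<le> M\<close> split \<open>F n\<close> into a head (\<open>j < N\<close>), a middle part and a tail (\<open>j \<ge> M\<close>). The middle part is small
  in \<open>L^2\<close> for large \<open>N\<close>, uniformly in \<open>M\<close>. By the sorting, the matrices of the tail have operator norm
  \<open>O(1 / sqrt M)\<close>; Gaussian integration by parts then gives a linear differential equation, up to a small
  error, for \<open>\<theta> \<mapsto> E exp (i (head + \<theta> tail))\<close>, so that the tail acts as an independent centered Gaussian vector
  with the same covariance. Letting \<open>n\<close>, then \<open>M\<close>, then \<open>N\<close> tend to infinity identifies the characteristic
  function of the limit law.
\<close>

section \<open>The standard Gaussian sequence and integration by parts\<close>

text \<open>Only variables with the same first index are orthogonal; correlations across first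
  indices are arbitrary, so the tail need not be uncorrelated with the variables of the head. What
  decouples the two is the operator norm of the tail: after integration by parts, head and tail
  interact only through the inner product of their gradients, and a tail matrix applied to a unit
  vector is small. The resulting bound is a multiple of the sum of the absolute head coefficients,
  which may grow with \<open>N\<close>. This is why two thresholds are needed: \<open>M\<close> goes
  to infinity while \<open>N\<close> stays fixed, and the part in between is controlled by its
  variance instead. Sorting prevents a coefficient of fixed size from escaping to ever larger
  \<open>j\<close>, where it would leave a non-Gaussian contribution that the limit coefficients
  miss. Triangular factors with respect to one fixed enumeration make each Gaussian variable a
  finite sum whose number of terms does not depend on \<open>n\<close>; orthonormality and pointwise
  convergence therefore survive entrywise limits.\<close>

lemma integral_vector_derivative_eq_0:
  fixes h :: "real \<Rightarrow> 'b::euclidean_space"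
  assumes deriv: "\<And>x. (h has_vector_derivative h' x) (at x)"
    and cont: "\<And>x. isCont h' x"
    and h: "integrable lborel h" and h': "integrable lborel h'"
  shows "integral\<^sup>L lborel h' = 0"
proof (rule ccontr)
  define L where "L = integral\<^sup>L lborel h'"
  \<comment> \<open>By the fundamental theorem \<open>u y\<close> is the integral of
    \<open>h'\<close> over \<open>[-y, y]\<close>, so \<open>u\<close> tends to \<open>L\<close>.
    But \<open>u\<close> is integrable as well, which is impossible if its norm stays above
    \<open>norm L / 2\<close> on a half-line.\<close>
  define u where "u y = h y - h (- y)" for y
  assume "integral\<^sup>L lborel h' \<noteq> 0"
  then have L: "norm L > 0" by (simp add: L_def)
  have "((\<lambda>y. integral\<^sup>L lborel (\<lambda>x. indicator {-y..y} x *\<^sub>R h' x)) \<longlongrightarrow> L) at_top"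
    unfolding L_def
  proof (rule integral_dominated_convergence_at_top[where w = "\<lambda>x. norm (h' x)"])
    show "AE x in lborel. ((\<lambda>y. indicator {-y..y} x *\<^sub>R h' x) \<longlongrightarrow> h' x) at_top"
    proof (intro AE_I2 tendsto_eventually)
      fix x :: real
      show "\<forall>\<^sub>F y in at_top. indicator {-y..y} x *\<^sub>R h' x = h' x"
        using eventually_ge_at_top[of "\<bar>x\<bar>"] by eventually_elim (auto simp: indicator_def)
    qed
  qed (use h' in \<open>auto simp: indicator_def\<close>)
  moreover have "\<forall>\<^sub>F y in at_top. integral\<^sup>L lborel (\<lambda>x. indicator {-y..y} x *\<^sub>R h' x) = u y"
    using eventually_ge_at_top[of 0]
  proof eventually_elim
    case (elim y)
    then show ?case unfolding u_def
      by (intro integral_FTC_Icc)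
        (use deriv cont in \<open>auto intro!: continuous_at_imp_continuous_on intro: has_vector_derivative_at_within\<close>)
  qed
  ultimately have "(u \<longlongrightarrow> L) at_top" by (rule Lim_transform_eventually)
  then have "\<forall>\<^sub>F y in at_top. dist (u y) L < norm L / 2"
    using L by (intro tendstoD) auto
  then obtain Y where Y: "\<And>y. y \<ge> Y \<Longrightarrow> dist (u y) L < norm L / 2"
    by (auto simp: eventually_at_top_linorder)
  have u: "integrable lborel u"
    unfolding u_def using h lborel_integrable_real_affine[of h "-1" 0] by auto
  have "integrable lborel (\<lambda>y. indicator {Y..} y *\<^sub>R (norm L / 2))"
  proof (rule Bochner_Integration.integrable_bound[OF integrable_norm[OF u]])
    show "AE x in lborel. norm (indicator {Y..} x *\<^sub>R (norm L / 2)) \<le> norm (norm (u x))"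
    proof (intro AE_I2)
      fix x show "norm (indicator {Y..} x *\<^sub>R (norm L / 2)) \<le> norm (norm (u x))"
        using Y[of x] norm_triangle_ineq2[of L "u x"]
        by (auto simp: indicator_def dist_norm norm_minus_commute)
    qed
  qed simp
  then have "integrable lborel (\<lambda>y. (2 / norm L) *\<^sub>R (indicator {Y..} y *\<^sub>R (norm L / 2)))"
    by (rule integrable_scaleR_right)
  then have "integrable lborel (indicator {Y..} :: real \<Rightarrow> real)"
    using L by (simp)
  then have "emeasure lborel {Y..} < \<infinity>"
    by (subst (asm) integrable_indicator_iff) auto
  moreover have "emeasure lborel {Y..} = \<infinity>"
  proof -
    have "ennreal c \<le> emeasure lborel {Y..}" if "c \<ge> 0" for c
    proof -
      have "ennreal c = emeasure lborel {Y..Y+c}" using that by simp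
      also have "\<dots> \<le> emeasure lborel {Y..}" by (intro emeasure_mono) auto
      finally show ?thesis .
    qed
    from this[of "enn2real (emeasure lborel {Y..}) + 1"] show ?thesis
      by (cases "emeasure lborel {Y..}") (auto simp: ennreal_le_iff2 simp flip: ennreal_1 ennreal_plus)
  qed
  ultimately show False by simp
qed

text \<open>Stein's identity: \<open>f\<close> times the density has derivative
  \<open>f' - x f\<close> times the density, which integrates to zero by the previous lemma.
  Integrability takes the place of a decay condition at infinity.\<close>

lemma std_normal_ibp:
  fixes f :: "real \<Rightarrow> 'b::euclidean_space"
  assumes deriv: "\<And>x. (f has_vector_derivative f' x) (at x)"
    and cont: "\<And>x. isCont f' x"
    and f: "integrable std_normal_distribution f"
    and xf: "integrable std_normal_distribution (\<lambda>x. x *\<^sub>R f x)"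
    and f': "integrable std_normal_distribution f'"
  shows "(\<integral>x. x *\<^sub>R f x \<partial>std_normal_distribution) = (\<integral>x. f' x \<partial>std_normal_distribution)"
proof -
  let ?\<phi> = std_normal_density
  have cf: "isCont f x" for x
    using deriv has_vector_derivative_continuous by blast
  have [measurable]: "f \<in> borel_measurable borel" "f' \<in> borel_measurable borel"
    using f f' by auto
  have d\<phi>: "(?\<phi> has_real_derivative - x * ?\<phi> x) (at x)" for x
    unfolding std_normal_density_def
    by (auto intro!: derivative_eq_intros simp: field_simps)
  have i: "integrable lborel (\<lambda>x. ?\<phi> x *\<^sub>R f x)" "integrable lborel (\<lambda>x. ?\<phi> x *\<^sub>R f' x)"
      "integrable lborel (\<lambda>x. ?\<phi> x *\<^sub>R (x *\<^sub>R f x))"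
    using f f' xf by (auto simp: integrable_density)
  have "(\<integral>x. ?\<phi> x *\<^sub>R f' x - ?\<phi> x *\<^sub>R (x *\<^sub>R f x) \<partial>lborel) = 0"
  proof (rule integral_vector_derivative_eq_0)
    fix x
    have "((\<lambda>x. ?\<phi> x *\<^sub>R f x) has_vector_derivative (?\<phi> x *\<^sub>R f' x + (- x * ?\<phi> x) *\<^sub>R f x)) (at x)"
      by (intro has_vector_derivative_scaleR d\<phi> deriv)
    then show "((\<lambda>x. ?\<phi> x *\<^sub>R f x) has_vector_derivative (?\<phi> x *\<^sub>R f' x - ?\<phi> x *\<^sub>R (x *\<^sub>R f x))) (at x)"
      by (simp add: mult.commute)
    have "isCont ?\<phi> x" using d\<phi> DERIV_isCont by blast
    then show "isCont (\<lambda>x. ?\<phi> x *\<^sub>R f' x - ?\<phi> x *\<^sub>R (x *\<^sub>R f x)) x"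
      using cf cont by (intro continuous_intros) auto
  qed (use i in auto)
  then have "(\<integral>x. ?\<phi> x *\<^sub>R f' x \<partial>lborel) = (\<integral>x. ?\<phi> x *\<^sub>R (x *\<^sub>R f x) \<partial>lborel)"
    using i by simp
  then show ?thesis by (simp add: integral_density)
qed

section \<open>Product of standard normal laws, and integration in a single coordinate\<close>

definition gauss_seq :: "(nat \<Rightarrow> real) measure" where
  "gauss_seq = PiM UNIV (\<lambda>_. std_normal_distribution)"

interpretation gauss_seq: prob_space gauss_seq
  unfolding gauss_seq_def by (intro prob_space_PiM prob_space_normal_density) simp

lemma sets_gauss_seq [measurable_cong]: "sets gauss_seq = sets (PiM UNIV (\<lambda>_. borel))"
  unfolding gauss_seq_def by (intro sets_PiM_cong) auto

lemma space_gauss_seq [simp]: "space gauss_seq = UNIV"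
  by (simp add: gauss_seq_def space_PiM)

lemma measurable_gauss_seq_upd [measurable]:
  "(\<lambda>z. (fst z)(p := snd z)) \<in> gauss_seq \<Otimes>\<^sub>M std_normal_distribution \<rightarrow>\<^sub>M gauss_seq"
proof -
  have "(\<lambda>z. (fst z)(p := snd z)) \<in> gauss_seq \<Otimes>\<^sub>M std_normal_distribution \<rightarrow>\<^sub>M PiM UNIV (\<lambda>_. borel)"
  proof (rule measurable_PiM_single')
    fix i
    show "(\<lambda>z. ((fst z)(p := snd z)) i) \<in> borel_measurable (gauss_seq \<Otimes>\<^sub>M std_normal_distribution)"
      by (cases "i = p") auto
  qed (auto simp: space_PiM)
  then show ?thesis by (simp add: measurable_cong_sets[OF refl sets_gauss_seq])
qed

text \<open>Overwriting coordinate \<open>p\<close> instead of deleting it keeps every function on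
  the same space, so that Fubini in one coordinate needs no product over a restricted index
  set.\<close>

lemma distr_gauss_seq_upd:
  "distr (gauss_seq \<Otimes>\<^sub>M std_normal_distribution) gauss_seq (\<lambda>z. (fst z)(p := snd z)) = gauss_seq"
proof -
  interpret N: prob_space std_normal_distribution by (intro prob_space_normal_density) simp
  interpret pair_prob_space std_normal_distribution gauss_seq ..
  interpret Q: pair_prob_space gauss_seq std_normal_distribution ..
  have "distr (std_normal_distribution \<Otimes>\<^sub>M gauss_seq) gauss_seq (\<lambda>(x, w). w(p := x)) = gauss_seq"
    unfolding gauss_seq_def
    using distr_pair_PiM_eq_PiM[of UNIV "\<lambda>_. std_normal_distribution" p]
    by (simp add: prob_space_normal_density)
  then show ?thesis
    unfolding case_prod_unfold
    by (subst Q.distr_pair_swap, subst distr_distr) (auto simp: comp_def case_prod_unfold)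
qed

lemma gauss_seq_integral_upd:
  fixes f :: "(nat \<Rightarrow> real) \<Rightarrow> 'b::{banach, second_countable_topology}"
  assumes f: "integrable gauss_seq f"
  shows "integral\<^sup>L gauss_seq f = (\<integral>w. (\<integral>x. f (w(p := x)) \<partial>std_normal_distribution) \<partial>gauss_seq)"
    and "AE w in gauss_seq. integrable std_normal_distribution (\<lambda>x. f (w(p := x)))"
    and "integrable gauss_seq (\<lambda>w. \<integral>x. f (w(p := x)) \<partial>std_normal_distribution)"
proof -
  interpret N: prob_space std_normal_distribution by (intro prob_space_normal_density) simp
  interpret Q: pair_prob_space gauss_seq std_normal_distribution ..
  have [measurable]: "f \<in> borel_measurable (PiM UNIV (\<lambda>_. borel))"
    using f by measurable
  have i: "integrable (gauss_seq \<Otimes>\<^sub>M std_normal_distribution) (\<lambda>(w, x). f (w(p := x)))"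
    using f by (subst (asm) distr_gauss_seq_upd[of p, symmetric], subst (asm) integrable_distr_eq)
      (auto simp: case_prod_unfold)
  show "AE w in gauss_seq. integrable std_normal_distribution (\<lambda>x. f (w(p := x)))"
    using Q.AE_integrable_fst'[OF i] by simp
  show "integrable gauss_seq (\<lambda>w. \<integral>x. f (w(p := x)) \<partial>std_normal_distribution)"
    using Q.integrable_fst'[OF i] by simp
  have "integral\<^sup>L gauss_seq f = (\<integral>z. (case z of (w, x) \<Rightarrow> f (w(p := x))) \<partial>(gauss_seq \<Otimes>\<^sub>M std_normal_distribution))"
    by (subst distr_gauss_seq_upd[of p, symmetric], subst integral_distr) (auto simp: case_prod_unfold)
  also have "\<dots> = (\<integral>w. (\<integral>x. f (w(p := x)) \<partial>std_normal_distribution) \<partial>gauss_seq)"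
    using Q.integral_fst'[OF i] by simp
  finally show "integral\<^sup>L gauss_seq f = (\<integral>w. (\<integral>x. f (w(p := x)) \<partial>std_normal_distribution) \<partial>gauss_seq)" .
qed

lemma gauss_seq_ibp:
  fixes f :: "(nat \<Rightarrow> real) \<Rightarrow> 'b::euclidean_space"
  assumes deriv: "\<And>w x. ((\<lambda>x. f (w(p := x))) has_vector_derivative f' (w(p := x))) (at x)"
    and cont: "\<And>w x. isCont (\<lambda>x. f' (w(p := x))) x"
    and f: "integrable gauss_seq f"
    and xf: "integrable gauss_seq (\<lambda>w. w p *\<^sub>R f w)"
    and f': "integrable gauss_seq f'"
  shows "(\<integral>w. w p *\<^sub>R f w \<partial>gauss_seq) = (\<integral>w. f' w \<partial>gauss_seq)"
proof -
  have "(\<integral>w. w p *\<^sub>R f w \<partial>gauss_seq) =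
      (\<integral>w. (\<integral>x. x *\<^sub>R f (w(p := x)) \<partial>std_normal_distribution) \<partial>gauss_seq)"
    using gauss_seq_integral_upd(1)[OF xf, of p] by simp
  also have "\<dots> = (\<integral>w. (\<integral>x. f' (w(p := x)) \<partial>std_normal_distribution) \<partial>gauss_seq)"
  proof (rule integral_cong_AE)
    have "AE w in gauss_seq. integrable std_normal_distribution (\<lambda>x. x *\<^sub>R f (w(p := x)))"
      using gauss_seq_integral_upd(2)[OF xf, of p] by simp
    then show "AE w in gauss_seq. (\<integral>x. x *\<^sub>R f (w(p := x)) \<partial>std_normal_distribution)
       = (\<integral>x. f' (w(p := x)) \<partial>std_normal_distribution)"
      using gauss_seq_integral_upd(2)[OF f, of p] gauss_seq_integral_upd(2)[OF f', of p]
    proof eventually_elim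
      case (elim w)
      then show ?case by (intro std_normal_ibp deriv cont)
    qed
  qed (use gauss_seq_integral_upd(3)[OF xf, of p] gauss_seq_integral_upd(3)[OF f', of p] in auto)
  also have "\<dots> = (\<integral>w. f' w \<partial>gauss_seq)"
    using gauss_seq_integral_upd(1)[OF f', of p] by simp
  finally show ?thesis .
qed

lemma distr_gauss_seq_component: "distr gauss_seq std_normal_distribution (\<lambda>w. w p) = std_normal_distribution"
  unfolding gauss_seq_def by (rule distr_PiM_component) (auto intro: prob_space_normal_density)

lemma integrable_gauss_seq_moment: "integrable gauss_seq (\<lambda>w. \<bar>w p\<bar> ^ d)"
proof -
  have [measurable]: "(\<lambda>w. w p) \<in> borel_measurable gauss_seq" by measurable
  have "integrable std_normal_distribution (\<lambda>x. \<bar>x\<bar> ^ d)"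
    using integrable_norm[OF integrable_std_normal_distribution_moment[of d]] by (simp add: power_abs)
  then show ?thesis
    by (subst (asm) distr_gauss_seq_component[of p, symmetric], subst (asm) integrable_distr_eq) auto
qed

lemma measure_gauss_seq_UNIV [simp]: "measure gauss_seq UNIV = 1"
  using gauss_seq.prob_space by simp

text \<open>The class of functions for which integration by parts is free of side conditions:
  polynomial growth in finitely many coordinates gives integrability, and continuity along
  coordinate lines is what the one-dimensional identity uses. It is closed under the operations
  below, so these conditions can be discharged automatically.\<close>

definition temperate :: "((nat \<Rightarrow> real) \<Rightarrow> 'b::euclidean_space) \<Rightarrow> bool" where
  "temperate f \<longleftrightarrow> f \<in> borel_measurable gauss_seq \<and> (\<forall>w p x. isCont (\<lambda>x. f (w(p := x))) x) \<and>
     (\<exists>C d m. \<forall>w. norm (f w) \<le> C * (1 + (\<Sum>q<m. \<bar>w q\<bar>)) ^ d)"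

lemma temperate_measurable: "temperate f \<Longrightarrow> f \<in> borel_measurable gauss_seq"
  and temperate_isCont: "temperate f \<Longrightarrow> isCont (\<lambda>x. f (w(p := x))) x"
  by (auto simp: temperate_def)

text \<open>The base is at least 1 and increases with the number of coordinates, so both the
  exponent and that number may be enlarged. Two temperate functions can thus be bounded with common
  parameters.\<close>

lemma temperate_bound:
  assumes "temperate f"
  shows "\<exists>C d m. C \<ge> 0 \<and> (\<forall>w d' m'. d \<le> d' \<longrightarrow> m \<le> m' \<longrightarrow>
    norm (f w) \<le> C * (1 + (\<Sum>q<m'. \<bar>w q\<bar>)) ^ d')"
proof -
  obtain C d m where *: "\<And>w. norm (f w) \<le> C * (1 + (\<Sum>q<m. \<bar>w q\<bar>)) ^ d"
    using assms by (auto simp: temperate_def)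
  have "norm (f w) \<le> \<bar>C\<bar> * (1 + (\<Sum>q<m'. \<bar>w q\<bar>)) ^ d'" if "d' \<ge> d" "m' \<ge> m" for w d' m'
  proof -
    have "norm (f w) \<le> C * (1 + (\<Sum>q<m. \<bar>w q\<bar>)) ^ d" by (rule *)
    also have "\<dots> \<le> \<bar>C\<bar> * (1 + (\<Sum>q<m'. \<bar>w q\<bar>)) ^ d'"
    proof (intro mult_mono)
      have "(1 + (\<Sum>q<m. \<bar>w q\<bar>)) ^ d \<le> (1 + (\<Sum>q<m'. \<bar>w q\<bar>)) ^ d"
        using that by (intro power_mono add_left_mono sum_mono2) (auto intro!: add_nonneg_nonneg sum_nonneg)
      also have "\<dots> \<le> (1 + (\<Sum>q<m'. \<bar>w q\<bar>)) ^ d'"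
        using that by (intro power_increasing) (auto intro!: sum_nonneg)
      finally show "(1 + (\<Sum>q<m. \<bar>w q\<bar>)) ^ d \<le> (1 + (\<Sum>q<m'. \<bar>w q\<bar>)) ^ d'" .
    qed (auto intro!: add_nonneg_nonneg sum_nonneg zero_le_power)
    finally show ?thesis .
  qed
  then show ?thesis by (intro exI[of _ "\<bar>C\<bar>"] exI[of _ d] exI[of _ m]) auto
qed

lemma temperate_bounded:
  assumes "f \<in> borel_measurable gauss_seq" "\<And>w p x. isCont (\<lambda>x. f (w(p := x))) x" "\<And>w. norm (f w) \<le> C"
  shows "temperate f"
  unfolding temperate_def using assms by (intro conjI exI[of _ C] exI[of _ 0]) auto

lemma temperate_const [intro!]: "temperate (\<lambda>_. c)"
  by (rule temperate_bounded[of _ "norm c"]) auto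

lemma temperate_coord [intro!]: "temperate (\<lambda>w. w q)"
proof -
  have "isCont (\<lambda>x. (w(p := x)) q) x" for w p and x :: real
    by (cases "p = q") auto
  moreover have "norm (w q) \<le> 1 * (1 + (\<Sum>r<Suc q. \<bar>w r\<bar>)) ^ 1" for w :: "nat \<Rightarrow> real"
    by (auto intro!: add_nonneg_nonneg sum_nonneg)
  ultimately show ?thesis unfolding temperate_def by (intro conjI) (measurable, blast+)
qed

lemma temperate_add [intro!]:
  assumes "temperate f" "temperate g"
  shows "temperate (\<lambda>w. f w + g w)"
proof -
  obtain C d m where 1: "C \<ge> 0"
    "\<And>w d' m'. d' \<ge> d \<Longrightarrow> m' \<ge> m \<Longrightarrow> norm (f w) \<le> C * (1 + (\<Sum>q<m'. \<bar>w q\<bar>)) ^ d'"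
    using temperate_bound[OF assms(1)] by blast
  obtain C' e n where 2: "C' \<ge> 0"
    "\<And>w d' m'. d' \<ge> e \<Longrightarrow> m' \<ge> n \<Longrightarrow> norm (g w) \<le> C' * (1 + (\<Sum>q<m'. \<bar>w q\<bar>)) ^ d'"
    using temperate_bound[OF assms(2)] by blast
  have "norm (f w + g w) \<le> (C + C') * (1 + (\<Sum>q<max m n. \<bar>w q\<bar>)) ^ max d e" for w
    using norm_triangle_ineq[of "f w" "g w"] 1(2)[of "max d e" "max m n" w] 2(2)[of "max d e" "max m n" w]
    by (simp add: distrib_right)
  then show ?thesis using assms unfolding temperate_def by (auto intro!: continuous_intros)
qed

lemma temperate_scaleR [intro!]:
  assumes "temperate f" "temperate g"
  shows "temperate (\<lambda>w. f w *\<^sub>R g w)"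
proof -
  obtain C d m where 1: "C \<ge> 0"
    "\<And>w d' m'. d' \<ge> d \<Longrightarrow> m' \<ge> m \<Longrightarrow> norm (f w) \<le> C * (1 + (\<Sum>q<m'. \<bar>w q\<bar>)) ^ d'"
    using temperate_bound[OF assms(1)] by blast
  obtain C' e n where 2: "C' \<ge> 0"
    "\<And>w d' m'. d' \<ge> e \<Longrightarrow> m' \<ge> n \<Longrightarrow> norm (g w) \<le> C' * (1 + (\<Sum>q<m'. \<bar>w q\<bar>)) ^ d'"
    using temperate_bound[OF assms(2)] by blast
  have "norm (f w *\<^sub>R g w) \<le> (C * C') * (1 + (\<Sum>q<max m n. \<bar>w q\<bar>)) ^ (d + e)" for w
  proof -
    have "norm (f w *\<^sub>R g w) = norm (f w) * norm (g w)" by simp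
    also have "\<dots> \<le> (C * (1 + (\<Sum>q<max m n. \<bar>w q\<bar>)) ^ d) * (C' * (1 + (\<Sum>q<max m n. \<bar>w q\<bar>)) ^ e)"
      using 1 2 by (intro mult_mono) (auto intro!: mult_nonneg_nonneg add_nonneg_nonneg sum_nonneg zero_le_power)
    finally show ?thesis by (simp add: power_add mult_ac)
  qed
  then show ?thesis using assms unfolding temperate_def by (auto intro!: continuous_intros)
qed

lemma temperate_mult [intro!]:
  fixes f g :: "_ \<Rightarrow> real"
  assumes "temperate f" "temperate g"
  shows "temperate (\<lambda>w. f w * g w)"
  using temperate_scaleR[OF assms] by simp

lemma temperate_minus [intro!]: "temperate f \<Longrightarrow> temperate (\<lambda>w. - f w)"
  using temperate_scaleR[of "\<lambda>_. -1" f] temperate_const[of "-1"] by simp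

lemma temperate_diff [intro!]:
  assumes "temperate f" "temperate g"
  shows "temperate (\<lambda>w. f w - g w)"
  using temperate_add[OF assms(1) temperate_minus[OF assms(2)]] by simp

lemma temperate_sum [intro!]: "(\<And>i. i \<in> I \<Longrightarrow> temperate (f i)) \<Longrightarrow> temperate (\<lambda>w. \<Sum>i\<in>I. f i w)"
  by (induction I rule: infinite_finite_induct) auto

lemma temperate_power [intro!]:
  fixes f :: "_ \<Rightarrow> real"
  shows "temperate f \<Longrightarrow> temperate (\<lambda>w. f w ^ n)"
  by (induction n) auto

lemma temperate_norm [intro!]: "temperate f \<Longrightarrow> temperate (\<lambda>w. norm (f w))"
  by (auto simp: temperate_def intro!: continuous_intros)

lemma temperate_abs [intro!]: "temperate f \<Longrightarrow> temperate (\<lambda>w. \<bar>f w :: real\<bar>)"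
  using temperate_norm[of f] by simp

text \<open>Every summand is at most the largest one, whose power occurs on the right.\<close>

lemma power_sum_le:
  fixes a :: "'i \<Rightarrow> real"
  assumes "finite I" "I \<noteq> {}" "\<And>i. i \<in> I \<Longrightarrow> a i \<ge> 0"
  shows "(\<Sum>i\<in>I. a i) ^ d \<le> real (card I) ^ d * (\<Sum>i\<in>I. a i ^ d)"
proof -
  have "Max (a ` I) \<in> a ` I" using assms by (intro Max_in) auto
  then obtain j where j: "j \<in> I" "a j = Max (a ` I)" by auto
  then have j: "j \<in> I" "\<And>i. i \<in> I \<Longrightarrow> a i \<le> a j"
    using assms by auto
  have "(\<Sum>i\<in>I. a i) \<le> real (card I) * a j"
    using sum_bounded_above[of I a "a j"] j by simp
  then have "(\<Sum>i\<in>I. a i) ^ d \<le> (real (card I) * a j) ^ d"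
    using assms by (intro power_mono sum_nonneg) auto
  also have "\<dots> \<le> real (card I) ^ d * (\<Sum>i\<in>I. a i ^ d)"
    unfolding power_mult_distrib
    using assms j member_le_sum[of j I "\<lambda>i. a i ^ d"] by (intro mult_left_mono) auto
  finally show ?thesis .
qed

lemma temperate_integrable:
  assumes "temperate f"
  shows "integrable gauss_seq f"
proof -
  obtain C d m where 1: "C \<ge> 0"
    "\<And>w d' m'. d' \<ge> d \<Longrightarrow> m' \<ge> m \<Longrightarrow> norm (f w) \<le> C * (1 + (\<Sum>q<m'. \<bar>w q\<bar>)) ^ d'"
    using temperate_bound[OF assms] by blast
  \<comment> \<open>The factors \<open>2 ^ d\<close> and \<open>real (Suc m) ^ d\<close> come from
    two uses of \<open>power_sum_le\<close>, for the two terms of \<open>1 + ?s\<close> and for the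
    absolute values in \<open>?s\<close>. Taking \<open>Suc m\<close> coordinates keeps the index
    set nonempty.\<close>
  define K where "K = C * (2 ^ d * real (Suc m) ^ d)"
  have bd: "norm (f w) \<le> K * (1 + (\<Sum>q<Suc m. \<bar>w q\<bar> ^ d))" for w
  proof -
    let ?s = "\<Sum>q<Suc m. \<bar>w q\<bar>"
    have s: "?s \<ge> 0" by (intro sum_nonneg) auto
    have "(1 + ?s) ^ d \<le> 2 ^ d * (1 + ?s ^ d)"
      using power_sum_le[of "{False, True}" "\<lambda>b. if b then ?s else 1" d] s by (simp add: sum_nonneg)
    also have "\<dots> \<le> 2 ^ d * (real (Suc m) ^ d + real (Suc m) ^ d * (\<Sum>q<Suc m. \<bar>w q\<bar> ^ d))"
      using power_sum_le[of "{..<Suc m}" "\<lambda>q. \<bar>w q\<bar>" d]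
      by (intro mult_left_mono add_mono) (auto simp del: sum.lessThan_Suc of_nat_Suc)
    finally have "C * (1 + ?s) ^ d \<le> C * (2 ^ d * (real (Suc m) ^ d + real (Suc m) ^ d * (\<Sum>q<Suc m. \<bar>w q\<bar> ^ d)))"
      using 1(1) by (rule mult_left_mono)
    with 1(2)[of d "Suc m" w] show ?thesis unfolding K_def
      by (simp add: algebra_simps del: sum.lessThan_Suc of_nat_Suc)
  qed
  have "integrable gauss_seq (\<lambda>w. K * (1 + (\<Sum>q<Suc m. \<bar>w q\<bar> ^ d)))"
    by (intro integrable_mult_right Bochner_Integration.integrable_add Bochner_Integration.integrable_sum
        integrable_gauss_seq_moment) simp
  then show ?thesis
    by (rule Bochner_Integration.integrable_bound)
      (use bd temperate_measurable[OF assms] in \<open>auto intro: order_trans[OF _ abs_ge_self] simp del: sum.lessThan_Suc\<close>)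
qed

lemma temperate_ibp:
  fixes f :: "(nat \<Rightarrow> real) \<Rightarrow> 'b::euclidean_space"
  assumes "\<And>w x. ((\<lambda>x. f (w(p := x))) has_vector_derivative f' (w(p := x))) (at x)"
    and "temperate f" "temperate f'"
  shows "(\<integral>w. w p *\<^sub>R f w \<partial>gauss_seq) = (\<integral>w. f' w \<partial>gauss_seq)"
  using assms by (intro gauss_seq_ibp temperate_integrable temperate_isCont temperate_scaleR temperate_coord)

section \<open>Centred quadratic forms\<close>

definition lin :: "nat \<Rightarrow> (nat \<Rightarrow> nat \<Rightarrow> real) \<Rightarrow> nat \<Rightarrow> (nat \<Rightarrow> real) \<Rightarrow> real" where
  "lin m A p w = (\<Sum>r<m. A p r * w r)"

text \<open>The subtracted trace is the expectation of the quadratic form, so these are the elements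
  of the second Wiener chaos over the first \<open>m\<close> coordinates. Matrices are total
  functions of which only the \<open>m\<close> by \<open>m\<close> block is read.\<close>

definition qf :: "nat \<Rightarrow> (nat \<Rightarrow> nat \<Rightarrow> real) \<Rightarrow> (nat \<Rightarrow> real) \<Rightarrow> real" where
  "qf m A w = (\<Sum>p<m. w p * lin m A p w) - (\<Sum>p<m. A p p)"

lemma temperate_lin [intro!]: "temperate (lin m A p)"
  unfolding lin_def[abs_def] by auto

lemma temperate_qf [intro!]: "temperate (qf m A)"
  unfolding qf_def[abs_def] by auto

lemma lin_deriv:
  assumes "p < m"
  shows "((\<lambda>x. lin m A q (w(p := x))) has_real_derivative A q p) (at x)"
proof -
  have "((\<lambda>x. \<Sum>r<m. A q r * (w(p := x)) r) has_real_derivative (\<Sum>r<m. if r = p then A q p else 0)) (at x)"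
  proof (intro DERIV_sum)
    fix r show "((\<lambda>x. A q r * (w(p := x)) r) has_real_derivative (if r = p then A q p else 0)) (at x)"
      by (cases "r = p") (auto intro!: derivative_eq_intros)
  qed
  then show ?thesis using assms by (simp add: lin_def sum.delta)
qed

lemma qf_deriv:
  assumes "p < m" and sym: "\<And>p r. p < m \<Longrightarrow> r < m \<Longrightarrow> A p r = A r p"
  shows "((\<lambda>x. qf m A (w(p := x))) has_real_derivative 2 * lin m A p (w(p := x))) (at x)"
proof -
  let ?w = "w(p := x)"
  have "((\<lambda>x. \<Sum>q<m. (w(p := x)) q * lin m A q (w(p := x))) has_real_derivative
     (\<Sum>q<m. (if q = p then lin m A p ?w else 0) + A q p * ?w q)) (at x)"
  proof (intro DERIV_sum)
    fix q show "((\<lambda>x. (w(p := x)) q * lin m A q (w(p := x))) has_real_derivative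
       (if q = p then lin m A p ?w else 0) + A q p * ?w q) (at x)"
      by (cases "q = p") (auto intro!: derivative_eq_intros lin_deriv[OF assms(1)])
  qed
  also have "(\<Sum>q<m. (if q = p then lin m A p ?w else 0) + A q p * ?w q) = lin m A p ?w + (\<Sum>q<m. A q p * ?w q)"
    using assms(1) by (simp add: sum.distrib sum.delta)
  also have "(\<Sum>q<m. A q p * ?w q) = (\<Sum>q<m. A p q * ?w q)"
    using assms(1) by (intro sum.cong) (auto simp: sym)
  also have "lin m A p ?w + (\<Sum>q<m. A p q * ?w q) = 2 * lin m A p ?w" by (simp add: lin_def)
  finally show ?thesis unfolding qf_def
    using DERIV_diff[OF _ DERIV_const[of "\<Sum>p<m. A p p"], of "\<lambda>x. \<Sum>q<m. (w(p := x)) q * lin m A q (w(p := x))"]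
    by (simp del: fun_upd_apply)
qed

text \<open>Each factor \<open>w p\<close> is integrated by parts. Differentiating
  \<open>lin m A p\<close> produces the diagonal entry \<open>A p p\<close>, and these terms cancel
  the trace; only the derivatives of \<open>\<Phi>\<close> remain.\<close>

lemma qf_ibp:
  fixes \<Phi> :: "(nat \<Rightarrow> real) \<Rightarrow> 'b::euclidean_space"
  assumes deriv: "\<And>p w x. p < m \<Longrightarrow> ((\<lambda>x. \<Phi> (w(p := x))) has_vector_derivative \<Phi>' p (w(p := x))) (at x)"
    and t: "temperate \<Phi>" "\<And>p. p < m \<Longrightarrow> temperate (\<Phi>' p)"
  shows "(\<integral>w. qf m A w *\<^sub>R \<Phi> w \<partial>gauss_seq) = (\<Sum>p<m. \<integral>w. lin m A p w *\<^sub>R \<Phi>' p w \<partial>gauss_seq)"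
proof -
  have *: "(\<integral>w. w p *\<^sub>R (lin m A p w *\<^sub>R \<Phi> w) \<partial>gauss_seq) =
      (\<integral>w. A p p *\<^sub>R \<Phi> w + lin m A p w *\<^sub>R \<Phi>' p w \<partial>gauss_seq)" if p: "p < m" for p
  proof (rule temperate_ibp)
    fix w x
    have "((\<lambda>x. lin m A p (w(p := x)) *\<^sub>R \<Phi> (w(p := x))) has_vector_derivative
           lin m A p (w(p := x)) *\<^sub>R \<Phi>' p (w(p := x)) + A p p *\<^sub>R \<Phi> (w(p := x))) (at x)"
      using p by (intro has_vector_derivative_scaleR lin_deriv deriv)
    then show "((\<lambda>x. lin m A p (w(p := x)) *\<^sub>R \<Phi> (w(p := x))) has_vector_derivative
           A p p *\<^sub>R \<Phi> (w(p := x)) + lin m A p (w(p := x)) *\<^sub>R \<Phi>' p (w(p := x))) (at x)"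
      by (simp add: add.commute)
  qed (use t p in auto)
  have i1: "integrable gauss_seq (\<lambda>w. w p *\<^sub>R (lin m A p w *\<^sub>R \<Phi> w))"
    and i2: "integrable gauss_seq (\<lambda>w. A p p *\<^sub>R \<Phi> w)" for p
    using t by (auto intro!: temperate_integrable simp del: scaleR_scaleR)
  have "(\<integral>w. qf m A w *\<^sub>R \<Phi> w \<partial>gauss_seq) =
    (\<integral>w. (\<Sum>p<m. w p *\<^sub>R (lin m A p w *\<^sub>R \<Phi> w) - A p p *\<^sub>R \<Phi> w) \<partial>gauss_seq)"
    unfolding qf_def by (simp add: scaleR_left_diff_distrib scaleR_sum_left sum_subtractf)
  also have "\<dots> = (\<Sum>p<m. (\<integral>w. w p *\<^sub>R (lin m A p w *\<^sub>R \<Phi> w) \<partial>gauss_seq) - (\<integral>w. A p p *\<^sub>R \<Phi> w \<partial>gauss_seq))"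
    using i1 i2 by (simp del: scaleR_scaleR)
  also have "\<dots> = (\<Sum>p<m. \<integral>w. lin m A p w *\<^sub>R \<Phi>' p w \<partial>gauss_seq)"
  proof (rule sum.cong[OF refl])
    fix p assume p: "p \<in> {..<m}"
    have "(\<integral>w. A p p *\<^sub>R \<Phi> w + lin m A p w *\<^sub>R \<Phi>' p w \<partial>gauss_seq) =
      (\<integral>w. A p p *\<^sub>R \<Phi> w \<partial>gauss_seq) + (\<integral>w. lin m A p w *\<^sub>R \<Phi>' p w \<partial>gauss_seq)"
      using t p by (intro Bochner_Integration.integral_add temperate_integrable) auto
    then show "(\<integral>w. w p *\<^sub>R (lin m A p w *\<^sub>R \<Phi> w) \<partial>gauss_seq) - (\<integral>w. A p p *\<^sub>R \<Phi> w \<partial>gauss_seq)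
      = (\<integral>w. lin m A p w *\<^sub>R \<Phi>' p w \<partial>gauss_seq)"
      using * p by simp
  qed
  finally show ?thesis .
qed

lemma gauss_seq_covariance: "(\<integral>w. w p * w q \<partial>gauss_seq) = (if p = q then 1 else 0)"
proof -
  have "(\<integral>w. w p *\<^sub>R w q \<partial>gauss_seq) = (\<integral>w. (if p = q then 1 else 0) \<partial>gauss_seq)"
  proof (rule temperate_ibp)
    show "((\<lambda>x. (w(p := x)) q) has_vector_derivative (if p = q then 1 else 0)) (at x)" for w and x :: real
      by (cases "p = q") (auto intro!: derivative_eq_intros)
  qed auto
  then show ?thesis by simp
qed

lemma lin_covariance: "(\<integral>w. lin m A p w * lin m B q w \<partial>gauss_seq) = (\<Sum>r<m. A p r * B q r)"
proof -
  have i: "integrable gauss_seq (\<lambda>w. (A p r * B q s) * (w r * w s))" for r s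
    by (intro temperate_integrable) auto
  have "(\<integral>w. lin m A p w * lin m B q w \<partial>gauss_seq) =
    (\<integral>w. (\<Sum>r<m. \<Sum>s<m. (A p r * B q s) * (w r * w s)) \<partial>gauss_seq)"
    unfolding lin_def by (simp add: sum_product mult_ac)
  also have "\<dots> = (\<Sum>r<m. \<Sum>s<m. (A p r * B q s) * (\<integral>w. w r * w s \<partial>gauss_seq))"
    using i by simp
  also have "\<dots> = (\<Sum>r<m. A p r * B q r)"
    by (simp add: gauss_seq_covariance sum.delta' if_distrib cong: if_cong sum.cong_simp)
  finally show ?thesis .
qed

text \<open>This is \<open>qf_ibp\<close> with \<open>qf m B\<close> as test function: its gradient
  is \<open>2 * lin m B\<close>, whence the factor 2 and the symmetry required of
  \<open>B\<close>.\<close>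

lemma qf_covariance:
  assumes "\<And>p r. p < m \<Longrightarrow> r < m \<Longrightarrow> B p r = B r p"
  shows "(\<integral>w. qf m A w * qf m B w \<partial>gauss_seq) = 2 * (\<Sum>p<m. \<Sum>r<m. A p r * B p r)"
proof -
  have "(\<integral>w. qf m A w *\<^sub>R qf m B w \<partial>gauss_seq) = (\<Sum>p<m. \<integral>w. lin m A p w *\<^sub>R (2 * lin m B p w) \<partial>gauss_seq)"
    by (rule qf_ibp) (auto intro!: qf_deriv assms simp flip: has_real_derivative_iff_has_vector_derivative)
  also have "\<dots> = (\<Sum>p<m. 2 * (\<integral>w. lin m A p w * lin m B p w \<partial>gauss_seq))"
    by (simp add: mult_ac)
  finally show ?thesis by (simp add: lin_covariance sum_distrib_left)
qed

section \<open>Quadratic forms in Gaussian variables\<close>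

text \<open>The matrix \<open>A^T A\<close>. It turns the squared length of \<open>A w\<close>,
  which is a quarter of the squared gradient of \<open>qf m A\<close> when \<open>A\<close> is
  symmetric, into a quadratic form again.\<close>

definition gram :: "nat \<Rightarrow> (nat \<Rightarrow> nat \<Rightarrow> real) \<Rightarrow> nat \<Rightarrow> nat \<Rightarrow> real" where
  "gram m A p r = (\<Sum>q<m. A q p * A q r)"

lemma gram_sym: "gram m A p r = gram m A r p"
  by (simp add: gram_def mult.commute)

text \<open>The left side is \<open>w^T (A^T A) w\<close>, and the trace of \<open>A^T A\<close> is
  the squared Hilbert-Schmidt norm of \<open>A\<close>; the identity splits the left side into its
  fluctuation and its mean.\<close>

lemma sum_lin_square: "(\<Sum>p<m. (lin m A p w)\<^sup>2) = qf m (gram m A) w + (\<Sum>p<m. \<Sum>r<m. (A p r)\<^sup>2)"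
proof -
  have "(\<Sum>p<m. (lin m A p w)\<^sup>2) = (\<Sum>p<m. \<Sum>r<m. \<Sum>s<m. w r * (A p r * A p s * w s))"
    by (simp add: lin_def power2_eq_square sum_product mult_ac)
  also have "\<dots> = (\<Sum>r<m. \<Sum>s<m. \<Sum>p<m. w r * (A p r * A p s * w s))"
    by (subst sum.swap, rule sum.cong[OF refl], subst sum.swap, rule refl)
  also have "\<dots> = (\<Sum>r<m. w r * lin m (gram m A) r w)"
    by (simp add: lin_def gram_def sum_distrib_left sum_distrib_right mult_ac)
  finally have 1: "(\<Sum>p<m. (lin m A p w)\<^sup>2) = (\<Sum>r<m. w r * lin m (gram m A) r w)" .
  have "(\<Sum>p<m. gram m A p p) = (\<Sum>p<m. \<Sum>r<m. (A p r)\<^sup>2)"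
    unfolding gram_def by (subst sum.swap) (simp add: power2_eq_square)
  then show ?thesis using 1 by (simp add: qf_def)
qed

text \<open>Submultiplicativity of the Hilbert-Schmidt norm, by Cauchy-Schwarz for each pair of
  columns.\<close>

lemma gram_square_le: "(\<Sum>p<m. \<Sum>r<m. (gram m A p r)\<^sup>2) \<le> (\<Sum>p<m. \<Sum>r<m. (A p r)\<^sup>2)\<^sup>2"
proof -
  have "(\<Sum>p<m. \<Sum>r<m. (gram m A p r)\<^sup>2) \<le> (\<Sum>p<m. \<Sum>r<m. (\<Sum>q<m. (A q p)\<^sup>2) * (\<Sum>q<m. (A q r)\<^sup>2))"
    unfolding gram_def by (intro sum_mono Cauchy_Schwarz_ineq_sum)
  also have "\<dots> = (\<Sum>p<m. \<Sum>q<m. (A q p)\<^sup>2)\<^sup>2"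
    by (simp add: power2_eq_square sum_product)
  also have "(\<Sum>p<m. \<Sum>q<m. (A q p)\<^sup>2) = (\<Sum>p<m. \<Sum>r<m. (A p r)\<^sup>2)"
    by (rule sum.swap)
  finally show ?thesis .
qed

lemma qf_expectation [simp]: "(\<integral>w. qf m A w \<partial>gauss_seq) = 0"
proof -
  have "(\<integral>w. qf m A w *\<^sub>R (1::real) \<partial>gauss_seq) = (\<Sum>p<m. \<integral>w. lin m A p w *\<^sub>R 0 \<partial>gauss_seq)"
    by (rule qf_ibp) auto
  then show ?thesis by simp
qed

text \<open>The constant is \<open>2 + 1\<close>: the variance is at most twice the square of the
  mean.\<close>

lemma sum_lin_square_second_moment:
  "(\<integral>w. (\<Sum>p<m. (lin m A p w)\<^sup>2)\<^sup>2 \<partial>gauss_seq) \<le> 3 * (\<Sum>p<m. \<Sum>r<m. (A p r)\<^sup>2)\<^sup>2"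
proof -
  define \<tau> where "\<tau> = (\<Sum>p<m. \<Sum>r<m. (A p r)\<^sup>2)"
  let ?D = "qf m (gram m A)"
  have "(\<integral>w. (\<Sum>p<m. (lin m A p w)\<^sup>2)\<^sup>2 \<partial>gauss_seq) = (\<integral>w. ?D w * ?D w + (2 * \<tau>) * ?D w + \<tau>\<^sup>2 \<partial>gauss_seq)"
    unfolding sum_lin_square \<tau>_def[symmetric] by (intro arg_cong[where f = "integral\<^sup>L _"] ext) (simp add: power2_eq_square algebra_simps)
  also have "\<dots> = (\<integral>w. ?D w * ?D w \<partial>gauss_seq) + (\<integral>w. (2 * \<tau>) * ?D w \<partial>gauss_seq) + (\<integral>w. \<tau>\<^sup>2 \<partial>gauss_seq)"
    by (subst Bochner_Integration.integral_add, (rule temperate_integrable; auto)+)+ simp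
  also have "\<dots> = 2 * (\<Sum>p<m. \<Sum>r<m. (gram m A p r)\<^sup>2) + \<tau>\<^sup>2"
    by (subst qf_covariance) (auto simp: gram_sym[of m A] power2_eq_square)
  also have "\<dots> \<le> 2 * \<tau>\<^sup>2 + \<tau>\<^sup>2"
    using gram_square_le[of m A] unfolding \<tau>_def by simp
  finally show ?thesis by (simp add: \<tau>_def)
qed

lemma temperate_divide [intro!]: "temperate f \<Longrightarrow> temperate (\<lambda>w. f w / (c::real))"
  using temperate_mult[of f "\<lambda>_. inverse c"] by (auto simp: divide_inverse)

text \<open>Write \<open>Q^4 = Q * Q^3\<close> and integrate by parts to get
  \<open>6 E (Q^2 |A w|^2)\<close>. By Young's inequality half of \<open>E Q^4\<close> is absorbed
  on the left, which leaves \<open>36 E |A w|^4\<close>; the previous bound then gives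
  \<open>36 * 3 = 108\<close>.\<close>

lemma qf_fourth_moment:
  assumes sym: "\<And>p r. p < m \<Longrightarrow> r < m \<Longrightarrow> A p r = A r p"
  shows "(\<integral>w. (qf m A w) ^ 4 \<partial>gauss_seq) \<le> 108 * (\<Sum>p<m. \<Sum>r<m. (A p r)\<^sup>2)\<^sup>2"
proof -
  let ?Q = "qf m A" and ?N = "\<lambda>w. \<Sum>p<m. (lin m A p w)\<^sup>2"
  have "(\<integral>w. ?Q w *\<^sub>R (?Q w ^ 3) \<partial>gauss_seq) = (\<Sum>p<m. \<integral>w. lin m A p w *\<^sub>R (3 * (?Q w)\<^sup>2 * (2 * lin m A p w)) \<partial>gauss_seq)"
  proof (rule qf_ibp)
    fix p w x assume "p < m"
    note [derivative_intros] = qf_deriv[OF \<open>p < m\<close> sym]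
    show "((\<lambda>x. ?Q (w(p := x)) ^ 3) has_vector_derivative (3 * (?Q (w(p := x)))\<^sup>2 * (2 * lin m A p (w(p := x))))) (at x)"
      unfolding has_real_derivative_iff_has_vector_derivative[symmetric]
      by (auto intro!: derivative_eq_intros)
  qed auto
  also have "\<dots> = (\<integral>w. 6 * (?Q w)\<^sup>2 * ?N w \<partial>gauss_seq)"
    by (subst Bochner_Integration.integral_sum[symmetric])
      (auto intro!: temperate_integrable Bochner_Integration.integral_cong sum.cong
        simp: sum_distrib_left power2_eq_square mult_ac)
  also have "\<dots> \<le> (\<integral>w. 1/2 * ?Q w ^ 4 + 18 * (?N w)\<^sup>2 \<partial>gauss_seq)"
  proof (intro integral_mono temperate_integrable)
    fix w
    have "0 \<le> ((?Q w)\<^sup>2 - 6 * ?N w)\<^sup>2" by simp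
    then show "6 * (?Q w)\<^sup>2 * ?N w \<le> 1/2 * ?Q w ^ 4 + 18 * (?N w)\<^sup>2"
      by (simp add: power2_eq_square power4_eq_xxxx algebra_simps)
  qed auto
  also have "\<dots> = 1/2 * (\<integral>w. ?Q w ^ 4 \<partial>gauss_seq) + 18 * (\<integral>w. (?N w)\<^sup>2 \<partial>gauss_seq)"
    by (subst Bochner_Integration.integral_add) (auto intro!: temperate_integrable)
  finally have "(\<integral>w. ?Q w ^ 4 \<partial>gauss_seq) \<le> 36 * (\<integral>w. (?N w)\<^sup>2 \<partial>gauss_seq)"
    by (simp add: power4_eq_xxxx power3_eq_cube mult_ac)
  then show ?thesis using sum_lin_square_second_moment[of m A] by linarith
qed

section \<open>Stability of characteristic functions and their derivative in a parameter\<close>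

lemma (in prob_space) expectation_abs_le_sqrt:
  fixes X :: "'a \<Rightarrow> real"
  assumes [measurable]: "X \<in> borel_measurable M" and X2: "integrable M (\<lambda>w. (X w)\<^sup>2)"
  shows "(\<integral>w. \<bar>X w\<bar> \<partial>M) \<le> sqrt (\<integral>w. (X w)\<^sup>2 \<partial>M)"
proof (rule real_le_rsqrt)
  have i: "integrable M X"
    using square_integrable_imp_integrable[OF _ X2] by simp
  show "(\<integral>w. \<bar>X w\<bar> \<partial>M)\<^sup>2 \<le> (\<integral>w. (X w)\<^sup>2 \<partial>M)"
    using variance_positive[of "\<lambda>w. \<bar>X w\<bar>"] variance_eq[of "\<lambda>w. \<bar>X w\<bar>"] i X2 by simp
qed

lemma norm_iexp_diff: "norm (iexp x - iexp y) \<le> \<bar>x - y\<bar>"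
proof -
  have "iexp x - iexp y = iexp y * (iexp (x - y) - 1)"
    by (simp add: algebra_simps flip: exp_add)
  then have "norm (iexp x - iexp y) = norm (iexp (x - y) - 1)"
    by (simp add: norm_mult)
  then show ?thesis using iexp_approx1[of "x - y" 0] by simp
qed

lemma (in prob_space) norm_iexp_diff_le:
  fixes X Y :: "'a \<Rightarrow> real"
  assumes [measurable]: "X \<in> borel_measurable M" "Y \<in> borel_measurable M" and i: "integrable M (\<lambda>w. X w - Y w)"
  shows "norm ((\<integral>w. iexp (X w) \<partial>M) - (\<integral>w. iexp (Y w) \<partial>M)) \<le> (\<integral>w. \<bar>X w - Y w\<bar> \<partial>M)"
proof -
  have ie: "integrable M (\<lambda>w. iexp (Z w))" if [measurable]: "Z \<in> borel_measurable M" for Z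
    by (rule integrable_const_bound[of _ 1]) auto
  have "norm ((\<integral>w. iexp (X w) \<partial>M) - (\<integral>w. iexp (Y w) \<partial>M)) = norm (\<integral>w. iexp (X w) - iexp (Y w) \<partial>M)"
    by (simp add: ie)
  also have "\<dots> \<le> (\<integral>w. norm (iexp (X w) - iexp (Y w)) \<partial>M)"
    by (rule integral_norm_bound)
  also have "\<dots> \<le> (\<integral>w. \<bar>X w - Y w\<bar> \<partial>M)"
  proof (intro integral_mono)
    show "norm (iexp (X w) - iexp (Y w)) \<le> \<bar>X w - Y w\<bar>" for w by (rule norm_iexp_diff)
  qed (use i ie in auto)
  finally show ?thesis .
qed

text \<open>The Taylor remainder of \<open>iexp\<close> after the linear term is at most
  \<open>(h * X)^2 / 2\<close>. Integrated, it bounds the error of the difference quotient by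
  \<open>\<bar>h\<bar>\<close> times half the second moment of \<open>X\<close>.\<close>

lemma (in prob_space) iexp_expectation_deriv:
  fixes X Y :: "'a \<Rightarrow> real"
  assumes [measurable]: "Y \<in> borel_measurable M" "X \<in> borel_measurable M" and X2: "integrable M (\<lambda>w. (X w)\<^sup>2)"
  shows "((\<lambda>\<theta>. \<integral>w. iexp (Y w + \<theta> * X w) \<partial>M) has_vector_derivative
     \<i> * (\<integral>w. X w *\<^sub>R iexp (Y w + \<theta> * X w) \<partial>M)) (at \<theta>)"
proof -
  let ?e = "\<lambda>\<theta> w. iexp (Y w + \<theta> * X w)"
  let ?I = "\<integral>w. (X w)\<^sup>2 \<partial>M"
  have X: "integrable M X" using square_integrable_imp_integrable[OF _ X2] by simp
  have i1: "integrable M (?e \<theta>)" for \<theta> by (rule integrable_const_bound[of _ 1]) auto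
  have i2: "integrable M (\<lambda>w. X w *\<^sub>R ?e \<theta> w)" for \<theta>
    by (rule Bochner_Integration.integrable_bound[OF X]) auto
  have bd: "norm ((\<integral>w. ?e y w \<partial>M) - (\<integral>w. ?e \<theta> w \<partial>M) - (y - \<theta>) *\<^sub>R (\<i> * (\<integral>w. X w *\<^sub>R ?e \<theta> w \<partial>M)))
     \<le> (y - \<theta>)\<^sup>2 * ?I / 2" for y
  proof -
    define h where "h = y - \<theta>"
    have "(\<integral>w. ?e y w \<partial>M) - (\<integral>w. ?e \<theta> w \<partial>M) - (y - \<theta>) *\<^sub>R (\<i> * (\<integral>w. X w *\<^sub>R ?e \<theta> w \<partial>M))
       = (\<integral>w. ?e y w - ?e \<theta> w - (h *\<^sub>R \<i>) * (X w *\<^sub>R ?e \<theta> w) \<partial>M)"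
      by (simp only: h_def Bochner_Integration.integral_diff[OF Bochner_Integration.integrable_diff[OF i1 i1]
          integrable_mult_right[OF i2]] Bochner_Integration.integral_diff[OF i1 i1] integral_mult_right_zero
          mult_scaleR_left[symmetric])
    also have "norm \<dots> \<le> (\<integral>w. h\<^sup>2 / 2 * (X w)\<^sup>2 \<partial>M)"
    proof (rule order_trans[OF integral_norm_bound], rule integral_mono)
      show "integrable M (\<lambda>w. norm (?e y w - ?e \<theta> w - (h *\<^sub>R \<i>) * (X w *\<^sub>R ?e \<theta> w)))"
        using i1 i2 by (intro integrable_norm Bochner_Integration.integrable_diff integrable_mult_right) auto
      fix w
      have "?e y w - ?e \<theta> w - (h *\<^sub>R \<i>) * (X w *\<^sub>R ?e \<theta> w) =
         ?e \<theta> w * (iexp (h * X w) - (\<Sum>k\<le>1. (\<i> * (h * X w)) ^ k / fact k))"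
        by (simp add: algebra_simps h_def scaleR_conv_of_real flip: exp_add)
      then have "norm (?e y w - ?e \<theta> w - (h *\<^sub>R \<i>) * (X w *\<^sub>R ?e \<theta> w)) =
        norm (iexp (h * X w) - (\<Sum>k\<le>1. (\<i> * (h * X w)) ^ k / fact k))"
        by (simp only: norm_mult norm_exp_i_times mult_1_left)
      also have "\<dots> \<le> \<bar>h * X w\<bar> ^ Suc 1 / fact (Suc 1)"
        using iexp_approx1[of "h * X w" 1] by simp
      also have "\<dots> = h\<^sup>2 / 2 * (X w)\<^sup>2"
        by (simp add: power2_eq_square abs_mult fact_numeral mult_ac flip: power2_abs)
      finally show "norm (?e y w - ?e \<theta> w - (h *\<^sub>R \<i>) * (X w *\<^sub>R ?e \<theta> w)) \<le> h\<^sup>2 / 2 * (X w)\<^sup>2" .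
    qed (use X2 in auto)
    finally show ?thesis by (simp add: h_def)
  qed
  show ?thesis unfolding has_vector_derivative_def
  proof (rule has_derivativeI_sandwich[of 1 _ _ _ _ "\<lambda>y. \<bar>y - \<theta>\<bar> * ?I / 2"])
    fix y :: real assume "y \<noteq> \<theta>"
    then show "norm ((\<integral>w. ?e y w \<partial>M) - (\<integral>w. ?e \<theta> w \<partial>M) - (y - \<theta>) *\<^sub>R (\<i> * (\<integral>w. X w *\<^sub>R ?e \<theta> w \<partial>M))) / norm (y - \<theta>)
       \<le> \<bar>y - \<theta>\<bar> * ?I / 2"
      using bd[of y] by (simp add: divide_le_eq power2_eq_square abs_mult_self_eq mult_ac)
  qed (auto intro!: tendsto_eq_intros bounded_linear_scaleR_left)
qed

lemma temperate_iexp: "temperate f \<Longrightarrow> temperate (\<lambda>w. iexp (f w))"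
  by (rule temperate_bounded[of _ 1]) (auto simp: temperate_def intro!: continuous_intros)

text \<open>Here \<open>B\<close> is the head and \<open>A\<close> the tail. The variance of
  \<open>qf m A\<close> is \<open>2 * \<tau>\<close>, so \<open>exp (-\<tau>)\<close> is the
  characteristic function at 1 of a Gaussian variable with the same variance: up to the error,
  \<open>qf m A\<close> acts like such a variable independent of \<open>qf m B\<close>. The error
  has two sources, the interaction \<open>\<omega>\<close> of the gradients and the fluctuation of
  \<open>|A w|^2\<close> about its mean \<open>\<tau>\<close>.\<close>

lemma iexp_qf_perturbation:
  assumes symA: "\<And>p r. p < m \<Longrightarrow> r < m \<Longrightarrow> A p r = A r p"
    and symB: "\<And>p r. p < m \<Longrightarrow> r < m \<Longrightarrow> B p r = B r p"
    and \<epsilon>: "\<epsilon> \<ge> 0" "\<And>x. (\<Sum>p<m. (lin m A p x)\<^sup>2) \<le> \<epsilon>\<^sup>2 * (\<Sum>p<m. (x p)\<^sup>2)"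
    and \<omega>: "(\<integral>w. \<bar>\<Sum>p<m. lin m A p w * lin m B p w\<bar> \<partial>gauss_seq) \<le> \<omega>"
  defines "\<tau> \<equiv> (\<Sum>p<m. \<Sum>r<m. (A p r)\<^sup>2)"
  shows "norm ((\<integral>w. iexp (qf m B w + qf m A w) \<partial>gauss_seq) - exp (-\<tau>) *\<^sub>R (\<integral>w. iexp (qf m B w) \<partial>gauss_seq))
     \<le> 2 * \<omega> + 2 * sqrt 2 * \<epsilon> * sqrt \<tau>"
proof -
  define \<Phi> where "\<Phi> \<theta> w = iexp (qf m B w + \<theta> * qf m A w)" for \<theta> w
  define \<psi> where "\<psi> \<theta> = (\<integral>w. \<Phi> \<theta> w \<partial>gauss_seq)" for \<theta>
  define W where "W w = (\<Sum>p<m. lin m A p w * lin m B p w)" for w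
  define N where "N w = (\<Sum>p<m. (lin m A p w)\<^sup>2)" for w
  \<comment> \<open>\<open>E\<close> is the defect in the equation
    \<open>\<psi>' = - 2 \<theta> \<tau> \<psi>\<close>: it would vanish if the gradients were
    orthogonal (\<open>W = 0\<close>) and the squared gradient of the tail were constant
    (\<open>N = \<tau>\<close>).\<close>
  define E where "E \<theta> = (\<integral>w. (W w + \<theta> * (N w - \<tau>)) *\<^sub>R \<Phi> \<theta> w \<partial>gauss_seq)" for \<theta>
  have tW [intro!]: "temperate W" and tN [intro!]: "temperate N" and t\<Phi> [intro!]: "temperate (\<Phi> \<theta>)" for \<theta>
    unfolding W_def[abs_def] N_def[abs_def] \<Phi>_def[abs_def]
    by (auto simp del: of_real_add intro!: temperate_iexp)
  have tis: "temperate f \<Longrightarrow> temperate (\<lambda>w. \<i> * f w)" for f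
    by (auto simp: temperate_def norm_mult intro!: continuous_intros)
  have norm\<Phi>: "norm (\<Phi> \<theta> w) = 1" for \<theta> w by (simp add: \<Phi>_def)
  have ND: "N w - \<tau> = qf m (gram m A) w" for w
    unfolding N_def \<tau>_def by (simp add: sum_lin_square)
  have tau: "\<tau> \<ge> 0" unfolding \<tau>_def by (intro sum_nonneg) auto
  have "(\<integral>w. \<bar>N w - \<tau>\<bar> \<partial>gauss_seq) \<le> sqrt (\<integral>w. (N w - \<tau>)\<^sup>2 \<partial>gauss_seq)"
    by (intro gauss_seq.expectation_abs_le_sqrt temperate_integrable temperate_measurable) auto
  also have "(\<integral>w. (N w - \<tau>)\<^sup>2 \<partial>gauss_seq) = 2 * (\<Sum>r<m. \<Sum>p<m. (gram m A p r)\<^sup>2)"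
    unfolding ND power2_eq_square by (subst qf_covariance) (auto simp: gram_sym[of m A])
  \<comment> \<open>By symmetry, column \<open>r\<close> of \<open>A^T A\<close> is \<open>A\<close>
    applied to column \<open>r\<close> of \<open>A\<close>. The operator bound is used for one
    factor \<open>A\<close> and the Hilbert-Schmidt norm for the other, so the fluctuation is small
    even if \<open>\<tau>\<close> is not.\<close>
  also have "(\<Sum>r<m. \<Sum>p<m. (gram m A p r)\<^sup>2) \<le> (\<Sum>r<m. \<epsilon>\<^sup>2 * (\<Sum>q<m. (A q r)\<^sup>2))"
  proof (rule sum_mono)
    fix r
    have "(\<Sum>p<m. (gram m A p r)\<^sup>2) = (\<Sum>p<m. (lin m A p (\<lambda>q. A q r))\<^sup>2)"
      unfolding gram_def lin_def by (intro sum.cong arg_cong[where f = "\<lambda>x. x\<^sup>2"]) (auto simp: symA)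
    then show "(\<Sum>p<m. (gram m A p r)\<^sup>2) \<le> \<epsilon>\<^sup>2 * (\<Sum>q<m. (A q r)\<^sup>2)" using \<epsilon>(2) by simp
  qed
  also have "\<dots> = \<epsilon>\<^sup>2 * \<tau>" unfolding \<tau>_def sum_distrib_left by (rule sum.swap)
  finally have Nbd: "(\<integral>w. \<bar>N w - \<tau>\<bar> \<partial>gauss_seq) \<le> sqrt 2 * \<epsilon> * sqrt \<tau>"
    using \<epsilon>(1) by (simp add: real_sqrt_mult)
  have Ebd: "norm (E \<theta>) \<le> \<omega> + sqrt 2 * \<epsilon> * sqrt \<tau>" if \<theta>: "\<theta> \<in> {0..1}" for \<theta>
  proof -
    have "norm (E \<theta>) \<le> (\<integral>w. norm ((W w + \<theta> * (N w - \<tau>)) *\<^sub>R \<Phi> \<theta> w) \<partial>gauss_seq)"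
      unfolding E_def by (rule integral_norm_bound)
    also have "\<dots> \<le> (\<integral>w. \<bar>W w\<bar> + \<bar>N w - \<tau>\<bar> \<partial>gauss_seq)"
    proof (intro integral_mono temperate_integrable temperate_norm temperate_scaleR)
      fix w
      have "\<bar>W w + \<theta> * (N w - \<tau>)\<bar> \<le> \<bar>W w\<bar> + \<bar>\<theta>\<bar> * \<bar>N w - \<tau>\<bar>"
        by (metis abs_mult abs_triangle_ineq)
      also have "\<bar>\<theta>\<bar> * \<bar>N w - \<tau>\<bar> \<le> \<bar>N w - \<tau>\<bar>" using \<theta> by (simp add: mult_left_le_one_le)
      finally show "norm ((W w + \<theta> * (N w - \<tau>)) *\<^sub>R \<Phi> \<theta> w) \<le> \<bar>W w\<bar> + \<bar>N w - \<tau>\<bar>"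
        by (simp add: norm\<Phi>)
    qed auto
    also have "\<dots> = (\<integral>w. \<bar>W w\<bar> \<partial>gauss_seq) + (\<integral>w. \<bar>N w - \<tau>\<bar> \<partial>gauss_seq)"
      by (intro Bochner_Integration.integral_add temperate_integrable) auto
    finally show ?thesis using Nbd \<omega> unfolding W_def by linarith
  qed
  have \<psi>': "(\<psi> has_vector_derivative - (2 * \<theta> * \<tau>) *\<^sub>R \<psi> \<theta> - 2 * E \<theta>) (at \<theta>)" for \<theta>
  proof -
    have "(\<integral>w. qf m A w *\<^sub>R \<Phi> \<theta> w \<partial>gauss_seq) =
      (\<Sum>p<m. \<integral>w. lin m A p w *\<^sub>R ((2 * lin m B p w + \<theta> * (2 * lin m A p w)) *\<^sub>R (\<i> * \<Phi> \<theta> w)) \<partial>gauss_seq)"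
    proof (rule qf_ibp)
      fix p w x assume p: "p < m"
      have d: "((\<lambda>x. qf m B (w(p := x)) + \<theta> * qf m A (w(p := x))) has_vector_derivative
          (2 * lin m B p (w(p := x)) + \<theta> * (2 * lin m A p (w(p := x))))) (at x)"
        unfolding has_real_derivative_iff_has_vector_derivative[symmetric]
        by (intro DERIV_add DERIV_cmult qf_deriv p symA symB)
      show "((\<lambda>x. \<Phi> \<theta> (w(p := x))) has_vector_derivative
          (2 * lin m B p (w(p := x)) + \<theta> * (2 * lin m A p (w(p := x)))) *\<^sub>R (\<i> * \<Phi> \<theta> (w(p := x)))) (at x)"
        unfolding \<Phi>_def using vector_diff_chain_at[OF d has_vector_derivative_iexp] by (simp add: comp_def)
    qed (auto intro!: tis)
    also have "\<dots> = (\<integral>w. (\<Sum>p<m. lin m A p w *\<^sub>R ((2 * lin m B p w + \<theta> * (2 * lin m A p w)) *\<^sub>R (\<i> * \<Phi> \<theta> w))) \<partial>gauss_seq)"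
      by (rule Bochner_Integration.integral_sum[symmetric])
        (auto intro!: temperate_integrable tis simp del: scaleR_scaleR)
    also have "\<dots> = (\<integral>w. (2 * \<i>) * ((\<theta> * \<tau>) *\<^sub>R \<Phi> \<theta> w + (W w + \<theta> * (N w - \<tau>)) *\<^sub>R \<Phi> \<theta> w) \<partial>gauss_seq)"
    proof (rule Bochner_Integration.integral_cong[OF refl])
      fix w
      have "(\<Sum>p<m. lin m A p w *\<^sub>R ((2 * lin m B p w + \<theta> * (2 * lin m A p w)) *\<^sub>R (\<i> * \<Phi> \<theta> w))) =
        (\<Sum>p<m. 2 * (lin m A p w * lin m B p w) + 2 * \<theta> * (lin m A p w)\<^sup>2) *\<^sub>R (\<i> * \<Phi> \<theta> w)"
        unfolding scaleR_sum_left by (intro sum.cong) (auto simp: power2_eq_square algebra_simps)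
      also have "(\<Sum>p<m. 2 * (lin m A p w * lin m B p w) + 2 * \<theta> * (lin m A p w)\<^sup>2) = 2 * W w + 2 * \<theta> * N w"
        unfolding W_def N_def by (simp add: sum.distrib sum_distrib_left)
      also have "(2 * W w + 2 * \<theta> * N w) *\<^sub>R (\<i> * \<Phi> \<theta> w) =
         (2 * \<i>) * ((\<theta> * \<tau>) *\<^sub>R \<Phi> \<theta> w + (W w + \<theta> * (N w - \<tau>)) *\<^sub>R \<Phi> \<theta> w)"
        by (simp add: scaleR_conv_of_real algebra_simps)
      finally show "(\<Sum>p<m. lin m A p w *\<^sub>R ((2 * lin m B p w + \<theta> * (2 * lin m A p w)) *\<^sub>R (\<i> * \<Phi> \<theta> w))) =
         (2 * \<i>) * ((\<theta> * \<tau>) *\<^sub>R \<Phi> \<theta> w + (W w + \<theta> * (N w - \<tau>)) *\<^sub>R \<Phi> \<theta> w)" .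
    qed
    also have "\<dots> = (2 * \<i>) * (\<integral>w. ((\<theta> * \<tau>) *\<^sub>R \<Phi> \<theta> w + (W w + \<theta> * (N w - \<tau>)) *\<^sub>R \<Phi> \<theta> w) \<partial>gauss_seq)"
      by (rule integral_mult_right_zero)
    also have "(\<integral>w. ((\<theta> * \<tau>) *\<^sub>R \<Phi> \<theta> w + (W w + \<theta> * (N w - \<tau>)) *\<^sub>R \<Phi> \<theta> w) \<partial>gauss_seq) = (\<theta> * \<tau>) *\<^sub>R \<psi> \<theta> + E \<theta>"
      unfolding \<psi>_def E_def by (subst Bochner_Integration.integral_add) (auto intro!: temperate_integrable simp del: scaleR_scaleR)
    finally have *: "\<i> * (\<integral>w. qf m A w *\<^sub>R \<Phi> \<theta> w \<partial>gauss_seq) = - (2 * \<theta> * \<tau>) *\<^sub>R \<psi> \<theta> - 2 * E \<theta>"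
      by (simp add: algebra_simps scaleR_conv_of_real)
    show ?thesis unfolding *[symmetric] unfolding \<psi>_def[abs_def] \<Phi>_def
      by (intro gauss_seq.iexp_expectation_deriv temperate_integrable temperate_measurable) auto
  qed
  \<comment> \<open>\<open>exp (\<tau> * \<theta>^2)\<close> is the integrating factor of the
    equation for \<open>\<psi>\<close>, so that only the defect \<open>E\<close> is left in the
    derivative of \<open>u\<close>.\<close>
  define u where "u \<theta> = exp (\<tau> * \<theta>\<^sup>2) *\<^sub>R \<psi> \<theta>" for \<theta>
  have u': "(u has_vector_derivative (- 2 * exp (\<tau> * \<theta>\<^sup>2)) *\<^sub>R E \<theta>) (at \<theta>)" for \<theta>
  proof -
    have "((\<lambda>\<theta>. exp (\<tau> * \<theta>\<^sup>2)) has_real_derivative exp (\<tau> * \<theta>\<^sup>2) * (2 * \<tau> * \<theta>)) (at \<theta>)"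
      by (auto intro!: derivative_eq_intros)
    from has_vector_derivative_scaleR[OF this \<psi>'[of \<theta>]] show ?thesis
      unfolding u_def by (rule has_vector_derivative_eq_rhs) (simp add: algebra_simps scaleR_conv_of_real)
  qed
  have "norm (u 1 - u 0) \<le> (2 * exp \<tau> * (\<omega> + sqrt 2 * \<epsilon> * sqrt \<tau>)) * norm (1 - 0 :: real)"
  proof (rule differentiable_bound[of "{0..1}" u "\<lambda>\<theta> h. h *\<^sub>R ((- 2 * exp (\<tau> * \<theta>\<^sup>2)) *\<^sub>R E \<theta>)"])
    fix \<theta> :: real assume \<theta>: "\<theta> \<in> {0..1}"
    show "(u has_derivative (\<lambda>h. h *\<^sub>R ((- 2 * exp (\<tau> * \<theta>\<^sup>2)) *\<^sub>R E \<theta>))) (at \<theta> within {0..1})"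
      using u' by (simp add: has_vector_derivative_def has_derivative_at_withinI)
    have "norm ((- 2 * exp (\<tau> * \<theta>\<^sup>2)) *\<^sub>R E \<theta>) \<le> 2 * exp \<tau> * (\<omega> + sqrt 2 * \<epsilon> * sqrt \<tau>)"
    proof -
      have "\<tau> * \<theta>\<^sup>2 \<le> \<tau>" using \<theta> tau by (simp add: mult_left_le power_le_one)
      then have "2 * exp (\<tau> * \<theta>\<^sup>2) * norm (E \<theta>) \<le> 2 * exp \<tau> * (\<omega> + sqrt 2 * \<epsilon> * sqrt \<tau>)"
        using Ebd[OF \<theta>] by (intro mult_mono) auto
      then show ?thesis by simp
    qed
    then show "onorm (\<lambda>h. h *\<^sub>R ((- 2 * exp (\<tau> * \<theta>\<^sup>2)) *\<^sub>R E \<theta>)) \<le> 2 * exp \<tau> * (\<omega> + sqrt 2 * \<epsilon> * sqrt \<tau>)"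
      by (intro onorm_le) (simp add: mult.commute mult_left_mono abs_mult)
  qed auto
  then have "exp (-\<tau>) * norm (u 1 - u 0) \<le> exp (-\<tau>) * (2 * exp \<tau> * (\<omega> + sqrt 2 * \<epsilon> * sqrt \<tau>))"
    by (intro mult_left_mono) auto
  also have "\<dots> = 2 * \<omega> + 2 * sqrt 2 * \<epsilon> * sqrt \<tau>"
    by (simp add: exp_minus field_simps)
  also have "exp (-\<tau>) * norm (u 1 - u 0) = norm (exp (-\<tau>) *\<^sub>R (u 1 - u 0))"
    by simp
  also have "exp (-\<tau>) *\<^sub>R (u 1 - u 0) = \<psi> 1 - exp (-\<tau>) *\<^sub>R \<psi> 0"
    by (simp add: u_def scaleR_diff_right flip: exp_add)
  finally show ?thesis by (simp add: \<psi>_def \<Phi>_def)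
qed

section \<open>Characteristic functions of random vectors\<close>

text \<open>The weights, divided by their common mass \<open>c\<close>, become densities, and Levy's
  one-dimensional uniqueness theorem applies to the tilted laws of \<open>X\<close> and
  \<open>Y\<close>. The masses agree by taking \<open>s = 0\<close>; if they vanish, both sides are
  zero. In the next lemma the weights carry the coordinates other than the one being
  treated.\<close>

lemma weighted_char_eq_imp:
  fixes w X :: "'a \<Rightarrow> real" and v Y :: "'b \<Rightarrow> real"
  assumes M: "prob_space M" and N: "prob_space N"
    and [measurable]: "w \<in> borel_measurable M" "X \<in> borel_measurable M" "v \<in> borel_measurable N" "Y \<in> borel_measurable N"
    and w: "\<And>x. 0 \<le> w x" "\<And>x. w x \<le> C" and v: "\<And>y. 0 \<le> v y" "\<And>y. v y \<le> C"
    and eq: "\<And>s. (\<integral>x. w x *\<^sub>R iexp (s * X x) \<partial>M) = (\<integral>y. v y *\<^sub>R iexp (s * Y y) \<partial>N)"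
    and [measurable]: "B \<in> sets borel"
  shows "(\<integral>x. w x * indicator B (X x) \<partial>M) = (\<integral>y. v y * indicator B (Y y) \<partial>N)"
proof -
  interpret M: prob_space M by fact
  interpret N: prob_space N by fact
  have iw: "integrable M w" using w by (intro M.integrable_const_bound[of _ C]) auto
  have iv: "integrable N v" using v by (intro N.integrable_const_bound[of _ C]) auto
  define c where "c = (\<integral>x. w x \<partial>M)"
  have c': "c = (\<integral>y. v y \<partial>N)"
  proof -
    have "(\<integral>x. complex_of_real (w x) \<partial>M) = (\<integral>y. complex_of_real (v y) \<partial>N)"
      using eq[of 0] by (simp add: scaleR_conv_of_real)
    then show ?thesis by (simp add: c_def)
  qed
  have c0: "c \<ge> 0" unfolding c_def using w by (simp add: integral_nonneg)
  show ?thesis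
  proof (cases "c = 0")
    case True
    have "AE x in M. w x = 0"
      using integral_nonneg_eq_0_iff_AE[OF iw] w True by (simp add: c_def)
    then have 1: "(\<integral>x. w x * indicator B (X x) \<partial>M) = (\<integral>x. 0 \<partial>M)"
      by (intro integral_cong_AE) auto
    have "AE y in N. v y = 0"
      using integral_nonneg_eq_0_iff_AE[OF iv] v True by (simp add: c')
    then have 2: "(\<integral>x. v x * indicator B (Y x) \<partial>N) = (\<integral>x. 0 \<partial>N)"
      by (intro integral_cong_AE) auto
    show ?thesis using 1 2 by simp
  next
    case False
    then have c: "c > 0" using c0 by simp
    have prob: "prob_space (density K (\<lambda>x. ennreal (u x / c)))"
      if "integrable K u" "\<And>x. 0 \<le> u x" "c = (\<integral>x. u x \<partial>K)" for K :: "'z measure" and u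
    proof (rule prob_spaceI)
      have "emeasure (density K (\<lambda>x. ennreal (u x / c))) (space (density K (\<lambda>x. ennreal (u x / c)))) =
        (\<integral>\<^sup>+x. ennreal (u x / c) \<partial>K)"
        using that(1) by (subst emeasure_density) (auto intro!: nn_integral_cong)
      also have "\<dots> = ennreal (\<integral>x. u x / c \<partial>K)"
        using that c by (intro nn_integral_eq_integral) auto
      also have "\<dots> = 1" using that(3) c by simp
      finally show "emeasure (density K (\<lambda>x. ennreal (u x / c))) (space (density K (\<lambda>x. ennreal (u x / c)))) = 1" .
    qed
    define M' where "M' = density M (\<lambda>x. ennreal (w x / c))"
    define N' where "N' = density N (\<lambda>x. ennreal (v x / c))"
    interpret M': prob_space M' unfolding M'_def by (rule prob[OF iw w(1) c_def])
    interpret N': prob_space N' unfolding N'_def by (rule prob[OF iv v(1) c'])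
    have [measurable_cong, simp]: "sets M' = sets M" "sets N' = sets N" by (auto simp: M'_def N'_def)
    have "distr M' borel X = distr N' borel Y"
    proof (rule Levy_uniqueness)
      show "char (distr M' borel X) = char (distr N' borel Y)"
      proof
        fix s
        have "char (distr M' borel X) s = (\<integral>x. iexp (s * X x) \<partial>M')"
          unfolding char_def by (subst integral_distr) auto
        also have "\<dots> = (\<integral>x. (w x / c) *\<^sub>R iexp (s * X x) \<partial>M)"
          unfolding M'_def using w c by (subst integral_density) auto
        also have "\<dots> = (\<integral>x. (1 / c) *\<^sub>R (w x *\<^sub>R iexp (s * X x)) \<partial>M)" by simp
        also have "\<dots> = (1 / c) *\<^sub>R (\<integral>x. w x *\<^sub>R iexp (s * X x) \<partial>M)"
          by (rule integral_scaleR_right)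
        also have "\<dots> = (1 / c) *\<^sub>R (\<integral>y. v y *\<^sub>R iexp (s * Y y) \<partial>N)"
          by (simp only: eq)
        also have "\<dots> = (\<integral>x. (1 / c) *\<^sub>R (v x *\<^sub>R iexp (s * Y x)) \<partial>N)"
          by (rule integral_scaleR_right[symmetric])
        also have "\<dots> = (\<integral>y. (v y / c) *\<^sub>R iexp (s * Y y) \<partial>N)" by simp
        also have "\<dots> = (\<integral>y. iexp (s * Y y) \<partial>N')"
          unfolding N'_def using v c by (subst integral_density) auto
        also have "\<dots> = char (distr N' borel Y) s"
          unfolding char_def by (subst integral_distr) auto
        finally show "char (distr M' borel X) s = char (distr N' borel Y) s" .
      qed
    qed (auto intro!: real_distribution.intro M'.prob_space_distr N'.prob_space_distr
        simp: real_distribution_axioms_def)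
    then have "(\<integral>x. indicator B x \<partial>distr M' borel X) = (\<integral>x. indicator B x \<partial>distr N' borel Y :: real)" by simp
    then have "(\<integral>x. indicator B (X x) \<partial>M') = (\<integral>x. indicator B (Y x) \<partial>N' :: real)"
      by (subst (asm) (1 2) integral_distr) auto
    then have "(\<integral>x. (w x / c) *\<^sub>R indicator B (X x) \<partial>M) = (\<integral>x. (v x / c) *\<^sub>R indicator B (Y x) \<partial>N :: real)"
      unfolding M'_def N'_def using w v c by (subst (asm) (1 2) integral_density) auto
    then show ?thesis using c by simp
  qed
qed

lemma iexp_cos_sin: "iexp x = of_real (cos x) + \<i> * of_real (sin x)"
  by (simp add: cis_conv_exp[symmetric] complex_eq_iff)

text \<open>Multivariate uniqueness by induction on \<open>J\<close>: one coordinate after the other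
  is turned from an exponential into an indicator. The exponential stays in the statement, with
  arbitrary \<open>I\<close> and \<open>t\<close>, because the next step needs it as input for the
  one-dimensional theorem.\<close>

lemma char_eq_imp_rectangle:
  fixes X :: "'i \<Rightarrow> 'a \<Rightarrow> real" and Y :: "'i \<Rightarrow> 'b \<Rightarrow> real"
  assumes M: "prob_space M" and N: "prob_space N"
    and mX [measurable]: "\<And>i. X i \<in> borel_measurable M" and mY [measurable]: "\<And>i. Y i \<in> borel_measurable N"
    and eq: "\<And>I t. finite I \<Longrightarrow> (\<integral>x. iexp (\<Sum>i\<in>I. t i * X i x) \<partial>M) = (\<integral>y. iexp (\<Sum>i\<in>I. t i * Y i y) \<partial>N)"
    and J: "finite J" and B: "\<And>i. i \<in> J \<Longrightarrow> B i \<in> sets borel"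
    and I: "finite I"
  shows "(\<integral>x. (\<Prod>j\<in>J. indicator (B j) (X j x)) *\<^sub>R iexp (\<Sum>i\<in>I. t i * X i x) \<partial>M) =
         (\<integral>y. (\<Prod>j\<in>J. indicator (B j) (Y j y)) *\<^sub>R iexp (\<Sum>i\<in>I. t i * Y i y) \<partial>N)"
  using J B I
proof (induction J arbitrary: I t rule: finite_induct)
  case empty
  then show ?case using eq by simp
next
  case (insert a J)
  interpret M: prob_space M by fact
  interpret N: prob_space N by fact
  have [measurable]: "B a \<in> sets borel" and [measurable]: "\<And>j. j \<in> J \<Longrightarrow> B j \<in> sets borel" using insert by auto
  let ?PX = "\<lambda>x. \<Prod>j\<in>J. indicat_real (B j) (X j x)" and ?PY = "\<lambda>y. \<Prod>j\<in>J. indicat_real (B j) (Y j y)"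
  have P01: "0 \<le> (\<Prod>j\<in>J. indicat_real (B j) (Z j))" "(\<Prod>j\<in>J. indicat_real (B j) (Z j)) \<le> 1" for Z
    by (auto intro!: prod_nonneg prod_le_1 simp: indicator_def)
  have IH: "(\<integral>x. ?PX x *\<^sub>R iexp (\<Sum>i\<in>I. t i * X i x) \<partial>M) = (\<integral>y. ?PY y *\<^sub>R iexp (\<Sum>i\<in>I. t i * Y i y) \<partial>N)"
    if "finite I" for I t
    using insert that by auto
  define S where "S x = (\<Sum>i\<in>I. t i * X i x)" for x
  define T where "T y = (\<Sum>i\<in>I. t i * Y i y)" for y
  have [measurable]: "S \<in> borel_measurable M" "T \<in> borel_measurable N" unfolding S_def[abs_def] T_def[abs_def] by auto
  have IH': "(\<integral>x. ?PX x *\<^sub>R iexp (r * S x + s * X a x) \<partial>M) = (\<integral>y. ?PY y *\<^sub>R iexp (r * T y + s * Y a y) \<partial>N)" for r s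
  proof -
    \<comment> \<open>The coefficients of \<open>r * S + s * X a\<close> as one linear combination;
      the two contributions are added because \<open>a\<close> may already belong to
      \<open>I\<close>.\<close>
    define t' where "t' i = (if i \<in> I then r * t i else 0) + (if i = a then s else 0)" for i
    have fin: "finite (insert a I)" using insert by simp
    have *: "(\<Sum>i\<in>insert a I. t' i * z i) = r * (\<Sum>i\<in>I. t i * z i) + s * z a" for z :: "'i \<Rightarrow> real"
    proof -
      have "(\<Sum>i\<in>insert a I. t' i * z i) = (\<Sum>i\<in>insert a I. if i \<in> I then r * t i * z i else 0) + (\<Sum>i\<in>insert a I. if i = a then s * z i else 0)"
        unfolding sum.distrib[symmetric] t'_def by (intro sum.cong) (auto simp: algebra_simps)
      also have "(\<Sum>i\<in>insert a I. if i \<in> I then r * t i * z i else 0) = (\<Sum>i\<in>I. r * t i * z i)"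
        using fin by (intro sum.mono_neutral_cong_right) auto
      also have "(\<Sum>i\<in>insert a I. if i = a then s * z i else 0) = s * z a"
        using fin by (simp add: sum.delta)
      finally show ?thesis by (simp add: sum_distrib_left mult.assoc)
    qed
    show ?thesis using IH[OF fin, of t'] unfolding * S_def T_def by simp
  qed
  have ie: "integrable M (\<lambda>x. ?PX x *\<^sub>R iexp (f x))" if [measurable]: "f \<in> borel_measurable M" for f
    using P01 by (intro M.integrable_const_bound[of _ 1]) auto
  have ie': "integrable N (\<lambda>x. ?PY x *\<^sub>R iexp (f x))" if [measurable]: "f \<in> borel_measurable N" for f
    using P01 by (intro N.integrable_const_bound[of _ 1]) auto
  \<comment> \<open>The factor \<open>iexp (S x)\<close> is complex and cannot serve as a weight.
    The combinations \<open>k0 + k1 * cos + k2 * sin\<close> with this constraint are nonnegative,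
    and by Euler's formula they are sums of three exponentials to which \<open>IH'\<close>
    applies.\<close>
  have key: "(\<integral>x. (?PX x * (k0 + k1 * cos (S x) + k2 * sin (S x))) * indicator (B a) (X a x) \<partial>M) =
        (\<integral>y. (?PY y * (k0 + k1 * cos (T y) + k2 * sin (T y))) * indicator (B a) (Y a y) \<partial>N)"
    if k: "\<bar>k1\<bar> + \<bar>k2\<bar> \<le> k0" for k0 k1 k2 :: real
  proof (rule weighted_char_eq_imp[OF M N, where C = "2 * k0"])
    have k0: "k0 \<ge> 0" using k by linarith
    have bd: "0 \<le> k0 + k1 * cos z + k2 * sin z" "k0 + k1 * cos z + k2 * sin z \<le> 2 * k0" for z
    proof -
      have "\<bar>k1 * cos z\<bar> \<le> \<bar>k1\<bar>" "\<bar>k2 * sin z\<bar> \<le> \<bar>k2\<bar>" by (auto simp: abs_mult mult_left_le)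
      then show "0 \<le> k0 + k1 * cos z + k2 * sin z" "k0 + k1 * cos z + k2 * sin z \<le> 2 * k0" using k by linarith+
    qed
    show "0 \<le> ?PX x * (k0 + k1 * cos (S x) + k2 * sin (S x))" for x
      using P01(1)[of "\<lambda>j. X j x"] bd by (intro mult_nonneg_nonneg) auto
    show "?PX x * (k0 + k1 * cos (S x) + k2 * sin (S x)) \<le> 2 * k0" for x
      using mult_mono[OF P01(2)[of "\<lambda>j. X j x"] bd(2)[of "S x"]] bd k0 by simp
    show "0 \<le> ?PY x * (k0 + k1 * cos (T x) + k2 * sin (T x))" for x
      using P01(1)[of "\<lambda>j. Y j x"] bd by (intro mult_nonneg_nonneg) auto
    show "?PY x * (k0 + k1 * cos (T x) + k2 * sin (T x)) \<le> 2 * k0" for x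
      using mult_mono[OF P01(2)[of "\<lambda>j. Y j x"] bd(2)[of "T x"]] bd k0 by simp
    fix s
    define c1 where "c1 = (k1 - \<i> * k2) / 2"
    define c2 where "c2 = (k1 + \<i> * k2) / 2"
    have expand: "(p * (k0 + k1 * cos z + k2 * sin z)) *\<^sub>R iexp y =
       k0 * (p *\<^sub>R iexp (0 * z + y)) + c1 * (p *\<^sub>R iexp (1 * z + y)) + c2 * (p *\<^sub>R iexp (- 1 * z + y))" for p z y
    proof -
      have 1: "iexp (1 * z + y) = iexp z * iexp y" "iexp (- 1 * z + y) = iexp (-z) * iexp y"
        by (simp_all add: algebra_simps flip: exp_add)
      have "complex_of_real (k0 + k1 * cos z + k2 * sin z) = k0 + c1 * iexp z + c2 * iexp (- z)"
        unfolding iexp_cos_sin c1_def c2_def by (simp add: field_simps)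
      then have "of_real p * complex_of_real (k0 + k1 * cos z + k2 * sin z) * iexp y =
          of_real p * (k0 + c1 * iexp z + c2 * iexp (- z)) * iexp y" by (simp only:)
      then show ?thesis unfolding 1 by (simp only: scaleR_conv_of_real of_real_mult) (simp add: algebra_simps)
    qed
    show "(\<integral>x. (?PX x * (k0 + k1 * cos (S x) + k2 * sin (S x))) *\<^sub>R iexp (s * X a x) \<partial>M) =
      (\<integral>y. (?PY y * (k0 + k1 * cos (T y) + k2 * sin (T y))) *\<^sub>R iexp (s * Y a y) \<partial>N)"
    proof -
      have "(\<integral>x. (?PX x * (k0 + k1 * cos (S x) + k2 * sin (S x))) *\<^sub>R iexp (s * X a x) \<partial>M) =
        k0 * (\<integral>x. ?PX x *\<^sub>R iexp (0 * S x + s * X a x) \<partial>M) + c1 * (\<integral>x. ?PX x *\<^sub>R iexp (1 * S x + s * X a x) \<partial>M)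
         + c2 * (\<integral>x. ?PX x *\<^sub>R iexp (- 1 * S x + s * X a x) \<partial>M)"
        unfolding expand
        by (subst Bochner_Integration.integral_add Bochner_Integration.integral_mult_right_zero,
          ((intro Bochner_Integration.integrable_add integrable_mult_right ie; measurable)+)?)+ (rule refl)
      also have "\<dots> = k0 * (\<integral>x. ?PY x *\<^sub>R iexp (0 * T x + s * Y a x) \<partial>N) + c1 * (\<integral>x. ?PY x *\<^sub>R iexp (1 * T x + s * Y a x) \<partial>N)
         + c2 * (\<integral>x. ?PY x *\<^sub>R iexp (- 1 * T x + s * Y a x) \<partial>N)"
        unfolding IH' by (rule refl)
      also have "\<dots> = (\<integral>x. (?PY x * (k0 + k1 * cos (T x) + k2 * sin (T x))) *\<^sub>R iexp (s * Y a x) \<partial>N)"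
        unfolding expand
        by (subst Bochner_Integration.integral_add Bochner_Integration.integral_mult_right_zero,
          ((intro Bochner_Integration.integrable_add integrable_mult_right ie'; measurable)+)?)+ (rule refl)
      finally show ?thesis .
    qed
  qed auto
  let ?Q = "\<lambda>x. ?PX x * indicat_real (B a) (X a x)" and ?R = "\<lambda>y. ?PY y * indicat_real (B a) (Y a y)"
  have iQ: "integrable M (\<lambda>x. ?Q x * f x)" if [measurable]: "f \<in> borel_measurable M" and "\<And>x. \<bar>f x\<bar> \<le> 1" for f
    using that P01(1)[of "\<lambda>j. X j x" for x] P01(2)[of "\<lambda>j. X j x" for x]
    by (intro M.integrable_const_bound[of _ 1]) (auto simp: abs_mult indicator_def intro!: mult_le_one)
  have iR: "integrable N (\<lambda>x. ?R x * f x)" if [measurable]: "f \<in> borel_measurable N" and "\<And>x. \<bar>f x\<bar> \<le> 1" for f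
    using that P01(1)[of "\<lambda>j. Y j x" for x] P01(2)[of "\<lambda>j. Y j x" for x]
    by (intro N.integrable_const_bound[of _ 1]) (auto simp: abs_mult indicator_def intro!: mult_le_one)
  \<comment> \<open>The weights \<open>1\<close>, \<open>1 + cos\<close> and \<open>1 + sin\<close>
    are admissible in \<open>key\<close>; subtracting the first from the other two recovers the real
    and imaginary parts.\<close>
  have c0: "(\<integral>x. ?Q x * 1 \<partial>M) = (\<integral>y. ?R y * 1 \<partial>N)"
    using key[of 0 0 1] by (simp add: mult_ac)
  have c1: "(\<integral>x. ?Q x * cos (S x) \<partial>M) = (\<integral>y. ?R y * cos (T y) \<partial>N)"
  proof -
    have "(\<integral>x. ?Q x * 1 + ?Q x * cos (S x) \<partial>M) = (\<integral>y. ?R y * 1 + ?R y * cos (T y) \<partial>N)"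
      using key[of 1 0 1] by (simp add: algebra_simps)
    then have "(\<integral>x. ?Q x * 1 \<partial>M) + (\<integral>x. ?Q x * cos (S x) \<partial>M) = (\<integral>y. ?R y * 1 \<partial>N) + (\<integral>y. ?R y * cos (T y) \<partial>N)"
      using Bochner_Integration.integral_add[OF iQ[of "\<lambda>_. 1"] iQ[of "\<lambda>x. cos (S x)"]]
        Bochner_Integration.integral_add[OF iR[of "\<lambda>_. 1"] iR[of "\<lambda>x. cos (T x)"]] by simp
    then show ?thesis using c0 by simp
  qed
  have c2: "(\<integral>x. ?Q x * sin (S x) \<partial>M) = (\<integral>y. ?R y * sin (T y) \<partial>N)"
  proof -
    have "(\<integral>x. ?Q x * 1 + ?Q x * sin (S x) \<partial>M) = (\<integral>y. ?R y * 1 + ?R y * sin (T y) \<partial>N)"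
      using key[of 0 1 1] by (simp add: algebra_simps)
    then have "(\<integral>x. ?Q x * 1 \<partial>M) + (\<integral>x. ?Q x * sin (S x) \<partial>M) = (\<integral>y. ?R y * 1 \<partial>N) + (\<integral>y. ?R y * sin (T y) \<partial>N)"
      using Bochner_Integration.integral_add[OF iQ[of "\<lambda>_. 1"] iQ[of "\<lambda>x. sin (S x)"]]
        Bochner_Integration.integral_add[OF iR[of "\<lambda>_. 1"] iR[of "\<lambda>x. sin (T x)"]] by simp
    then show ?thesis using c0 by simp
  qed
  have exp_re: "q *\<^sub>R iexp z = of_real (q * cos z) + \<i> * of_real (q * sin z)" for q z
    unfolding iexp_cos_sin by (simp add: scaleR_conv_of_real algebra_simps)
  have "(\<integral>x. ?Q x *\<^sub>R iexp (S x) \<partial>M) = of_real (\<integral>x. ?Q x * cos (S x) \<partial>M) + \<i> * of_real (\<integral>x. ?Q x * sin (S x) \<partial>M)"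
    unfolding exp_re by (subst Bochner_Integration.integral_add)
      (auto intro!: integrable_of_real integrable_mult_right iQ simp del: of_real_mult)
  also have "\<dots> = of_real (\<integral>x. ?R x * cos (T x) \<partial>N) + \<i> * of_real (\<integral>x. ?R x * sin (T x) \<partial>N)"
    unfolding c1 c2 ..
  also have "\<dots> = (\<integral>x. ?R x *\<^sub>R iexp (T x) \<partial>N)"
    unfolding exp_re by (subst Bochner_Integration.integral_add)
      (auto intro!: integrable_of_real integrable_mult_right iR simp del: of_real_mult)
  finally show ?case using insert(1,2) by (simp add: S_def T_def mult.commute)
qed

text \<open>Rectangles over finite sets of coordinates determine a finite measure on the full
  product, also for an infinite index type. Their probabilities come from the previous lemma with
  \<open>I = {}\<close>, where the exponential is 1.\<close>

lemma char_eq_imp_distr_PiM_eq: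
  fixes X :: "'i \<Rightarrow> 'a \<Rightarrow> real" and Y :: "'i \<Rightarrow> 'b \<Rightarrow> real"
  assumes M: "prob_space M" and N: "prob_space N"
    and mX [measurable]: "\<And>i. X i \<in> borel_measurable M" and mY [measurable]: "\<And>i. Y i \<in> borel_measurable N"
    and eq: "\<And>I t. finite I \<Longrightarrow> (\<integral>x. iexp (\<Sum>i\<in>I. t i * X i x) \<partial>M) = (\<integral>y. iexp (\<Sum>i\<in>I. t i * Y i y) \<partial>N)"
  shows "distr M (PiM UNIV (\<lambda>_. borel)) (\<lambda>x i. X i x) = distr N (PiM UNIV (\<lambda>_. borel)) (\<lambda>y i. Y i y)"
proof (rule measure_eqI_PiM_infinite)
  interpret M: prob_space M by fact
  interpret N: prob_space N by fact
  have m1 [measurable]: "(\<lambda>x i. X i x) \<in> M \<rightarrow>\<^sub>M PiM UNIV (\<lambda>_. borel)"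
    by (rule measurable_PiM_single') (auto simp: space_PiM)
  have m2 [measurable]: "(\<lambda>x i. Y i x) \<in> N \<rightarrow>\<^sub>M PiM UNIV (\<lambda>_. borel)"
    by (rule measurable_PiM_single') (auto simp: space_PiM)
  show "finite_measure (distr M (PiM UNIV (\<lambda>_. borel)) (\<lambda>x i. X i x))"
    using M.prob_space_distr[OF m1] prob_space.finite_measure by blast
  fix A :: "'i \<Rightarrow> real set" and J :: "'i set"
  assume J: "finite J" and A: "\<And>i. i \<in> J \<Longrightarrow> A i \<in> sets borel"
  let ?A = "prod_emb UNIV (\<lambda>_. borel) J (Pi\<^sub>E J A)"
  have [measurable]: "?A \<in> sets (PiM UNIV (\<lambda>_. borel))"
    using J A by (intro sets_PiM_I) auto
  have ind: "indicat_real ?A z = (\<Prod>j\<in>J. indicator (A j) (z j))" for z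
    using J by (auto simp: prod_emb_def indicator_def PiE_iff prod_zero_iff)
  have "complex_of_real (\<integral>x. (\<Prod>j\<in>J. indicator (A j) (X j x)) \<partial>M) = of_real (\<integral>y. (\<Prod>j\<in>J. indicator (A j) (Y j y)) \<partial>N)"
    using char_eq_imp_rectangle[where I = "{}", OF M N mX mY eq J A]
    unfolding integral_complex_of_real[symmetric] by (simp add: scaleR_conv_of_real)
  then have "(\<integral>x. indicator ?A (\<lambda>i. X i x) \<partial>M) = (\<integral>x. indicat_real ?A (\<lambda>i. Y i x) \<partial>N)"
    unfolding ind of_real_eq_iff .
  then have "(\<integral>z. indicat_real ?A z \<partial>distr M (PiM UNIV (\<lambda>_. borel)) (\<lambda>x i. X i x)) =
     (\<integral>z. indicat_real ?A z \<partial>distr N (PiM UNIV (\<lambda>_. borel)) (\<lambda>x i. Y i x))"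
    by (subst (1 2) integral_distr) auto
  then show "emeasure (distr M (PiM UNIV (\<lambda>_. borel)) (\<lambda>x i. X i x)) ?A =
      emeasure (distr N (PiM UNIV (\<lambda>_. borel)) (\<lambda>x i. Y i x)) ?A"
    using M.prob_space_distr[OF m1] N.prob_space_distr[OF m2]
    by (simp add: finite_measure.emeasure_eq_measure[OF prob_space.finite_measure])
qed auto

section \<open>Factorization of covariance kernels\<close>

lemma sum_lincomb_square:
  fixes x :: "'i \<Rightarrow> 'b \<Rightarrow> real"
  shows "(\<Sum>b\<in>S. (\<Sum>i\<in>I. t i * x i b)\<^sup>2) = (\<Sum>i\<in>I. \<Sum>j\<in>I. t i * t j * (\<Sum>b\<in>S. x i b * x j b))"
proof -
  have "(\<Sum>b\<in>S. (\<Sum>i\<in>I. t i * x i b)\<^sup>2) = (\<Sum>b\<in>S. \<Sum>i\<in>I. \<Sum>j\<in>I. t i * t j * (x i b * x j b))"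
    by (simp add: power2_eq_square sum_product mult_ac)
  also have "\<dots> = (\<Sum>i\<in>I. \<Sum>b\<in>S. \<Sum>j\<in>I. t i * t j * (x i b * x j b))"
    by (rule sum.swap)
  also have "\<dots> = (\<Sum>i\<in>I. \<Sum>j\<in>I. \<Sum>b\<in>S. t i * t j * (x i b * x j b))"
    by (intro sum.cong[OF refl], subst sum.swap, rule refl)
  finally show ?thesis by (simp add: sum_distrib_left)
qed

lemma sum_sum_lincomb_square:
  fixes x :: "'i \<Rightarrow> 'b \<Rightarrow> 'c \<Rightarrow> real"
  shows "(\<Sum>p\<in>S. \<Sum>r\<in>R. (\<Sum>i\<in>I. t i * x i p r)\<^sup>2) =
    (\<Sum>i\<in>I. \<Sum>j\<in>I. t i * t j * (\<Sum>p\<in>S. \<Sum>r\<in>R. x i p r * x j p r))"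
  using sum_lincomb_square[of t "\<lambda>i (p, r). x i p r" I "S \<times> R"]
  by (simp add: sum.cartesian_product case_prod_unfold)

definition psd :: "('i \<Rightarrow> 'i \<Rightarrow> real) \<Rightarrow> bool" where
  "psd C \<longleftrightarrow> (\<forall>i j. C i j = C j i) \<and> (\<forall>I c. finite I \<longrightarrow> 0 \<le> (\<Sum>i\<in>I. \<Sum>j\<in>I. c i * c j * C i j))"

lemma psd_sym: "psd C \<Longrightarrow> C i j = C j i"
  and psd_nonneg: "psd C \<Longrightarrow> finite I \<Longrightarrow> 0 \<le> (\<Sum>i\<in>I. \<Sum>j\<in>I. c i * c j * C i j)"
  unfolding psd_def by blast+

lemma psd_diag: "psd C \<Longrightarrow> 0 \<le> C i i"
  using psd_nonneg[of C "{i}" "\<lambda>_. 1"] by simp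

lemma psd_two:
  assumes "psd C" shows "0 \<le> x\<^sup>2 * C i i + 2 * x * y * C i j + y\<^sup>2 * C j j"
proof (cases "i = j")
  case True
  have "x\<^sup>2 * C i i + 2 * x * y * C i j + y\<^sup>2 * C j j = (x + y)\<^sup>2 * C i i"
    using True by (simp add: power2_eq_square algebra_simps)
  then show ?thesis using psd_diag[OF assms, of i] by simp
next
  case False
  then show ?thesis
    using psd_nonneg[OF assms, of "{i, j}" "\<lambda>k. if k = i then x else y"] psd_sym[OF assms, of i j]
    by (simp add: power2_eq_square algebra_simps)
qed

text \<open>The test vectors \<open>(C j j, - C i j)\<close> and \<open>(- C i j, C i i)\<close>
  give the claim multiplied by \<open>C j j\<close> and by \<open>C i i\<close>. If both diagonal
  entries vanish, \<open>(1, - C i j)\<close> forces \<open>C i j = 0\<close>.\<close>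

lemma psd_cauchy_schwarz:
  assumes "psd C" shows "(C i j)\<^sup>2 \<le> C i i * C j j"
proof -
  note p = psd_two[OF assms, of _ i _ j]
  have "0 \<le> C j j * (C i i * C j j - (C i j)\<^sup>2)"
    using p[of "C j j" "- C i j"] by (simp add: power2_eq_square algebra_simps)
  moreover have "0 \<le> C i i * (C i i * C j j - (C i j)\<^sup>2)"
    using p[of "- C i j" "C i i"] by (simp add: power2_eq_square algebra_simps)
  moreover have "0 \<le> - 2 * (C i j)\<^sup>2" if "C i i = 0" "C j j = 0"
    using p[of 1 "- C i j"] that by (simp add: power2_eq_square algebra_simps)
  ultimately show ?thesis
    using psd_diag[OF assms, of i] psd_diag[OF assms, of j]
    by (cases "C i i = 0"; cases "C j j = 0") (auto simp: zero_le_mult_iff mult_le_0_iff)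
qed

text \<open>Coefficients are added up over the fibres of \<open>h\<close>, so the map may identify
  indices; \<open>from_nat\<close>, to which this is applied, does so in general.\<close>

lemma psd_comp:
  assumes "psd C" shows "psd (\<lambda>a b. C (h a) (h b))"
  unfolding psd_def
proof (intro conjI allI impI)
  show "C (h a) (h b) = C (h b) (h a)" for a b by (rule psd_sym[OF assms])
  fix I :: "'b set" and c :: "'b \<Rightarrow> real" assume I: "finite I"
  define d where "d i = (\<Sum>a\<in>{a\<in>I. h a = i}. c a)" for i
  have "0 \<le> (\<Sum>i\<in>h`I. \<Sum>j\<in>h`I. d i * d j * C i j)"
    using I by (intro psd_nonneg[OF assms]) auto
  also have "\<dots> = (\<Sum>i\<in>h`I. d i * (\<Sum>j\<in>h`I. d j * C i j))"
    by (simp add: sum_distrib_left mult.assoc)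
  also have "\<dots> = (\<Sum>i\<in>h`I. d i * (\<Sum>b\<in>I. c b * C i (h b)))"
  proof (intro sum.cong[OF refl] arg_cong2[where f = "(*)"] refl)
    fix i
    have "(\<Sum>j\<in>h`I. d j * C i j) = (\<Sum>j\<in>h`I. \<Sum>b\<in>{b\<in>I. h b = j}. c b * C i (h b))"
      unfolding d_def sum_distrib_right by (intro sum.cong) auto
    also have "\<dots> = (\<Sum>b\<in>I. c b * C i (h b))" using I by (intro sum.group) auto
    finally show "(\<Sum>j\<in>h`I. d j * C i j) = (\<Sum>b\<in>I. c b * C i (h b))" .
  qed
  also have "\<dots> = (\<Sum>i\<in>h`I. \<Sum>a\<in>{a\<in>I. h a = i}. c a * (\<Sum>b\<in>I. c b * C (h a) (h b)))"
    unfolding d_def sum_distrib_right by (intro sum.cong) auto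
  also have "\<dots> = (\<Sum>a\<in>I. c a * (\<Sum>b\<in>I. c b * C (h a) (h b)))"
    using I by (intro sum.group) auto
  finally show "0 \<le> (\<Sum>a\<in>I. \<Sum>b\<in>I. c a * c b * C (h a) (h b))"
    by (simp add: sum_distrib_left mult.assoc)
qed

text \<open>When the pivot \<open>C s s\<close> vanishes, division by zero makes the Schur complement the identity,
  which is harmless because the whole row \<open>C s\<close> then vanishes as well.\<close>

lemma psd_schur:
  assumes C: "psd C"
  shows "psd (\<lambda>a b. C a b - C a s * C b s / C s s)"
proof (cases "C s s = 0")
  case True
  then show ?thesis using C by simp
next
  case False
  then have pos: "C s s > 0" using psd_diag[OF C, of s] by simp
  show ?thesis unfolding psd_def
  proof (intro conjI allI impI)
    show "C a b - C a s * C b s / C s s = C b a - C b s * C a s / C s s" for a b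
      using psd_sym[OF C, of a b] by (simp add: mult.commute)
    fix I :: "'a set" and c :: "'a \<Rightarrow> real" assume I: "finite I"
    define d where "d a = (if a \<in> I then c a else 0)" for a
    let ?I = "insert s I"
    define T where "T = (\<Sum>a\<in>?I. d a * C a s)"
    \<comment> \<open>Completing the square: shifting the coefficient at \<open>s\<close> by
      \<open>T / C s s\<close> minimises the form in that coefficient, and the minimum is the form
      of the Schur complement. The extension \<open>d\<close> of \<open>c\<close> by zero covers the
      case that \<open>s\<close> lies outside \<open>I\<close>.\<close>
    define e where "e a = d a - (if a = s then T / C s s else 0)" for a
    have fin: "finite ?I" using I by simp
    have Ce: "(\<Sum>b\<in>?I. e b * C a b) = (\<Sum>b\<in>?I. d b * C a b) - T / C s s * C a s" for a
    proof -
      have "(\<Sum>b\<in>?I. e b * C a b) = (\<Sum>b\<in>?I. d b * C a b) - (\<Sum>b\<in>?I. if b = s then T / C s s * C a s else 0)"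
        unfolding e_def sum_subtractf[symmetric] by (intro sum.cong) (auto simp: algebra_simps)
      then show ?thesis using fin by (simp only: sum.delta) simp
    qed
    have "0 \<le> (\<Sum>a\<in>?I. \<Sum>b\<in>?I. e a * e b * C a b)" by (rule psd_nonneg[OF C fin])
    also have "\<dots> = (\<Sum>a\<in>?I. e a * (\<Sum>b\<in>?I. e b * C a b))" by (simp add: sum_distrib_left mult.assoc)
    also have "\<dots> = (\<Sum>a\<in>?I. d a * ((\<Sum>b\<in>?I. d b * C a b) - T / C s s * C a s)) -
       T / C s s * ((\<Sum>b\<in>?I. d b * C s b) - T / C s s * C s s)"
    proof -
      have "(\<Sum>a\<in>?I. e a * z a) = (\<Sum>a\<in>?I. d a * z a) - (\<Sum>a\<in>?I. if a = s then T / C s s * z s else 0)" for z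
        unfolding e_def sum_subtractf[symmetric] by (intro sum.cong) (auto simp: algebra_simps)
      then show ?thesis unfolding Ce using fin by (simp only: sum.delta) simp
    qed
    also have "(\<Sum>b\<in>?I. d b * C s b) = T" unfolding T_def by (intro sum.cong) (auto simp: psd_sym[OF C, of s])
    also have "T / C s s * (T - T / C s s * C s s) = 0" using pos by simp
    also have "(\<Sum>a\<in>?I. d a * ((\<Sum>b\<in>?I. d b * C a b) - T / C s s * C a s)) - 0 =
       (\<Sum>a\<in>?I. \<Sum>b\<in>?I. d a * d b * (C a b - C a s * C b s / C s s))"
    proof -
      have "(\<Sum>b\<in>?I. d b * C a b) - T / C s s * C a s = (\<Sum>b\<in>?I. d b * (C a b - C a s * C b s / C s s))" for a
      proof -
        have "T / C s s * C a s = (\<Sum>b\<in>?I. d b * C b s) * (C a s / C s s)" unfolding T_def by (simp only: times_divide_eq_left times_divide_eq_right)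
        also have "\<dots> = (\<Sum>b\<in>?I. d b * (C a s * C b s / C s s))"
          unfolding sum_distrib_right by (intro sum.cong) (auto simp: mult_ac)
        finally show ?thesis by (simp only: right_diff_distrib sum_subtractf)
      qed
      then show ?thesis by (simp add: sum_distrib_left mult.assoc)
    qed
    also have "\<dots> = (\<Sum>a\<in>I. \<Sum>b\<in>?I. d a * d b * (C a b - C a s * C b s / C s s))"
      using fin by (intro sum.mono_neutral_right) (auto simp: d_def)
    also have "\<dots> = (\<Sum>a\<in>I. \<Sum>b\<in>I. d a * d b * (C a b - C a s * C b s / C s s))"
      using fin by (intro sum.cong refl sum.mono_neutral_right) (auto simp: d_def)
    also have "\<dots> = (\<Sum>a\<in>I. \<Sum>b\<in>I. c a * c b * (C a b - C a s * C b s / C s s))"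
      by (simp add: d_def cong: sum.cong_simp)
    finally show "0 \<le> (\<Sum>a\<in>I. \<Sum>b\<in>I. c a * c b * (C a b - C a s * C b s / C s s))" .
  qed
qed

text \<open>Symmetric Gaussian elimination: the kernel left after the pivots below \<open>s\<close>
  have been eliminated. For a covariance kernel it is the covariance of the residuals after
  projection on the first \<open>s\<close> variables.\<close>

fun schur :: "(nat \<Rightarrow> nat \<Rightarrow> real) \<Rightarrow> nat \<Rightarrow> nat \<Rightarrow> nat \<Rightarrow> real" where
  "schur C 0 a b = C a b"
| "schur C (Suc s) a b = schur C s a b - schur C s a s * schur C s b s / schur C s s s"

text \<open>The normalised column of pivot \<open>s\<close>. A vanishing pivot gives a zero column,
  as division by zero is zero.\<close>

definition cholesky :: "(nat \<Rightarrow> nat \<Rightarrow> real) \<Rightarrow> nat \<Rightarrow> nat \<Rightarrow> real" where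
  "cholesky C a s = schur C s a s / sqrt (schur C s s s)"

lemma psd_schur_iterate: "psd C \<Longrightarrow> psd (schur C s)"
proof (induction s)
  case 0
  have "schur C 0 = C" by (intro ext) simp
  with 0 show ?case by simp
next
  case (Suc s)
  have "schur C (Suc s) = (\<lambda>a b. schur C s a b - schur C s a s * schur C s b s / schur C s s s)"
    by (intro ext) simp
  then show ?case using psd_schur[OF Suc.IH[OF Suc.prems]] by (simp only:)
qed

text \<open>Elimination clears the row and column of its pivot. If the pivot is zero, the
  elimination changes nothing, but then Cauchy-Schwarz shows that this row and column are zero
  already.\<close>

lemma schur_eq_0: "psd C \<Longrightarrow> a < s \<or> b < s \<Longrightarrow> schur C s a b = 0"
proof (induction s arbitrary: a b)
  case (Suc s)
  let ?S = "schur C s"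
  have z: "?S s b = 0" "?S b s = 0" if "?S s s = 0" for b
    using psd_cauchy_schwarz[OF psd_schur_iterate[OF Suc.prems(1)], of s s b] that
      psd_sym[OF psd_schur_iterate[OF Suc.prems(1)], of s s b] by auto
  show ?case
  proof (cases "a < s \<or> b < s")
    case True
    then have "?S a b = 0" "?S a s = 0 \<or> ?S b s = 0" using Suc by auto
    then show ?thesis by auto
  next
    case False
    then have "a = s \<or> b = s" using Suc.prems by auto
    then show ?thesis
    proof
      assume a: "a = s"
      have "?S b s = ?S s b" by (rule psd_sym[OF psd_schur_iterate[OF Suc.prems(1)]])
      then show ?thesis using z(1)[of b] unfolding a by (cases "?S s s = 0") auto
    next
      assume b: "b = s"
      show ?thesis using z(2)[of a] unfolding b by (cases "?S s s = 0") auto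
    qed
  qed
qed simp

lemma cholesky_eq_0: "psd C \<Longrightarrow> a < s \<Longrightarrow> cholesky C a s = 0"
  by (simp add: cholesky_def schur_eq_0)

lemma cholesky_partial:
  assumes "psd C"
  shows "C a b = (\<Sum>s<n. cholesky C a s * cholesky C b s) + schur C n a b"
proof (induction n)
  case (Suc n)
  have "cholesky C a n * cholesky C b n = schur C n a n * schur C n b n / schur C n n n"
    using psd_diag[OF psd_schur_iterate[OF assms], of n n] by (simp add: cholesky_def)
  then show ?case using Suc by simp
qed simp

text \<open>After transport to \<open>nat\<close>, the remainder of the elimination vanishes at
  \<open>(to_nat i, to_nat j)\<close> once pivot \<open>to_nat i\<close> is done. Hence an infinite
  kernel is factored by finite sums, and no convergence question arises.\<close>

lemma psd_factorization:
  fixes C :: "'i::countable \<Rightarrow> 'i \<Rightarrow> real"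
  assumes "psd C"
  obtains L :: "'i \<Rightarrow> nat \<Rightarrow> real" where "\<And>i s. to_nat i < s \<Longrightarrow> L i s = 0"
    "\<And>i j. C i j = (\<Sum>s\<le>to_nat i. L i s * L j s)"
proof -
  define D where "D a b = C (from_nat a) (from_nat b)" for a b
  have D: "psd D" unfolding D_def by (rule psd_comp[OF assms])
  have eq: "C i j = (\<Sum>s\<le>to_nat i. cholesky D (to_nat i) s * cholesky D (to_nat j) s)" for i j
  proof -
    have "D (to_nat i) (to_nat j) = (\<Sum>s<Suc (to_nat i). cholesky D (to_nat i) s * cholesky D (to_nat j) s)"
      using cholesky_partial[OF D, of "to_nat i" "to_nat j" "Suc (to_nat i)"]
        schur_eq_0[OF D, of "to_nat i" "Suc (to_nat i)" "to_nat j"] by (simp del: schur.simps sum.lessThan_Suc)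
    then show ?thesis by (simp add: D_def lessThan_Suc_atMost)
  qed
  show ?thesis
    by (rule that[of "\<lambda>i. cholesky D (to_nat i)"]) (auto intro: eq cholesky_eq_0[OF D])
qed

section \<open>Gaussian families and their covariances\<close>

lemma (in prob_space) centered_gaussian_rv_char:
  assumes "centered_gaussian_rv M X"
  shows "integrable M (\<lambda>x. (X x)\<^sup>2)"
    and "(\<integral>x. iexp (X x) \<partial>M) = exp (- (\<integral>x. (X x)\<^sup>2 \<partial>M) / 2)"
proof -
  have [measurable]: "X \<in> borel_measurable M" using assms by (simp add: centered_gaussian_rv_def)
  consider (zero) "AE x in M. X x = 0" | (normal) \<sigma> where "\<sigma> > 0" "distributed M lborel X (normal_density 0 \<sigma>)"
    using assms by (auto simp: centered_gaussian_rv_def)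
  then have "integrable M (\<lambda>x. (X x)\<^sup>2) \<and> (\<integral>x. iexp (X x) \<partial>M) = exp (- (\<integral>x. (X x)\<^sup>2 \<partial>M) / 2)"
  proof cases
    case zero
    have "integrable M (\<lambda>x. (X x)\<^sup>2) \<longleftrightarrow> integrable M (\<lambda>_. 0 :: real)"
      using zero by (intro integrable_cong_AE) auto
    moreover have "(\<integral>x. iexp (X x) \<partial>M) = (\<integral>x. 1 \<partial>M)"
      using zero by (intro integral_cong_AE) auto
    moreover have "(\<integral>x. (X x)\<^sup>2 \<partial>M) = (\<integral>x. 0 \<partial>M)"
      using zero by (intro integral_cong_AE) auto
    ultimately show ?thesis by (simp add: prob_space)
  next
    case normal
    have mom: "integrable lborel (\<lambda>x. normal_density 0 \<sigma> x * x\<^sup>2)"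
      using integrable_normal_moment[OF normal(1), of 0 2] by simp
    have i: "integrable M (\<lambda>x. (X x)\<^sup>2)"
      using mom distributed_integrable[OF normal(2), of "\<lambda>x. x\<^sup>2"] by simp
    have var: "(\<integral>x. (X x)\<^sup>2 \<partial>M) = \<sigma>\<^sup>2"
      using normal_distributed_variance[OF normal] normal_distributed_expectation[OF normal] by simp
    have std: "distributed M lborel (\<lambda>x. X x / \<sigma>) std_normal_density"
      using normal by (subst (asm) normal_standard_normal_convert) simp_all
    have "distr M lborel (\<lambda>x. X x / \<sigma>) = std_normal_distribution"
      using std by (simp add: distributed_def)
    then have "char (distr M lborel (\<lambda>x. X x / \<sigma>)) \<sigma> = complex_of_real (exp (- (\<sigma>\<^sup>2) / 2))"
      using fun_cong[OF char_std_normal_distribution, of \<sigma>] by simp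
    then have "(\<integral>x. iexp (X x) \<partial>M) = complex_of_real (exp (- (\<sigma>\<^sup>2) / 2))"
      unfolding char_def using normal(1) by (subst (asm) integral_distr) auto
    then show ?thesis using i var by (simp add: exp_of_real)
  qed
  then show "integrable M (\<lambda>x. (X x)\<^sup>2)" "(\<integral>x. iexp (X x) \<partial>M) = exp (- (\<integral>x. (X x)\<^sup>2 \<partial>M) / 2)" by auto
qed

lemma jointly_gaussian_component:
  assumes "jointly_gaussian M g" shows "centered_gaussian_rv M (g i)"
  using assms[unfolded jointly_gaussian_def, rule_format, of "{i}" "\<lambda>_. 1"] by simp

lemma (in prob_space) square_integrable_mult:
  fixes X Y :: "'a \<Rightarrow> real"
  assumes [measurable]: "X \<in> borel_measurable M" "Y \<in> borel_measurable M"
    and "integrable M (\<lambda>x. (X x)\<^sup>2)" "integrable M (\<lambda>x. (Y x)\<^sup>2)"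
  shows "integrable M (\<lambda>x. X x * Y x)"
proof (rule Bochner_Integration.integrable_bound)
  show "integrable M (\<lambda>x. (X x)\<^sup>2 + (Y x)\<^sup>2)" using assms by simp
  have "\<bar>X x * Y x\<bar> \<le> (X x)\<^sup>2 + (Y x)\<^sup>2" for x
  proof -
    have "2 * \<bar>X x\<bar> * \<bar>Y x\<bar> \<le> (X x)\<^sup>2 + (Y x)\<^sup>2"
      using sum_squares_bound[of "\<bar>X x\<bar>" "\<bar>Y x\<bar>"] by simp
    moreover have "0 \<le> \<bar>X x\<bar> * \<bar>Y x\<bar>" by simp
    ultimately show ?thesis unfolding abs_mult by linarith
  qed
  then show "AE x in M. norm (X x * Y x) \<le> norm ((X x)\<^sup>2 + (Y x)\<^sup>2)"
    by (intro AE_I2) (auto intro: order_trans[OF _ abs_ge_self])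
qed simp

lemma (in prob_space) lincomb_second_moment:
  fixes X :: "'i \<Rightarrow> 'a \<Rightarrow> real"
  assumes [measurable]: "\<And>i. X i \<in> borel_measurable M" and i2: "\<And>i. integrable M (\<lambda>x. (X i x)\<^sup>2)"
  shows "(\<integral>x. (\<Sum>i\<in>I. c i * X i x)\<^sup>2 \<partial>M) = (\<Sum>i\<in>I. \<Sum>j\<in>I. c i * c j * (\<integral>x. X i x * X j x \<partial>M))"
proof -
  have i: "integrable M (\<lambda>x. (c i * c j) * (X i x * X j x))" for i j
    by (intro integrable_mult_right square_integrable_mult) (auto intro: i2)
  have "(\<integral>x. (\<Sum>i\<in>I. c i * X i x)\<^sup>2 \<partial>M) = (\<integral>x. (\<Sum>i\<in>I. \<Sum>j\<in>I. (c i * c j) * (X i x * X j x)) \<partial>M)"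
    by (simp add: power2_eq_square sum_product mult_ac)
  also have "\<dots> = (\<Sum>i\<in>I. \<Sum>j\<in>I. (\<integral>x. (c i * c j) * (X i x * X j x) \<partial>M))"
    using i by (simp only: Bochner_Integration.integral_sum Bochner_Integration.integrable_sum)
  finally show ?thesis by simp
qed

lemma (in prob_space) psd_covariance:
  fixes X :: "'i \<Rightarrow> 'a \<Rightarrow> real"
  assumes "\<And>i. X i \<in> borel_measurable M" "\<And>i. integrable M (\<lambda>x. (X i x)\<^sup>2)"
  shows "psd (\<lambda>i j. \<integral>x. X i x * X j x \<partial>M)"
  unfolding psd_def lincomb_second_moment[OF assms, symmetric]
  by (auto simp: mult.commute)

text \<open>The characteristic function of a linear combination depends on its second moment alone,
  hence on the covariances; the degenerate and the normal case need not be told apart.\<close>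

lemma jointly_gaussian_law_eq:
  fixes g :: "'i \<Rightarrow> 'a \<Rightarrow> real" and h :: "'i \<Rightarrow> 'b \<Rightarrow> real"
  assumes M: "prob_space M" and N: "prob_space N"
    and g: "jointly_gaussian M g" and h: "jointly_gaussian N h"
    and cov: "\<And>i j. (\<integral>x. g i x * g j x \<partial>M) = (\<integral>x. h i x * h j x \<partial>N)"
  shows "distr M (PiM UNIV (\<lambda>_. borel)) (\<lambda>x i. g i x) = distr N (PiM UNIV (\<lambda>_. borel)) (\<lambda>x i. h i x)"
proof -
  interpret M: prob_space M by fact
  interpret N: prob_space N by fact
  have cg: "centered_gaussian_rv M (g i)" "centered_gaussian_rv N (h i)" for i
    using jointly_gaussian_component[OF g] jointly_gaussian_component[OF h] by auto
  have mg: "g i \<in> borel_measurable M" and mh: "h i \<in> borel_measurable N" for i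
    using cg[of i] by (auto simp: centered_gaussian_rv_def)
  note i2 = M.centered_gaussian_rv_char(1)[OF cg(1)] N.centered_gaussian_rv_char(1)[OF cg(2)]
  show ?thesis
  proof (rule char_eq_imp_distr_PiM_eq[OF M N mg mh])
    fix I :: "'i set" and t :: "'i \<Rightarrow> real" assume "finite I"
    then have c: "centered_gaussian_rv M (\<lambda>x. \<Sum>i\<in>I. t i * g i x)" "centered_gaussian_rv N (\<lambda>x. \<Sum>i\<in>I. t i * h i x)"
      using g h by (auto simp: jointly_gaussian_def)
    have "(\<integral>x. (\<Sum>i\<in>I. t i * g i x)\<^sup>2 \<partial>M) = (\<integral>x. (\<Sum>i\<in>I. t i * h i x)\<^sup>2 \<partial>N)"
      using M.lincomb_second_moment[of g t I] N.lincomb_second_moment[of h t I] mg mh i2 cov by simp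
    then show "(\<integral>x. iexp (\<Sum>i\<in>I. t i * g i x) \<partial>M) = (\<integral>x. iexp (\<Sum>i\<in>I. t i * h i x) \<partial>N)"
      by (simp only: M.centered_gaussian_rv_char(2)[OF c(1)] N.centered_gaussian_rv_char(2)[OF c(2)])
  qed
qed

section \<open>Gaussian vectors and chaos variables as functions of the Gaussian sequence\<close>

lemma distr_gauss_seq_component': "distr gauss_seq borel (\<lambda>w. w p) = std_normal_distribution"
  using distr_gauss_seq_component[of p] by (simp cong: distr_cong)

lemma indep_vars_gauss_seq: "gauss_seq.indep_vars (\<lambda>_. borel) (\<lambda>i w. w i) UNIV"
proof (subst gauss_seq.indep_vars_iff_distr_eq_PiM)
  have "distr gauss_seq (PiM UNIV (\<lambda>_. borel)) (\<lambda>x. \<lambda>i\<in>UNIV. x i) = distr gauss_seq gauss_seq (\<lambda>x. x)"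
    by (intro distr_cong) (auto simp: sets_gauss_seq)
  also have "\<dots> = PiM UNIV (\<lambda>_. std_normal_distribution)" by (simp add: gauss_seq_def)
  finally show "distr gauss_seq (PiM UNIV (\<lambda>_. borel)) (\<lambda>x. \<lambda>i\<in>UNIV. x i) =
    PiM UNIV (\<lambda>i. distr gauss_seq borel (\<lambda>w. w i))"
    by (simp add: distr_gauss_seq_component')
qed auto

lemma distributed_gauss_seq_lincomb:
  assumes I: "finite I" and pos: "(\<Sum>b\<in>I. (c b)\<^sup>2) > 0"
  shows "distributed gauss_seq lborel (\<lambda>w. \<Sum>b\<in>I. c b * w b) (normal_density 0 (sqrt (\<Sum>b\<in>I. (c b)\<^sup>2)))"
proof -
  \<comment> \<open>Terms with coefficient zero are dropped, since the addition theorem for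
    independent normal variables asks for positive standard deviations.\<close>
  define I' where "I' = {b\<in>I. c b \<noteq> 0}"
  have fin: "finite I'" using I by (simp add: I'_def)
  have ne: "I' \<noteq> {}"
  proof
    assume "I' = {}"
    then have "(\<Sum>b\<in>I. (c b)\<^sup>2) = 0" by (intro sum.neutral) (auto simp: I'_def)
    with pos show False by simp
  qed
  have "gauss_seq.indep_vars (\<lambda>_. borel) (\<lambda>b w. c b * w b) UNIV"
    by (rule gauss_seq.indep_vars_compose2[OF indep_vars_gauss_seq]) auto
  then have ind: "gauss_seq.indep_vars (\<lambda>_. borel) (\<lambda>b w. c b * w b) I'"
    by (rule gauss_seq.indep_vars_subset) auto
  have nd: "distributed gauss_seq lborel (\<lambda>w. c b * w b) (normal_density 0 \<bar>c b\<bar>)" if "b \<in> I'" for b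
  proof -
    have "distributed gauss_seq lborel (\<lambda>w. w b) std_normal_density"
      using distr_gauss_seq_component[of b] by (auto simp: distributed_def cong: distr_cong)
    from gauss_seq.normal_density_affine[OF this, of "c b" 0] that show ?thesis
      by (auto simp: I'_def)
  qed
  have "distributed gauss_seq lborel (\<lambda>w. \<Sum>b\<in>I'. c b * w b) (normal_density (\<Sum>b\<in>I'. 0) (sqrt (\<Sum>b\<in>I'. \<bar>c b\<bar>\<^sup>2)))"
    by (rule gauss_seq.sum_indep_normal[OF fin ne ind _ nd]) (auto simp: I'_def)
  moreover have "(\<Sum>b\<in>I'. c b * w b) = (\<Sum>b\<in>I. c b * w b)" for w
    using I by (intro sum.mono_neutral_left) (auto simp: I'_def)
  moreover have "(\<Sum>b\<in>I'. \<bar>c b\<bar>\<^sup>2) = (\<Sum>b\<in>I. (c b)\<^sup>2)"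
    using I by (simp, intro sum.mono_neutral_left) (auto simp: I'_def)
  ultimately show ?thesis by simp
qed

lemma centered_gaussian_rv_lincomb:
  assumes I: "finite I"
  shows "centered_gaussian_rv gauss_seq (\<lambda>w. \<Sum>b\<in>I. c b * w b)"
proof (cases "(\<Sum>b\<in>I. (c b)\<^sup>2) = 0")
  case True
  then have "\<And>b. b \<in> I \<Longrightarrow> c b = 0" using I by (simp add: sum_nonneg_eq_0_iff)
  then show ?thesis by (auto simp: centered_gaussian_rv_def)
next
  case False
  then have "(\<Sum>b\<in>I. (c b)\<^sup>2) > 0" by (simp add: less_le sum_nonneg)
  from distributed_gauss_seq_lincomb[OF I this] this show ?thesis
    unfolding centered_gaussian_rv_def
    by (intro conjI disjI2 exI[of _ "sqrt (\<Sum>b\<in>I. (c b)\<^sup>2)"]) auto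
qed

text \<open>Triangular with respect to the enumeration \<open>to_nat\<close>, the shape of a
  Cholesky factor. The range of summation in \<open>gvec\<close> depends only on the index, so
  entrywise convergence of factors yields pointwise convergence of the variables they
  define.\<close>

definition lower :: "('i::countable \<Rightarrow> nat \<Rightarrow> real) \<Rightarrow> bool" where
  "lower L \<longleftrightarrow> (\<forall>i b. to_nat i < b \<longrightarrow> L i b = 0)"

definition gvec :: "('i::countable \<Rightarrow> nat \<Rightarrow> real) \<Rightarrow> 'i \<Rightarrow> (nat \<Rightarrow> real) \<Rightarrow> real" where
  "gvec L i w = (\<Sum>b\<le>to_nat i. L i b * w b)"

lemma temperate_gvec [intro!]: "temperate (gvec L i)"
  unfolding gvec_def[abs_def] by auto

lemma measurable_gvec [measurable]: "gvec L i \<in> borel_measurable (PiM UNIV (\<lambda>_. borel))"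
  unfolding gvec_def[abs_def] by measurable

lemma gvec_eq_lin:
  assumes "lower L" "to_nat i < m"
  shows "gvec L i w = (\<Sum>b<m. L i b * w b)"
  unfolding gvec_def by (intro sum.mono_neutral_left) (use assms in \<open>auto simp: lower_def\<close>)

lemma lower_inner_eq:
  assumes "lower L" "to_nat i < m"
  shows "(\<Sum>b\<le>to_nat i. L i b * L j b) = (\<Sum>b<m. L i b * L j b)"
  by (intro sum.mono_neutral_left) (use assms in \<open>auto simp: lower_def\<close>)

lemma gvec_covariance:
  assumes "lower L"
  shows "(\<integral>w. gvec L i w * gvec L j w \<partial>gauss_seq) = (\<Sum>b\<le>to_nat i. L i b * L j b)"
proof -
  define m where "m = Suc (max (to_nat i) (to_nat j))"
  have m: "to_nat i < m" "to_nat j < m" by (auto simp: m_def)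
  show ?thesis
    using lin_covariance[of m "\<lambda>_. L i" 0 "\<lambda>_. L j" 0]
    unfolding lin_def gvec_eq_lin[OF assms m(1)] gvec_eq_lin[OF assms m(2)] lower_inner_eq[OF assms m(1)] by simp
qed

lemma jointly_gaussian_gvec: "jointly_gaussian gauss_seq (gvec L)"
  unfolding jointly_gaussian_def
proof (intro allI impI)
  fix I :: "'a set" and c :: "'a \<Rightarrow> real" assume I: "finite I"
  define m where "m = Suc (Max (to_nat ` I))"
  have m: "to_nat i < m" if "i \<in> I" for i using I that by (auto simp: m_def less_Suc_eq_le)
  have "(\<Sum>i\<in>I. c i * gvec L i w) = (\<Sum>b<m. (\<Sum>i\<in>I. c i * (if b \<le> to_nat i then L i b else 0)) * w b)" for w
  proof -
    have "(\<Sum>i\<in>I. c i * gvec L i w) = (\<Sum>i\<in>I. \<Sum>b<m. c i * (if b \<le> to_nat i then L i b else 0) * w b)"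
    proof (rule sum.cong[OF refl])
      fix i assume i: "i \<in> I"
      have "gvec L i w = (\<Sum>b<m. (if b \<le> to_nat i then L i b else 0) * w b)"
        unfolding gvec_def using m[OF i] by (intro sum.mono_neutral_cong_left) auto
      then show "c i * gvec L i w = (\<Sum>b<m. c i * (if b \<le> to_nat i then L i b else 0) * w b)"
        by (simp add: sum_distrib_left mult.assoc)
    qed
    also have "\<dots> = (\<Sum>b<m. \<Sum>i\<in>I. c i * (if b \<le> to_nat i then L i b else 0) * w b)" by (rule sum.swap)
    finally show ?thesis by (simp only: sum_distrib_right)
  qed
  then show "centered_gaussian_rv gauss_seq (\<lambda>w. \<Sum>i\<in>I. c i * gvec L i w)"
    by (simp only:) (rule centered_gaussian_rv_lincomb, simp)
qed

text \<open>The Cholesky factor of the covariance kernel, applied to independent standard normals,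
  reproduces the covariances and therefore the joint law.\<close>

lemma jointly_gaussian_representation:
  fixes g :: "'i::countable \<Rightarrow> 'a \<Rightarrow> real"
  assumes M: "prob_space M" and g: "jointly_gaussian M g"
  obtains L :: "'i \<Rightarrow> nat \<Rightarrow> real" where "lower L"
    "\<And>i j. (\<Sum>b\<le>to_nat i. L i b * L j b) = (\<integral>x. g i x * g j x \<partial>M)"
    "distr M (PiM UNIV (\<lambda>_. borel)) (\<lambda>x i. g i x) = distr gauss_seq (PiM UNIV (\<lambda>_. borel)) (\<lambda>w i. gvec L i w)"
proof -
  interpret prob_space M by fact
  have cg: "centered_gaussian_rv M (g i)" for i by (rule jointly_gaussian_component[OF g])
  then have "psd (\<lambda>i j. \<integral>x. g i x * g j x \<partial>M)"
    by (intro psd_covariance centered_gaussian_rv_char(1)) (auto simp: centered_gaussian_rv_def)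
  from psd_factorization[OF this] obtain L :: "'i \<Rightarrow> nat \<Rightarrow> real" where L: "\<And>i s. to_nat i < s \<Longrightarrow> L i s = 0"
      "\<And>i j. (\<integral>x. g i x * g j x \<partial>M) = (\<Sum>s\<le>to_nat i. L i s * L j s)" by blast
  have low: "lower L" using L(1) by (simp add: lower_def)
  show ?thesis
  proof (rule that[OF low L(2)[symmetric]])
    show "distr M (PiM UNIV (\<lambda>_. borel)) (\<lambda>x i. g i x) = distr gauss_seq (PiM UNIV (\<lambda>_. borel)) (\<lambda>w i. gvec L i w)"
      by (intro jointly_gaussian_law_eq M g jointly_gaussian_gvec gauss_seq.prob_space_axioms)
        (simp add: gvec_covariance[OF low] L(2))
  qed
qed

lemma jointly_gaussian_comp:
  assumes "jointly_gaussian M g" "inj h"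
  shows "jointly_gaussian M (\<lambda>a. g (h a))"
  unfolding jointly_gaussian_def
proof (intro allI impI)
  fix I :: "'c set" and c :: "'c \<Rightarrow> real" assume I: "finite I"
  have "(\<Sum>i\<in>h`I. c (inv h i) * g i w) = (\<Sum>a\<in>I. c a * g (h a) w)" for w
    using assms(2) by (subst sum.reindex) (auto intro: inj_on_subset simp: inv_f_f)
  moreover have "centered_gaussian_rv M (\<lambda>w. \<Sum>i\<in>h`I. c (inv h i) * g i w)"
    using assms(1)[unfolded jointly_gaussian_def, rule_format, of "h ` I" "\<lambda>i. c (inv h i)"] I by simp
  ultimately show "centered_gaussian_rv M (\<lambda>w. \<Sum>a\<in>I. c a * g (h a) w)" by simp
qed

text \<open>Outside \<open>{..<n}\<close> the rearrangement is the identity. Injectivity on all of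
  \<open>nat\<close> is what allows it to reindex a whole Gaussian family while distinct indices
  stay distinct, so that orthogonality is preserved.\<close>

lemma decreasing_rearrangement:
  fixes f :: "nat \<Rightarrow> real"
  obtains p where "inj p" "bij_betw p {..<n} {..<n}" "\<And>a b. a \<le> b \<Longrightarrow> b < n \<Longrightarrow> f (p b) \<le> f (p a)"
proof -
  define xs where "xs = sort_key (\<lambda>j. - f j) [0..<n]"
  have len: "length xs = n" and set: "set xs = {..<n}" and dist: "distinct xs" by (auto simp: xs_def)
  define p where "p j = (if j < n then xs ! j else j)" for j
  have "bij_betw ((!) xs) {..<n} {..<n}"
    by (rule bij_betw_nth[OF dist]) (simp_all add: len set)
  then have bij: "bij_betw p {..<n} {..<n}"
    by (rule bij_betw_cong[THEN iffD1, rotated]) (simp add: p_def)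
  have lt: "p j < n \<longleftrightarrow> j < n" for j
    using bij by (auto simp: p_def bij_betw_def)
  have "inj p"
  proof (rule injI)
    fix a b assume eq: "p a = p b"
    then have "a < n \<longleftrightarrow> b < n" using lt by metis
    then show "a = b" using eq bij by (cases "a < n") (auto simp: p_def bij_betw_def inj_on_def)
  qed
  moreover have "f (p b) \<le> f (p a)" if "a \<le> b" "b < n" for a b
  proof -
    have "sorted (map (\<lambda>j. - f j) xs)" by (simp add: xs_def)
    from sorted_nth_mono[OF this, of a b] that len show ?thesis by (simp add: p_def)
  qed
  ultimately show ?thesis using that bij by blast
qed

lemma borel_measurable_vec_lambda [measurable (raw)]:
  fixes f :: "'k::finite \<Rightarrow> 'a \<Rightarrow> real"
  assumes [measurable]: "\<And>i. f i \<in> borel_measurable M"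
  shows "(\<lambda>x. \<chi> i. f i x) \<in> borel_measurable M"
proof (subst borel_measurable_euclidean_space, intro ballI)
  fix b :: "real ^ 'k" assume "b \<in> Basis"
  then obtain i where "b = axis i 1" by (auto simp: Basis_vec_def)
  then show "(\<lambda>x. (\<chi> i. f i x) \<bullet> b) \<in> borel_measurable M"
    by (simp add: inner_axis)
qed

text \<open>Orthonormality is imposed within each first index \<open>i\<close> only, as in the
  hypothesis on the variables. The sum up to \<open>to_nat (i, j)\<close> is the full inner product,
  because row \<open>(i, j)\<close> vanishes beyond.\<close>

definition orthonormal_rows :: "('k::countable \<times> nat \<Rightarrow> nat \<Rightarrow> real) \<Rightarrow> bool" where
  "orthonormal_rows L \<longleftrightarrow> lower L \<and>
    (\<forall>i j j'. (\<Sum>b\<le>to_nat (i, j). L (i, j) b * L (i, j') b) = (if j = j' then 1 else 0))"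

text \<open>The index set \<open>S\<close> is a parameter so that head, middle part, tail and their
  unions are instances of one object.\<close>

definition chaos :: "('k::countable \<Rightarrow> nat \<Rightarrow> real) \<Rightarrow> ('k \<times> nat \<Rightarrow> nat \<Rightarrow> real) \<Rightarrow> nat set \<Rightarrow> 'k \<Rightarrow> (nat \<Rightarrow> real) \<Rightarrow> real" where
  "chaos l L S i w = (\<Sum>j\<in>S. l i j * ((gvec L (i, j) w)\<^sup>2 - 1))"

lemma temperate_chaos [intro!]: "temperate (chaos l L S i)"
  unfolding chaos_def[abs_def] by auto

lemma measurable_chaos [measurable]: "chaos l L S i \<in> borel_measurable (PiM UNIV (\<lambda>_. borel))"
  unfolding chaos_def[abs_def] by measurable

lemma (in prob_space) expectation_abs_le_of_nn_integral:
  fixes X :: "'a \<Rightarrow> real"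
  assumes [measurable]: "X \<in> borel_measurable M" and le: "(\<integral>\<^sup>+x. ennreal ((X x)\<^sup>2) \<partial>M) \<le> ennreal (e\<^sup>2)" and e: "e \<ge> 0"
  shows "integrable M X" "(\<integral>x. \<bar>X x\<bar> \<partial>M) \<le> e"
proof -
  have i: "integrable M (\<lambda>x. (X x)\<^sup>2)"
    using le by (intro integrableI_nonneg) (auto intro: le_less_trans)
  then show "integrable M X" using square_integrable_imp_integrable[of X] by simp
  have "(\<integral>x. (X x)\<^sup>2 \<partial>M) \<le> e\<^sup>2"
    using le nn_integral_eq_integral[OF i] by simp
  then have "sqrt (\<integral>x. (X x)\<^sup>2 \<partial>M) \<le> e" using e by (rule real_le_lsqrt[rotated])
  then show "(\<integral>x. \<bar>X x\<bar> \<partial>M) \<le> e" using expectation_abs_le_sqrt[OF _ i] by simp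
qed

text \<open>The given vector and its model live on different spaces, so they are compared through
  expectations of bounded Lipschitz functions, which an \<open>L^2\<close> error \<open>e\<close> in
  each coordinate controls. The model is chosen before \<open>f\<close>; hence one model serves all
  test functions.\<close>

lemma chaos_vector_approx:
  fixes g :: "'k::finite \<times> nat \<Rightarrow> 'a \<Rightarrow> real"
  assumes M: "prob_space M" and cv: "chaos_vector M g lam F" and e: "e > 0"
  shows "\<exists>J l L. orthonormal_rows L \<and> (\<forall>i j. J \<le> j \<longrightarrow> l i j = 0) \<and> (\<forall>i a b. a \<le> b \<longrightarrow> \<bar>l i b\<bar> \<le> \<bar>l i a\<bar>) \<and>
    (\<forall>f :: real ^ 'k \<Rightarrow> real. \<forall>B c. f \<in> borel_measurable borel \<longrightarrow> (\<forall>x. \<bar>f x\<bar> \<le> B) \<longrightarrow> c \<ge> 0 \<longrightarrow>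
      (\<forall>x y. \<bar>f x - f y\<bar> \<le> c * (\<Sum>i\<in>UNIV. \<bar>x $ i - y $ i\<bar>)) \<longrightarrow>
      \<bar>(\<integral>x. f (\<chi> i. F i x) \<partial>M) - (\<integral>w. f (\<chi> i. chaos l L {..<J} i w) \<partial>gauss_seq)\<bar> \<le> c * (real CARD('k) * e))"
proof -
  interpret prob_space M by fact
  have g: "jointly_gaussian M g" and nd: "\<And>ij. distributed M lborel (g ij) (normal_density 0 1)"
    and orth: "\<And>i j j'. j \<noteq> j' \<Longrightarrow> (\<integral>x. g (i, j) x * g (i, j') x \<partial>M) = 0"
    and mF [measurable]: "\<And>i. F i \<in> borel_measurable M"
    and lim: "\<And>i. (\<lambda>N. \<integral>\<^sup>+x. ennreal ((F i x - (\<Sum>j<N. lam i j * ((g (i, j) x)\<^sup>2 - 1)))\<^sup>2) \<partial>M) \<longlonglongrightarrow> 0"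
    using cv by (auto simp: chaos_vector_def)
  have mg [measurable]: "g ij \<in> borel_measurable M" for ij
    using nd[of ij] by (simp add: distributed_def)
  define S where "S N i x = (\<Sum>j<N. lam i j * ((g (i, j) x)\<^sup>2 - 1))" for N i x
  have [measurable]: "S N i \<in> borel_measurable M" for N i unfolding S_def[abs_def] by measurable
  have "\<forall>\<^sub>F N in sequentially. \<forall>i\<in>UNIV. (\<integral>\<^sup>+x. ennreal ((F i x - S N i x)\<^sup>2) \<partial>M) < ennreal (e\<^sup>2)"
    using lim e unfolding S_def by (intro eventually_ball_finite ballI order_tendstoD(2)) auto
  then obtain J where J: "\<And>i. (\<integral>\<^sup>+x. ennreal ((F i x - S J i x)\<^sup>2) \<partial>M) < ennreal (e\<^sup>2)"
    by (auto simp: eventually_sequentially)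
  have "\<forall>i. \<exists>p. inj p \<and> bij_betw p {..<J} {..<J} \<and> (\<forall>a b. a \<le> b \<longrightarrow> b < J \<longrightarrow> \<bar>lam i (p b)\<bar> \<le> \<bar>lam i (p a)\<bar>)"
  proof
    fix i
    obtain p where "inj p" "bij_betw p {..<J} {..<J}" "\<And>a b. a \<le> b \<Longrightarrow> b < J \<Longrightarrow> \<bar>lam i (p b)\<bar> \<le> \<bar>lam i (p a)\<bar>"
      by (rule decreasing_rearrangement[where f = "\<lambda>j. \<bar>lam i j\<bar>" and n = J]) blast
    then show "\<exists>p. inj p \<and> bij_betw p {..<J} {..<J} \<and> (\<forall>a b. a \<le> b \<longrightarrow> b < J \<longrightarrow> \<bar>lam i (p b)\<bar> \<le> \<bar>lam i (p a)\<bar>)"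
      by blast
  qed
  then obtain p where p: "\<And>i. inj (p i)" "\<And>i. bij_betw (p i) {..<J} {..<J}"
     "\<And>i a b. a \<le> b \<Longrightarrow> b < J \<Longrightarrow> \<bar>lam i (p i b)\<bar> \<le> \<bar>lam i (p i a)\<bar>"
    by metis
  define l where "l i j = (if j < J then lam i (p i j) else 0)" for i j
  \<comment> \<open>Each first index has its own rearrangement, which is legitimate because
    orthogonality only relates variables with equal first index. Permuting inside
    \<open>{..<J}\<close> does not change the truncated sum; this is why truncation precedes
    sorting.\<close>
  define h where "h ij = (fst ij, p (fst ij) (snd ij))" for ij
  have "inj h" using p(1) by (auto simp: inj_def h_def)
  from jointly_gaussian_comp[OF g this] have g': "jointly_gaussian M (\<lambda>ij. g (h ij))" .
  from jointly_gaussian_representation[OF M g'] obtain L where L: "lower L"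
    "\<And>i j. (\<Sum>b\<le>to_nat i. L i b * L j b) = (\<integral>x. g (h i) x * g (h j) x \<partial>M)"
    "distr M (PiM UNIV (\<lambda>_. borel)) (\<lambda>x i. g (h i) x) = distr gauss_seq (PiM UNIV (\<lambda>_. borel)) (\<lambda>w i. gvec L i w)"
    by blast
  have var: "(\<integral>x. g ij x * g ij x \<partial>M) = 1" for ij
    using standard_normal_distributed_variance[OF nd] standard_normal_distributed_expectation[OF nd]
    by (simp add: power2_eq_square)
  have "orthonormal_rows L"
    unfolding orthonormal_rows_def using L(1) p(1) by (auto simp: L(2) h_def var intro!: orth dest: injD)
  moreover have "\<forall>i j. J \<le> j \<longrightarrow> l i j = 0" by (auto simp: l_def)
  moreover have "\<forall>i a b. a \<le> b \<longrightarrow> \<bar>l i b\<bar> \<le> \<bar>l i a\<bar>" using p(3) by (auto simp: l_def)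
  moreover have "\<bar>(\<integral>x. f (\<chi> i. F i x) \<partial>M) - (\<integral>w. f (\<chi> i. chaos l L {..<J} i w) \<partial>gauss_seq)\<bar> \<le> c * (real CARD('k) * e)"
    if f [measurable]: "f \<in> borel_measurable borel" and B: "\<And>x. \<bar>f x\<bar> \<le> B" and c: "c \<ge> 0"
      and lip: "\<And>x y. \<bar>f x - f y\<bar> \<le> c * (\<Sum>i\<in>UNIV. \<bar>x $ i - y $ i\<bar>)" for f :: "real ^ 'k \<Rightarrow> real" and B c
  proof -
    define G where "G z = f (\<chi> i. \<Sum>j<J. l i j * ((z (i, j))\<^sup>2 - 1))" for z :: "'k \<times> nat \<Rightarrow> real"
    have [measurable]: "G \<in> borel_measurable (PiM UNIV (\<lambda>_. borel))" unfolding G_def[abs_def] by measurable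
    have m1: "(\<lambda>w i. gvec L i w) \<in> gauss_seq \<rightarrow>\<^sub>M PiM UNIV (\<lambda>_. borel)"
      by (rule measurable_PiM_single') (auto simp: space_PiM)
    have m2: "(\<lambda>w i. g (h i) w) \<in> M \<rightarrow>\<^sub>M PiM UNIV (\<lambda>_. borel)"
      by (rule measurable_PiM_single') (auto simp: space_PiM)
    have "(\<integral>w. f (\<chi> i. chaos l L {..<J} i w) \<partial>gauss_seq) = (\<integral>w. G (\<lambda>i. gvec L i w) \<partial>gauss_seq)"
      by (simp add: G_def chaos_def)
    also have "\<dots> = (\<integral>x. G (\<lambda>i. g (h i) x) \<partial>M)"
      using arg_cong[OF L(3), of "\<lambda>N. integral\<^sup>L N G"] by (simp add: integral_distr[OF m1] integral_distr[OF m2])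
    also have "\<dots> = (\<integral>x. f (\<chi> i. S J i x) \<partial>M)"
    proof -
      have "(\<Sum>j<J. l i j * ((g (h (i, j)) x)\<^sup>2 - 1)) = S J i x" for i x
        unfolding S_def l_def h_def
        by (subst sum.reindex_bij_betw[OF p(2)[of i], symmetric]) simp
      then show ?thesis by (simp add: G_def)
    qed
    finally have eq: "(\<integral>w. f (\<chi> i. chaos l L {..<J} i w) \<partial>gauss_seq) = (\<integral>x. f (\<chi> i. S J i x) \<partial>M)" .
    have fi: "integrable M (\<lambda>x. f (\<chi> i. Z i x))" if [measurable]: "\<And>i. Z i \<in> borel_measurable M" for Z
      using B by (intro integrable_const_bound[of _ B]) auto
    note ap = expectation_abs_le_of_nn_integral[OF _ less_imp_le[OF J] less_imp_le[OF e]]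
    have "\<bar>(\<integral>x. f (\<chi> i. F i x) \<partial>M) - (\<integral>x. f (\<chi> i. S J i x) \<partial>M)\<bar> = \<bar>(\<integral>x. f (\<chi> i. F i x) - f (\<chi> i. S J i x) \<partial>M)\<bar>"
      by (subst Bochner_Integration.integral_diff) (auto intro!: fi)
    also have "\<dots> \<le> (\<integral>x. \<bar>f (\<chi> i. F i x) - f (\<chi> i. S J i x)\<bar> \<partial>M)"
      by (rule integral_abs_bound)
    also have "\<dots> \<le> (\<integral>x. c * (\<Sum>i\<in>UNIV. \<bar>F i x - S J i x\<bar>) \<partial>M)"
    proof (rule integral_mono)
      show "\<bar>f (\<chi> i. F i x) - f (\<chi> i. S J i x)\<bar> \<le> c * (\<Sum>i\<in>UNIV. \<bar>F i x - S J i x\<bar>)" for x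
        using lip[of "\<chi> i. F i x" "\<chi> i. S J i x"] by simp
      show "integrable M (\<lambda>x. c * (\<Sum>i\<in>UNIV. \<bar>F i x - S J i x\<bar>))"
        by (intro integrable_mult_right Bochner_Integration.integrable_sum integrable_abs ap(1)) auto
      show "integrable M (\<lambda>x. \<bar>f (\<chi> i. F i x) - f (\<chi> i. S J i x)\<bar>)"
        by (intro integrable_abs Bochner_Integration.integrable_diff fi) auto
    qed
    also have "\<dots> = c * (\<Sum>i\<in>UNIV. (\<integral>x. \<bar>F i x - S J i x\<bar> \<partial>M))"
      by (simp add: ap(1))
    also have "\<dots> \<le> c * (\<Sum>i\<in>(UNIV::'k set). e)"
      using c by (intro mult_left_mono sum_mono ap(2)) auto
    finally show ?thesis unfolding eq by simp
  qed
  ultimately show ?thesis by blast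
qed

section \<open>Head and tail of a chaos vector\<close>

lemma orthonormal_sum_square:
  fixes v :: "nat \<Rightarrow> nat \<Rightarrow> real"
  assumes S: "finite S" and o: "\<And>j j'. j \<in> S \<Longrightarrow> j' \<in> S \<Longrightarrow> (\<Sum>p<m. v j p * v j' p) = (if j = j' then 1 else 0)"
  shows "(\<Sum>p<m. (\<Sum>j\<in>S. c j * v j p)\<^sup>2) = (\<Sum>j\<in>S. (c j)\<^sup>2)"
proof -
  have "(\<Sum>p<m. (\<Sum>j\<in>S. c j * v j p)\<^sup>2) = (\<Sum>p<m. \<Sum>j\<in>S. \<Sum>j'\<in>S. c j * c j' * (v j p * v j' p))"
    by (simp add: power2_eq_square sum_product mult_ac)
  also have "\<dots> = (\<Sum>j\<in>S. \<Sum>j'\<in>S. \<Sum>p<m. c j * c j' * (v j p * v j' p))"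
    by (subst sum.swap, rule sum.cong[OF refl], subst sum.swap, rule refl)
  also have "\<dots> = (\<Sum>j\<in>S. \<Sum>j'\<in>S. c j * c j' * (if j = j' then 1 else 0))"
    unfolding sum_distrib_left[symmetric] by (intro sum.cong refl) (auto simp: o)
  also have "\<dots> = (\<Sum>j\<in>S. (c j)\<^sup>2)"
    using S by (intro sum.cong refl) (simp add: power2_eq_square if_distrib sum.delta cong: if_cong)
  finally show ?thesis .
qed

lemma bessel_inequality:
  fixes v :: "nat \<Rightarrow> nat \<Rightarrow> real"
  assumes S: "finite S" and o: "\<And>j j'. j \<in> S \<Longrightarrow> j' \<in> S \<Longrightarrow> (\<Sum>p<m. v j p * v j' p) = (if j = j' then 1 else 0)"
  shows "(\<Sum>j\<in>S. (\<Sum>p<m. v j p * x p)\<^sup>2) \<le> (\<Sum>p<m. (x p)\<^sup>2)"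
proof -
  define c where "c j = (\<Sum>p<m. v j p * x p)" for j
  have "0 \<le> (\<Sum>p<m. (x p - (\<Sum>j\<in>S. c j * v j p))\<^sup>2)" by (intro sum_nonneg) auto
  also have "\<dots> = (\<Sum>p<m. (x p)\<^sup>2) - 2 * (\<Sum>p<m. \<Sum>j\<in>S. c j * (v j p * x p)) + (\<Sum>p<m. (\<Sum>j\<in>S. c j * v j p)\<^sup>2)"
    by (simp add: power2_diff sum.distrib sum_subtractf sum_distrib_left mult_ac)
  also have "(\<Sum>p<m. \<Sum>j\<in>S. c j * (v j p * x p)) = (\<Sum>j\<in>S. (c j)\<^sup>2)"
    by (subst sum.swap) (simp add: c_def power2_eq_square flip: sum_distrib_left)
  also have "(\<Sum>p<m. (\<Sum>j\<in>S. c j * v j p)\<^sup>2) = (\<Sum>j\<in>S. (c j)\<^sup>2)"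
    by (rule orthonormal_sum_square[OF S o])
  finally show ?thesis by (simp add: c_def)
qed

text \<open>A spectral decomposition when the rows are orthonormal: the rows \<open>(i, j)\<close>
  with \<open>j\<close> in \<open>S\<close> are eigenvectors and \<open>l i j\<close> are the
  eigenvalues.\<close>

definition chaos_mat :: "('k \<Rightarrow> nat \<Rightarrow> real) \<Rightarrow> ('k \<times> nat \<Rightarrow> nat \<Rightarrow> real) \<Rightarrow> nat set \<Rightarrow> 'k \<Rightarrow> nat \<Rightarrow> nat \<Rightarrow> real" where
  "chaos_mat l L S i p r = (\<Sum>j\<in>S. l i j * L (i, j) p * L (i, j) r)"

lemma orthonormal_rowsD:
  assumes "orthonormal_rows L" "to_nat (i, j) < m"
  shows "(\<Sum>p<m. L (i, j) p * L (i, j') p) = (if j = j' then 1 else 0)"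
  using assms lower_inner_eq[of L "(i, j)" m "(i, j')"] by (simp add: orthonormal_rows_def)

text \<open>The rows being unit vectors, the trace of the matrix is the sum of the
  \<open>l i j\<close>, which matches the centring of the squares.\<close>

lemma chaos_eq_qf:
  assumes L: "orthonormal_rows L" and m: "\<And>j. j \<in> S \<Longrightarrow> to_nat (i, j) < m"
  shows "chaos l L S i w = qf m (chaos_mat l L S i) w"
proof -
  have low: "lower L" using L by (simp add: orthonormal_rows_def)
  have "(\<Sum>p<m. w p * lin m (chaos_mat l L S i) p w) =
     (\<Sum>p<m. \<Sum>r<m. \<Sum>j\<in>S. l i j * ((L (i, j) p * w p) * (L (i, j) r * w r)))"
    by (simp add: lin_def chaos_mat_def sum_distrib_left sum_distrib_right mult_ac)
  also have "\<dots> = (\<Sum>j\<in>S. \<Sum>p<m. \<Sum>r<m. l i j * ((L (i, j) p * w p) * (L (i, j) r * w r)))"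
    by (subst (2) sum.swap, subst sum.swap, rule refl)
  also have "\<dots> = (\<Sum>j\<in>S. l i j * (gvec L (i, j) w)\<^sup>2)"
  proof (rule sum.cong[OF refl])
    fix j assume "j \<in> S"
    then have "gvec L (i, j) w = (\<Sum>b<m. L (i, j) b * w b)" by (intro gvec_eq_lin[OF low] m)
    then show "(\<Sum>p<m. \<Sum>r<m. l i j * ((L (i, j) p * w p) * (L (i, j) r * w r))) = l i j * (gvec L (i, j) w)\<^sup>2"
      by (simp only: power2_eq_square sum_product) (simp only: sum_distrib_left)
  qed
  finally have 1: "(\<Sum>p<m. w p * lin m (chaos_mat l L S i) p w) = (\<Sum>j\<in>S. l i j * (gvec L (i, j) w)\<^sup>2)" .
  have "(\<Sum>p<m. chaos_mat l L S i p p) = (\<Sum>j\<in>S. l i j * (\<Sum>p<m. L (i, j) p * L (i, j) p))"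
    unfolding chaos_mat_def by (subst sum.swap) (simp add: sum_distrib_left mult_ac)
  also have "\<dots> = (\<Sum>j\<in>S. l i j)"
    by (intro sum.cong refl) (simp add: orthonormal_rowsD[OF L m])
  finally show ?thesis using 1 by (simp add: chaos_def qf_def right_diff_distrib sum_subtractf)
qed

lemma chaos_mat_sym: "chaos_mat l L S i p r = chaos_mat l L S i r p"
  by (simp add: chaos_mat_def mult_ac)

lemma chaos_mat_square:
  assumes L: "orthonormal_rows L" and S: "finite S" and m: "\<And>j. j \<in> S \<Longrightarrow> to_nat (i, j) < m"
  shows "(\<Sum>p<m. \<Sum>r<m. (chaos_mat l L S i p r)\<^sup>2) = (\<Sum>j\<in>S. (l i j)\<^sup>2)"
proof -
  have o: "(\<Sum>p<m. L (i, j) p * L (i, j') p) = (if j = j' then 1 else 0)" if "j \<in> S" "j' \<in> S" for j j'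
    using orthonormal_rowsD[OF L m] that by blast
  have "(\<Sum>p<m. \<Sum>r<m. (chaos_mat l L S i p r)\<^sup>2) = (\<Sum>r<m. \<Sum>p<m. (\<Sum>j\<in>S. (l i j * L (i, j) r) * L (i, j) p)\<^sup>2)"
    unfolding chaos_mat_def by (subst sum.swap) (simp add: mult_ac)
  also have "\<dots> = (\<Sum>r<m. \<Sum>j\<in>S. (l i j * L (i, j) r)\<^sup>2)"
    by (intro sum.cong refl orthonormal_sum_square[OF S o])
  also have "\<dots> = (\<Sum>j\<in>S. (l i j)\<^sup>2 * (\<Sum>r<m. L (i, j) r * L (i, j) r))"
    by (subst sum.swap) (simp add: power2_eq_square sum_distrib_left mult_ac)
  also have "\<dots> = (\<Sum>j\<in>S. (l i j)\<^sup>2)"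
    by (intro sum.cong refl) (simp add: o)
  finally show ?thesis .
qed

text \<open>Coordinates along the eigenvectors are multiplied by at most \<open>\<delta>\<close>,
  and by Bessel their squares add up to at most the squared length of \<open>x\<close>.\<close>

lemma chaos_mat_op_bound:
  assumes L: "orthonormal_rows L" and S: "finite S" and m: "\<And>j. j \<in> S \<Longrightarrow> to_nat (i, j) < m"
    and \<delta>: "\<And>j. j \<in> S \<Longrightarrow> \<bar>l i j\<bar> \<le> \<delta>"
  shows "(\<Sum>p<m. (lin m (chaos_mat l L S i) p x)\<^sup>2) \<le> \<delta>\<^sup>2 * (\<Sum>p<m. (x p)\<^sup>2)"
proof -
  have o: "(\<Sum>p<m. L (i, j) p * L (i, j') p) = (if j = j' then 1 else 0)" if "j \<in> S" "j' \<in> S" for j j'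
    using orthonormal_rowsD[OF L m] that by blast
  define c where "c j = (\<Sum>r<m. L (i, j) r * x r)" for j
  have "lin m (chaos_mat l L S i) p x = (\<Sum>j\<in>S. (l i j * c j) * L (i, j) p)" for p
    unfolding lin_def chaos_mat_def c_def sum_distrib_left sum_distrib_right
    by (subst sum.swap) (simp add: mult_ac)
  then have "(\<Sum>p<m. (lin m (chaos_mat l L S i) p x)\<^sup>2) = (\<Sum>j\<in>S. (l i j * c j)\<^sup>2)"
    using orthonormal_sum_square[OF S o, of "\<lambda>j. l i j * c j"] by simp
  also have "\<dots> \<le> (\<Sum>j\<in>S. \<delta>\<^sup>2 * (c j)\<^sup>2)"
  proof (rule sum_mono)
    fix j assume "j \<in> S"
    then have "(l i j)\<^sup>2 \<le> \<delta>\<^sup>2" using \<delta>[of j] by (metis abs_ge_zero power2_abs power_mono)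
    then show "(l i j * c j)\<^sup>2 \<le> \<delta>\<^sup>2 * (c j)\<^sup>2" by (simp add: power_mult_distrib mult_right_mono)
  qed
  also have "\<dots> = \<delta>\<^sup>2 * (\<Sum>j\<in>S. (c j)\<^sup>2)" by (simp add: sum_distrib_left)
  also have "\<dots> \<le> \<delta>\<^sup>2 * (\<Sum>p<m. (x p)\<^sup>2)"
    unfolding c_def by (intro mult_left_mono bessel_inequality[OF S o]) auto
  finally show ?thesis .
qed

lemma chaos_second_moment:
  assumes L: "orthonormal_rows L" and S: "finite S"
  shows "(\<integral>w. (chaos l L S i w)\<^sup>2 \<partial>gauss_seq) = 2 * (\<Sum>j\<in>S. (l i j)\<^sup>2)"
proof -
  obtain m where m: "\<And>j. j \<in> S \<Longrightarrow> to_nat (i, j) < m"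
    using finite_nat_set_iff_bounded[of "(\<lambda>j. to_nat (i, j)) ` S"] S by auto
  have eq: "chaos l L S i w = qf m (chaos_mat l L S i) w" for w by (rule chaos_eq_qf[OF L m])
  have "(\<integral>w. (chaos l L S i w)\<^sup>2 \<partial>gauss_seq) = 2 * (\<Sum>p<m. \<Sum>r<m. (chaos_mat l L S i p r)\<^sup>2)"
    unfolding eq power2_eq_square by (rule qf_covariance) (rule chaos_mat_sym)
  then show ?thesis by (simp add: chaos_mat_square[OF L S m])
qed

text \<open>The variance is twice the sum of squares, and \<open>108 = 27 * 2^2\<close>.\<close>

lemma chaos_fourth_moment:
  assumes L: "orthonormal_rows L" and S: "finite S"
  shows "(\<integral>w. (chaos l L S i w) ^ 4 \<partial>gauss_seq) \<le> 27 * (\<integral>w. (chaos l L S i w)\<^sup>2 \<partial>gauss_seq)\<^sup>2"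
proof -
  obtain m where m: "\<And>j. j \<in> S \<Longrightarrow> to_nat (i, j) < m"
    using finite_nat_set_iff_bounded[of "(\<lambda>j. to_nat (i, j)) ` S"] S by auto
  have eq: "chaos l L S i w = qf m (chaos_mat l L S i) w" for w by (rule chaos_eq_qf[OF L m])
  have "(\<integral>w. (chaos l L S i w) ^ 4 \<partial>gauss_seq) \<le> 108 * (\<Sum>p<m. \<Sum>r<m. (chaos_mat l L S i p r)\<^sup>2)\<^sup>2"
    unfolding eq by (rule qf_fourth_moment) (rule chaos_mat_sym)
  then show ?thesis by (simp add: chaos_mat_square[OF L S m] chaos_second_moment[OF L S])
qed

lemma qf_sum: "qf m (\<lambda>p r. \<Sum>i\<in>I. t i * R i p r) w = (\<Sum>i\<in>I. t i * qf m (R i) w)"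
proof -
  have "(\<Sum>p<m. w p * lin m (\<lambda>p r. \<Sum>i\<in>I. t i * R i p r) p w) = (\<Sum>p<m. \<Sum>i\<in>I. t i * (w p * lin m (R i) p w))"
  proof (rule sum.cong[OF refl])
    fix p
    have "lin m (\<lambda>p r. \<Sum>i\<in>I. t i * R i p r) p w = (\<Sum>i\<in>I. t i * lin m (R i) p w)"
      unfolding lin_def sum_distrib_left sum_distrib_right by (subst sum.swap) (simp add: mult_ac)
    then show "w p * lin m (\<lambda>p r. \<Sum>i\<in>I. t i * R i p r) p w = (\<Sum>i\<in>I. t i * (w p * lin m (R i) p w))"
      by (simp add: sum_distrib_left mult_ac)
  qed
  also have "\<dots> = (\<Sum>i\<in>I. t i * (\<Sum>p<m. w p * lin m (R i) p w))"
    by (subst sum.swap) (simp add: sum_distrib_left)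
  finally have "(\<Sum>p<m. w p * lin m (\<lambda>p r. \<Sum>i\<in>I. t i * R i p r) p w) = (\<Sum>i\<in>I. t i * (\<Sum>p<m. w p * lin m (R i) p w))" .
  moreover have "(\<Sum>p<m. \<Sum>i\<in>I. t i * R i p p) = (\<Sum>i\<in>I. t i * (\<Sum>p<m. R i p p))"
    by (subst sum.swap) (simp add: sum_distrib_left)
  ultimately show ?thesis by (simp add: qf_def right_diff_distrib sum_subtractf)
qed

lemma lin_sum: "lin m (\<lambda>p r. \<Sum>i\<in>I. t i * R i p r) p w = (\<Sum>i\<in>I. t i * lin m (R i) p w)"
  unfolding lin_def sum_distrib_left sum_distrib_right by (subst sum.swap) (simp add: mult_ac)

lemma psd_inner: "psd (\<lambda>i j. \<Sum>p<m::nat. \<Sum>r<m::nat. x i p r * x j p r)"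
  unfolding psd_def
proof (intro conjI allI impI)
  show "(\<Sum>p<m. \<Sum>r<m. x i p r * x j p r) = (\<Sum>p<m. \<Sum>r<m. x j p r * x i p r)" for i j
    by (simp add: mult.commute)
  fix I :: "'a set" and c :: "'a \<Rightarrow> real"
  show "0 \<le> (\<Sum>i\<in>I. \<Sum>j\<in>I. c i * c j * (\<Sum>p<m. \<Sum>r<m. x i p r * x j p r))"
    unfolding sum_sum_lincomb_square[symmetric] by (intro sum_nonneg) auto
qed

text \<open>Exceeds every \<open>to_nat i\<close>, hence bounds the columns on which a triangular
  factor over \<open>'k\<close> can be nonzero. As \<open>to_nat\<close> is merely injective, it
  need not be the number of elements of \<open>'k\<close>.\<close>

definition kdim :: "'k::finite itself \<Rightarrow> nat" where
  "kdim _ = Suc (Max (range (to_nat :: 'k \<Rightarrow> nat)))"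

lemma to_nat_less_kdim: "to_nat (i :: 'k::finite) < kdim TYPE('k)"
  unfolding kdim_def by (simp add: less_Suc_eq_le)

lemma sum_mult_square_le:
  fixes t :: "'k::finite \<Rightarrow> real"
  shows "(\<Sum>i\<in>UNIV. t i * x i)\<^sup>2 \<le> (\<Sum>i\<in>UNIV. (t i)\<^sup>2) * (\<Sum>i\<in>UNIV. (x i)\<^sup>2)"
  by (rule Cauchy_Schwarz_ineq_sum)

text \<open>The two vectors differ by the middle part, whose mean absolute value is at most its
  \<open>L^2\<close> norm. Writing the full index set as \<open>{..<M} \<union> {M..<J}\<close> also
  covers \<open>J < M\<close>.\<close>

lemma chaos_iexp_middle:
  fixes l :: "'k::finite \<Rightarrow> nat \<Rightarrow> real"
  assumes L: "orthonormal_rows L" and NM: "N \<le> M"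
  shows "norm ((\<integral>w. iexp (\<Sum>i\<in>UNIV. t i * chaos l L ({..<N} \<union> {M..<J}) i w) \<partial>gauss_seq) -
      (\<integral>w. iexp (\<Sum>i\<in>UNIV. t i * chaos l L ({..<M} \<union> {M..<J}) i w) \<partial>gauss_seq))
    \<le> sqrt (2 * (\<Sum>i\<in>UNIV. (t i)\<^sup>2) * (\<Sum>i\<in>UNIV. \<Sum>j\<in>{N..<M}. (l i j)\<^sup>2))"
proof -
  let ?X = "\<lambda>w. \<Sum>i\<in>UNIV. t i * chaos l L ({..<N} \<union> {M..<J}) i w"
  let ?Y = "\<lambda>w. \<Sum>i\<in>UNIV. t i * chaos l L ({..<M} \<union> {M..<J}) i w"
  let ?D = "\<lambda>w. \<Sum>i\<in>UNIV. t i * chaos l L {N..<M} i w"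
  have D: "?X w - ?Y w = - ?D w" for w
  proof -
    have "{..<M} \<union> {M..<J} = ({..<N} \<union> {M..<J}) \<union> {N..<M}" using NM by auto
    then have "chaos l L ({..<M} \<union> {M..<J}) i w = chaos l L ({..<N} \<union> {M..<J}) i w + chaos l L {N..<M} i w" for i
      unfolding chaos_def using NM by (simp only:) (subst sum.union_disjoint, auto)
    then show ?thesis by (simp add: algebra_simps sum.distrib)
  qed
  have "norm ((\<integral>w. iexp (?X w) \<partial>gauss_seq) - (\<integral>w. iexp (?Y w) \<partial>gauss_seq)) \<le> (\<integral>w. \<bar>?X w - ?Y w\<bar> \<partial>gauss_seq)"
    by (intro gauss_seq.norm_iexp_diff_le temperate_measurable temperate_integrable) auto
  also have "\<dots> = (\<integral>w. \<bar>?D w\<bar> \<partial>gauss_seq)" unfolding D by simp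
  also have "\<dots> \<le> sqrt (\<integral>w. (?D w)\<^sup>2 \<partial>gauss_seq)"
    by (intro gauss_seq.expectation_abs_le_sqrt temperate_measurable temperate_integrable) auto
  also have "\<dots> \<le> sqrt (2 * (\<Sum>i\<in>UNIV. (t i)\<^sup>2) * (\<Sum>i\<in>UNIV. \<Sum>j\<in>{N..<M}. (l i j)\<^sup>2))"
  proof (rule real_sqrt_le_mono)
    have "(\<integral>w. (?D w)\<^sup>2 \<partial>gauss_seq) \<le> (\<integral>w. (\<Sum>i\<in>UNIV. (t i)\<^sup>2) * (\<Sum>i\<in>UNIV. (chaos l L {N..<M} i w)\<^sup>2) \<partial>gauss_seq)"
      by (intro integral_mono sum_mult_square_le temperate_integrable) auto
    also have "\<dots> = (\<Sum>i\<in>UNIV. (t i)\<^sup>2) * (\<Sum>i\<in>UNIV. (\<integral>w. (chaos l L {N..<M} i w)\<^sup>2 \<partial>gauss_seq))"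
      by (subst integral_mult_right_zero, subst Bochner_Integration.integral_sum) (auto intro!: temperate_integrable)
    also have "\<dots> = (\<Sum>i\<in>UNIV. (t i)\<^sup>2) * (\<Sum>i\<in>UNIV. 2 * (\<Sum>j\<in>{N..<M}. (l i j)\<^sup>2))"
      by (simp add: chaos_second_moment[OF L])
    finally show "(\<integral>w. (?D w)\<^sup>2 \<partial>gauss_seq) \<le> 2 * (\<Sum>i\<in>UNIV. (t i)\<^sup>2) * (\<Sum>i\<in>UNIV. \<Sum>j\<in>{N..<M}. (l i j)\<^sup>2)"
      by (simp add: mult_ac flip: sum_distrib_left)
  qed
  finally show ?thesis .
qed

text \<open>Both factors are Gaussian. The first has variance 1; the second is the inner product of
  \<open>w\<close> with \<open>A v\<close>, whose variance is at most \<open>\<epsilon>^2\<close>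
  since \<open>v\<close> is a unit vector. The arithmetic-geometric inequality, weighted by
  \<open>\<epsilon>\<close>, gives the bound whatever the dependence between them.\<close>

lemma expectation_abs_gvec_mult_le:
  fixes v :: "'i::countable \<Rightarrow> nat \<Rightarrow> real"
  assumes symA: "\<And>p r. p < m \<Longrightarrow> r < m \<Longrightarrow> A p r = A r p"
    and \<epsilon>: "\<epsilon> > 0" "\<And>x. (\<Sum>p<m. (lin m A p x)\<^sup>2) \<le> \<epsilon>\<^sup>2 * (\<Sum>p<m. (x p)\<^sup>2)"
    and v: "lower v" "to_nat a < m" "(\<Sum>p<m. v a p * v a p) = 1"
  shows "(\<integral>w. \<bar>gvec v a w * (\<Sum>p<m. v a p * lin m A p w)\<bar> \<partial>gauss_seq) \<le> \<epsilon>"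
proof -
  let ?G = "gvec v a"
  define y where "y r = (\<Sum>p<m. v a p * A p r)" for r
  define Y where "Y w = lin m (\<lambda>_. y) 0 w" for w
  have Y: "(\<Sum>p<m. v a p * lin m A p w) = Y w" for w
    unfolding Y_def y_def lin_def sum_distrib_left sum_distrib_right by (subst sum.swap) (simp add: mult_ac)
  have tY [intro!]: "temperate Y" unfolding Y_def[abs_def] by (rule temperate_lin)
  have EG: "(\<integral>w. (?G w)\<^sup>2 \<partial>gauss_seq) = 1"
    using gvec_covariance[OF v(1), of a a] lower_inner_eq[OF v(1,2), of a] v(3) by (simp add: power2_eq_square)
  have "(\<integral>w. (Y w)\<^sup>2 \<partial>gauss_seq) = (\<Sum>r<m. (y r)\<^sup>2)"
    using lin_covariance[of m "\<lambda>_. y" 0 "\<lambda>_. y" 0] by (simp add: Y_def power2_eq_square)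
  also have "\<dots> = (\<Sum>r<m. (lin m A r (v a))\<^sup>2)"
    unfolding y_def lin_def by (intro sum.cong refl arg_cong[where f = "\<lambda>x. x\<^sup>2"]) (auto simp: symA mult.commute)
  also have "\<dots> \<le> \<epsilon>\<^sup>2 * 1" using \<epsilon>(2)[of "v a"] v(3) by (simp add: power2_eq_square)
  finally have EY: "(\<integral>w. (Y w)\<^sup>2 \<partial>gauss_seq) \<le> \<epsilon>\<^sup>2" by simp
  have "(\<integral>w. \<bar>?G w * Y w\<bar> \<partial>gauss_seq) \<le> (\<integral>w. \<epsilon> / 2 * (?G w)\<^sup>2 + 1 / (2 * \<epsilon>) * (Y w)\<^sup>2 \<partial>gauss_seq)"
  proof (intro integral_mono temperate_integrable)
    fix w
    have "2 * \<epsilon> * \<bar>?G w * Y w\<bar> \<le> (\<epsilon> * ?G w)\<^sup>2 + (Y w)\<^sup>2"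
      using sum_squares_bound[of "\<bar>\<epsilon> * ?G w\<bar>" "\<bar>Y w\<bar>"] \<epsilon>(1) by (simp add: abs_mult mult_ac power_mult_distrib)
    then show "\<bar>?G w * Y w\<bar> \<le> \<epsilon> / 2 * (?G w)\<^sup>2 + 1 / (2 * \<epsilon>) * (Y w)\<^sup>2"
      using \<epsilon>(1) by (simp add: field_simps power2_eq_square)
  qed auto
  also have "\<dots> = \<epsilon> / 2 * (\<integral>w. (?G w)\<^sup>2 \<partial>gauss_seq) + 1 / (2 * \<epsilon>) * (\<integral>w. (Y w)\<^sup>2 \<partial>gauss_seq)"
    by (subst Bochner_Integration.integral_add) (auto intro!: temperate_integrable)
  also have "\<dots> \<le> \<epsilon> / 2 + 1 / (2 * \<epsilon>) * \<epsilon>\<^sup>2"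
    unfolding EG using EY \<epsilon>(1) by (intro add_mono mult_left_mono) auto
  also have "\<dots> = \<epsilon>" using \<epsilon>(1) by (simp add: power2_eq_square)
  finally show ?thesis unfolding Y .
qed

text \<open>\<open>K\<close> is a Cholesky factor of the covariance matrix of the tail. It is fixed
  before \<open>t\<close>, \<open>N\<close> and \<open>\<delta>\<close>, because later the same
  Gaussian vector has to serve every \<open>t\<close> and stay unchanged while \<open>N\<close>
  tends to infinity. The bound on its entries is what makes these factors relatively
  compact.\<close>

lemma chaos_tail_gaussian:
  fixes l :: "'k::finite \<Rightarrow> nat \<Rightarrow> real"
  assumes L: "orthonormal_rows L" and l2: "\<And>i. (\<Sum>j\<in>{M..<J}. (l i j)\<^sup>2) \<le> C"
  obtains K :: "'k \<Rightarrow> nat \<Rightarrow> real" where "lower K" "\<And>i b. (K i b)\<^sup>2 \<le> 2 * C"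
    "\<And>t N \<delta>. N \<le> M \<Longrightarrow> \<delta> > 0 \<Longrightarrow> (\<And>i j. M \<le> j \<Longrightarrow> \<bar>l i j\<bar> \<le> \<delta>) \<Longrightarrow>
      norm ((\<integral>w. iexp (\<Sum>i\<in>UNIV. t i * chaos l L ({..<N} \<union> {M..<J}) i w) \<partial>gauss_seq) -
       exp (- (\<Sum>b<kdim TYPE('k). (\<Sum>i\<in>UNIV. t i * K i b)\<^sup>2) / 2) *\<^sub>R
       (\<integral>w. iexp (\<Sum>i\<in>UNIV. t i * chaos l L {..<N} i w) \<partial>gauss_seq))
      \<le> 2 * \<delta> * sqrt ((\<Sum>i\<in>UNIV. (t i)\<^sup>2) * real CARD('k) + 1) *
        ((\<Sum>i\<in>UNIV. \<Sum>j<N. \<bar>t i * l i j\<bar>) + sqrt (2 * (\<Sum>i\<in>UNIV. (t i)\<^sup>2) * real CARD('k) * C))"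
proof -
  have low: "lower L" using L by (simp add: orthonormal_rows_def)
  define m where "m = Suc (Max (to_nat ` ((UNIV :: 'k set) \<times> {..<max J M})))"
  have m: "to_nat (i::'k, j) < m" if "j < max J M" for i j
    using that unfolding m_def less_Suc_eq_le by (intro Max_ge) auto
  let ?T = "{M..<J}"
  let ?R = "chaos_mat l L ?T"
  have mT: "to_nat (i, j) < m" if "j \<in> ?T" for i :: 'k and j using that m by auto
  have sqT: "(\<Sum>p<m. \<Sum>r<m. (?R i p r)\<^sup>2) = (\<Sum>j\<in>?T. (l i j)\<^sup>2)" for i
    by (rule chaos_mat_square[OF L _ mT]) auto
  define V where "V i i' = 2 * (\<Sum>p<m. \<Sum>r<m. ?R i p r * ?R i' p r)" for i i'
  \<comment> \<open>The factor 2 in the covariance of the second chaos is moved into the matrices,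
    so that \<open>V\<close> appears as a kernel of inner products.\<close>
  have "psd (\<lambda>i i'. \<Sum>p<m. \<Sum>r<m. (sqrt 2 * ?R i p r) * (sqrt 2 * ?R i' p r))"
    by (rule psd_inner)
  also have "(\<lambda>i i'. \<Sum>p<m. \<Sum>r<m. (sqrt 2 * ?R i p r) * (sqrt 2 * ?R i' p r)) = V"
  proof (intro ext)
    have "(sqrt 2 * a) * (sqrt 2 * b) = 2 * (a * b)" for a b :: real
      by (metis mult.assoc mult.left_commute real_sqrt_mult_self abs_numeral)
    then show "(\<Sum>p<m. \<Sum>r<m. (sqrt 2 * ?R i p r) * (sqrt 2 * ?R i' p r)) = V i i'" for i i'
      by (simp only: V_def sum_distrib_left)
  qed
  finally have "psd V" .
  from psd_factorization[OF this] obtain K :: "'k \<Rightarrow> nat \<Rightarrow> real" where K: "\<And>i s. to_nat i < s \<Longrightarrow> K i s = 0"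
     "\<And>i j. V i j = (\<Sum>s\<le>to_nat i. K i s * K j s)" by blast
  have lowK: "lower K" using K(1) by (simp add: lower_def)
  have VK: "V i j = (\<Sum>b<kdim TYPE('k). K i b * K j b)" for i j
    unfolding K(2) by (rule lower_inner_eq[OF lowK to_nat_less_kdim])
  have Vdiag: "V i i = 2 * (\<Sum>j\<in>?T. (l i j)\<^sup>2)" for i
    using sqT[of i] by (simp add: V_def power2_eq_square)
  have Kb: "(K i b)\<^sup>2 \<le> 2 * C" for i b
  proof (cases "b \<le> to_nat i")
    case True
    have "(K i b)\<^sup>2 \<le> (\<Sum>s\<le>to_nat i. (K i s)\<^sup>2)"
      using True by (intro member_le_sum) auto
    also have "\<dots> = V i i" unfolding K(2) by (simp add: power2_eq_square)
    also have "\<dots> \<le> 2 * C" unfolding Vdiag using l2[of i] by simp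
    finally show ?thesis .
  next
    case False
    have "0 \<le> (\<Sum>j\<in>?T. (l i j)\<^sup>2)" by (intro sum_nonneg) auto
    then have "0 \<le> C" using l2[of i] by linarith
    then show ?thesis using K(1) False by simp
  qed
  show ?thesis
  proof (rule that[OF lowK Kb])
    fix t :: "'k \<Rightarrow> real" and N :: nat and \<delta> :: real
    assume NM: "N \<le> M" and \<delta>: "\<delta> > 0" and l\<delta>: "\<And>i j. M \<le> j \<Longrightarrow> \<bar>l i j\<bar> \<le> \<delta>"
    define TT where "TT = (\<Sum>i\<in>UNIV. (t i)\<^sup>2)"
    have TT: "TT \<ge> 0" unfolding TT_def by (intro sum_nonneg) auto
    define A where "A p r = (\<Sum>i\<in>UNIV. t i * ?R i p r)" for p r
    define B where "B p r = (\<Sum>i\<in>UNIV. t i * chaos_mat l L {..<N} i p r)" for p r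
    \<comment> \<open>Cauchy-Schwarz in the coordinates bounds the operator norm of \<open>A\<close>
      by \<open>\<delta> * sqrt (TT * CARD('k))\<close>; the added 1 keeps \<open>\<epsilon>\<close>
      positive when \<open>t\<close> vanishes.\<close>
    define \<epsilon> where "\<epsilon> = \<delta> * sqrt (TT * real CARD('k) + 1)"
    have \<epsilon>: "\<epsilon> > 0" using \<delta> TT by (auto simp: \<epsilon>_def intro!: mult_pos_pos add_nonneg_pos)
    have mN: "to_nat (i, j) < m" if "j \<in> {..<N}" for i :: 'k and j using that m NM by auto
    have symA: "A p r = A r p" and symB: "B p r = B r p" for p r
      by (simp_all add: A_def B_def chaos_mat_sym[of l L _ _ p r])
    have qA: "(\<Sum>i\<in>UNIV. t i * chaos l L ?T i w) = qf m A w" for w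
      unfolding A_def qf_sum by (intro sum.cong refl arg_cong2[where f = "(*)"] chaos_eq_qf[OF L] mT)
    have qB: "(\<Sum>i\<in>UNIV. t i * chaos l L {..<N} i w) = qf m B w" for w
      unfolding B_def qf_sum by (intro sum.cong refl arg_cong2[where f = "(*)"] chaos_eq_qf[OF L] mN)
    have split: "(\<Sum>i\<in>UNIV. t i * chaos l L ({..<N} \<union> ?T) i w) = qf m B w + qf m A w" for w
    proof -
      have "chaos l L ({..<N} \<union> ?T) i w = chaos l L {..<N} i w + chaos l L ?T i w" for i
        unfolding chaos_def using NM by (subst sum.union_disjoint) auto
      then show ?thesis by (simp add: distrib_left sum.distrib qA[symmetric] qB[symmetric])
    qed
    define \<tau> where "\<tau> = (\<Sum>p<m. \<Sum>r<m. (A p r)\<^sup>2)"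
    have tauV: "\<tau> = (\<Sum>i\<in>UNIV. \<Sum>i'\<in>UNIV. t i * t i' * (\<Sum>p<m. \<Sum>r<m. ?R i p r * ?R i' p r))"
      unfolding \<tau>_def A_def by (rule sum_sum_lincomb_square)
    \<comment> \<open>\<open>2 * \<tau>\<close> is the variance of the tail combination, so
      \<open>exp (- \<tau>)\<close> is the characteristic function of the Gaussian vector with
      factor \<open>K\<close>.\<close>
    have tauK: "\<tau> = (\<Sum>b<kdim TYPE('k). (\<Sum>i\<in>UNIV. t i * K i b)\<^sup>2) / 2"
    proof -
      have "2 * \<tau> = (\<Sum>i\<in>UNIV. \<Sum>i'\<in>UNIV. t i * t i' * V i i')"
        unfolding tauV V_def by (simp add: sum_distrib_left mult_ac)
      also have "\<dots> = (\<Sum>b<kdim TYPE('k). (\<Sum>i\<in>UNIV. t i * K i b)\<^sup>2)"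
        unfolding VK sum_lincomb_square ..
      finally show ?thesis by simp
    qed
    have op: "(\<Sum>p<m. (lin m A p x)\<^sup>2) \<le> \<epsilon>\<^sup>2 * (\<Sum>p<m. (x p)\<^sup>2)" for x
    proof -
      have x2: "0 \<le> (\<Sum>p<m. (x p)\<^sup>2)" by (intro sum_nonneg) auto
      have "(\<Sum>p<m. (lin m A p x)\<^sup>2) \<le> (\<Sum>p<m. TT * (\<Sum>i\<in>UNIV. (lin m (?R i) p x)\<^sup>2))"
        unfolding A_def lin_sum TT_def by (intro sum_mono sum_mult_square_le)
      also have "\<dots> = TT * (\<Sum>i\<in>UNIV. \<Sum>p<m. (lin m (?R i) p x)\<^sup>2)"
        by (subst sum.swap) (simp add: sum_distrib_left)
      also have "\<dots> \<le> TT * (\<Sum>i\<in>(UNIV::'k set). \<delta>\<^sup>2 * (\<Sum>p<m. (x p)\<^sup>2))"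
        using TT by (intro mult_left_mono sum_mono chaos_mat_op_bound[OF L _ mT] l\<delta>) auto
      also have "\<dots> = (\<delta>\<^sup>2 * (TT * real CARD('k))) * (\<Sum>p<m. (x p)\<^sup>2)" by simp
      also have "\<dots> \<le> \<epsilon>\<^sup>2 * (\<Sum>p<m. (x p)\<^sup>2)"
        using TT x2 by (intro mult_right_mono) (auto simp: \<epsilon>_def power_mult_distrib intro!: mult_left_mono)
      finally show ?thesis .
    qed
    have tau_le: "\<tau> \<le> TT * (real CARD('k) * C)"
    proof -
      have "\<tau> \<le> (\<Sum>p<m. \<Sum>r<m. TT * (\<Sum>i\<in>UNIV. (?R i p r)\<^sup>2))"
        unfolding \<tau>_def A_def TT_def by (intro sum_mono sum_mult_square_le)
      also have "\<dots> = TT * (\<Sum>p<m. \<Sum>r<m. \<Sum>i\<in>UNIV. (?R i p r)\<^sup>2)" by (simp add: sum_distrib_left)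
      also have "(\<Sum>p<m. \<Sum>r<m. \<Sum>i\<in>UNIV. (?R i p r)\<^sup>2) = (\<Sum>p<m. \<Sum>i\<in>UNIV. \<Sum>r<m. (?R i p r)\<^sup>2)"
        by (intro sum.cong[OF refl], subst sum.swap, rule refl)
      also have "\<dots> = (\<Sum>i\<in>UNIV. \<Sum>p<m. \<Sum>r<m. (?R i p r)\<^sup>2)" by (rule sum.swap)
      also have "TT * (\<Sum>i\<in>UNIV. \<Sum>p<m. \<Sum>r<m. (?R i p r)\<^sup>2) \<le> TT * (\<Sum>i\<in>(UNIV::'k set). C)"
        using TT l2 by (intro mult_left_mono sum_mono) (auto simp: sqT)
      finally show ?thesis by simp
    qed
    have "(\<integral>w. \<bar>\<Sum>p<m. lin m A p w * lin m B p w\<bar> \<partial>gauss_seq) \<le> \<epsilon> * (\<Sum>i\<in>UNIV. \<Sum>j<N. \<bar>t i * l i j\<bar>)"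
    proof -
      \<comment> \<open>The interaction of the gradients is expanded over the finitely many head
        variables. Each term pairs one of them with the image of its unit row under the tail matrix,
        and has mean absolute value at most \<open>\<epsilon>\<close> times the modulus of its
        coefficient.\<close>
      define H where "H i j w = gvec L (i, j) w * (\<Sum>p<m. L (i, j) p * lin m A p w)" for i j w
      have tH [intro!]: "temperate (H i j)" for i j unfolding H_def[abs_def] by auto
      have lB: "lin m B p w = (\<Sum>i\<in>UNIV. \<Sum>j<N. (t i * l i j) * (L (i, j) p * gvec L (i, j) w))" for p w
      proof -
        have "lin m (chaos_mat l L {..<N} i) p w = (\<Sum>j<N. l i j * (L (i, j) p * gvec L (i, j) w))" for i
        proof -
          have "lin m (chaos_mat l L {..<N} i) p w = (\<Sum>j<N. \<Sum>r<m. l i j * L (i, j) p * (L (i, j) r * w r))"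
            unfolding lin_def chaos_mat_def sum_distrib_left sum_distrib_right by (subst sum.swap) (simp add: mult_ac)
          also have "\<dots> = (\<Sum>j<N. l i j * (L (i, j) p * gvec L (i, j) w))"
            by (intro sum.cong refl) (simp add: gvec_eq_lin[OF low mN] sum_distrib_left mult_ac)
          finally show ?thesis .
        qed
        then show ?thesis unfolding B_def lin_sum by (simp add: sum_distrib_left mult_ac)
      qed
      have "(\<Sum>p<m. lin m A p w * lin m B p w) = (\<Sum>i\<in>UNIV. \<Sum>j<N. (t i * l i j) * H i j w)" for w
      proof -
        have "(\<Sum>p<m. lin m A p w * lin m B p w) =
          (\<Sum>p<m. \<Sum>i\<in>UNIV. \<Sum>j<N. (t i * l i j) * (gvec L (i, j) w * (L (i, j) p * lin m A p w)))"
          unfolding lB by (simp add: sum_distrib_left mult_ac)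
        also have "\<dots> = (\<Sum>i\<in>UNIV. \<Sum>p<m. \<Sum>j<N. (t i * l i j) * (gvec L (i, j) w * (L (i, j) p * lin m A p w)))"
          by (rule sum.swap)
        also have "\<dots> = (\<Sum>i\<in>UNIV. \<Sum>j<N. \<Sum>p<m. (t i * l i j) * (gvec L (i, j) w * (L (i, j) p * lin m A p w)))"
          by (intro sum.cong[OF refl], subst sum.swap, rule refl)
        finally show ?thesis by (simp add: H_def sum_distrib_left)
      qed
      then have "(\<integral>w. \<bar>\<Sum>p<m. lin m A p w * lin m B p w\<bar> \<partial>gauss_seq) = (\<integral>w. \<bar>\<Sum>i\<in>UNIV. \<Sum>j<N. (t i * l i j) * H i j w\<bar> \<partial>gauss_seq)"
        by simp
      also have "\<dots> \<le> (\<integral>w. (\<Sum>i\<in>UNIV. \<Sum>j<N. \<bar>t i * l i j\<bar> * \<bar>H i j w\<bar>) \<partial>gauss_seq)"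
      proof (intro integral_mono temperate_integrable)
        fix w
        have "\<bar>\<Sum>i\<in>UNIV. \<Sum>j<N. (t i * l i j) * H i j w\<bar> \<le> (\<Sum>i\<in>UNIV. \<bar>\<Sum>j<N. (t i * l i j) * H i j w\<bar>)"
          by (rule sum_abs)
        also have "\<dots> \<le> (\<Sum>i\<in>UNIV. \<Sum>j<N. \<bar>(t i * l i j) * H i j w\<bar>)"
          by (intro sum_mono sum_abs)
        finally show "\<bar>\<Sum>i\<in>UNIV. \<Sum>j<N. (t i * l i j) * H i j w\<bar> \<le> (\<Sum>i\<in>UNIV. \<Sum>j<N. \<bar>t i * l i j\<bar> * \<bar>H i j w\<bar>)"
          by (simp only: abs_mult)
      qed (auto simp del: abs_mult)
      also have "\<dots> = (\<Sum>i\<in>UNIV. \<Sum>j<N. \<bar>t i * l i j\<bar> * (\<integral>w. \<bar>H i j w\<bar> \<partial>gauss_seq))"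
      proof -
        have i: "integrable gauss_seq (\<lambda>w. \<bar>t i * l i j\<bar> * \<bar>H i j w\<bar>)" for i j
          by (intro integrable_mult_right temperate_integrable temperate_abs tH)
        show ?thesis
          by (subst Bochner_Integration.integral_sum, (intro Bochner_Integration.integrable_sum i),
              subst Bochner_Integration.integral_sum, rule i, simp only: integral_mult_right_zero)
      qed
      also have "\<dots> \<le> (\<Sum>i\<in>UNIV. \<Sum>j<N. \<bar>t i * l i j\<bar> * \<epsilon>)"
      proof (intro sum_mono mult_left_mono)
        fix i :: 'k and j assume j: "j \<in> {..<N}"
        show "(\<integral>w. \<bar>H i j w\<bar> \<partial>gauss_seq) \<le> \<epsilon>"
          unfolding H_def by (rule expectation_abs_gvec_mult_le[OF symA \<epsilon> op low mN[OF j]])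
            (simp add: orthonormal_rowsD[OF L mN[OF j]])
      qed simp
      finally show ?thesis by (simp add: sum_distrib_left mult_ac)
    qed
    from iexp_qf_perturbation[OF symA symB less_imp_le[OF \<epsilon>] op this]
    have "norm ((\<integral>w. iexp (qf m B w + qf m A w) \<partial>gauss_seq) - exp (- \<tau>) *\<^sub>R (\<integral>w. iexp (qf m B w) \<partial>gauss_seq))
      \<le> 2 * (\<epsilon> * (\<Sum>i\<in>UNIV. \<Sum>j<N. \<bar>t i * l i j\<bar>)) + 2 * sqrt 2 * \<epsilon> * sqrt \<tau>"
      unfolding \<tau>_def by simp
    also have "\<dots> \<le> 2 * (\<epsilon> * (\<Sum>i\<in>UNIV. \<Sum>j<N. \<bar>t i * l i j\<bar>)) + 2 * sqrt 2 * \<epsilon> * sqrt (TT * (real CARD('k) * C))"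
      using tau_le \<epsilon> by (intro add_left_mono mult_left_mono real_sqrt_le_mono) auto
    also have "\<dots> = 2 * \<delta> * sqrt (TT * real CARD('k) + 1) * ((\<Sum>i\<in>UNIV. \<Sum>j<N. \<bar>t i * l i j\<bar>) + sqrt (2 * TT * real CARD('k) * C))"
      by (simp add: \<epsilon>_def real_sqrt_mult algebra_simps)
    finally show "norm ((\<integral>w. iexp (\<Sum>i\<in>UNIV. t i * chaos l L ({..<N} \<union> ?T) i w) \<partial>gauss_seq) -
       exp (- (\<Sum>b<kdim TYPE('k). (\<Sum>i\<in>UNIV. t i * K i b)\<^sup>2) / 2) *\<^sub>R
       (\<integral>w. iexp (\<Sum>i\<in>UNIV. t i * chaos l L {..<N} i w) \<partial>gauss_seq))
      \<le> 2 * \<delta> * sqrt ((\<Sum>i\<in>UNIV. (t i)\<^sup>2) * real CARD('k) + 1) *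
        ((\<Sum>i\<in>UNIV. \<Sum>j<N. \<bar>t i * l i j\<bar>) + sqrt (2 * (\<Sum>i\<in>UNIV. (t i)\<^sup>2) * real CARD('k) * C))"
      unfolding split qB tauK TT_def by simp
  qed
qed

section \<open>Passage to the limit\<close>

lemma cos_lipschitz: "\<bar>cos x - cos y\<bar> \<le> \<bar>x - y :: real\<bar>"
  using abs_Re_le_cmod[of "iexp x - iexp y"] norm_iexp_diff[of x y] by (simp add: Re_exp)

lemma sin_lipschitz: "\<bar>sin x - sin y\<bar> \<le> \<bar>x - y :: real\<bar>"
  using abs_Im_le_cmod[of "iexp x - iexp y"] norm_iexp_diff[of x y] by (simp add: Im_exp)

lemma (in prob_space) iexp_expectation_split:
  assumes [measurable]: "X \<in> borel_measurable M"
  shows "(\<integral>x. iexp (X x) \<partial>M) = of_real (\<integral>x. cos (X x) \<partial>M) + \<i> * of_real (\<integral>x. sin (X x) \<partial>M)"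
proof -
  have "integrable M (\<lambda>x. cos (X x))" "integrable M (\<lambda>x. sin (X x))"
    by (auto intro!: integrable_const_bound[of _ 1])
  then show ?thesis unfolding iexp_cos_sin by (subst Bochner_Integration.integral_add) auto
qed

text \<open>Bolzano-Weierstrass for each index in the enumeration \<open>from_nat\<close>, then a
  diagonal choice. Allowing any countable index type lets several arrays be treated as a single
  family.\<close>

lemma convergent_diagonal_subsequence:
  fixes X :: "nat \<Rightarrow> 'i::countable \<Rightarrow> real"
  assumes "\<And>i. \<exists>B. \<forall>n. \<bar>X n i\<bar> \<le> B"
  shows "\<exists>r x. strict_mono (r :: nat \<Rightarrow> nat) \<and> (\<forall>i. (\<lambda>n. X (r n) i) \<longlonglongrightarrow> x i)"
proof -
  interpret subseqs "\<lambda>k s. convergent (\<lambda>n. X (s n) (from_nat k))"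
  proof
    fix k and s :: "nat \<Rightarrow> nat"
    obtain B where "\<forall>n. \<bar>X n (from_nat k)\<bar> \<le> B" using assms by blast
    then have "bounded (range (\<lambda>n. X (s n) (from_nat k)))" by (auto simp: bounded_iff)
    then obtain l r where "strict_mono r" "((\<lambda>n. X (s n) (from_nat k)) \<circ> r) \<longlonglongrightarrow> l"
      using bounded_imp_convergent_subsequence by blast
    then show "\<exists>r'. strict_mono r' \<and> convergent (\<lambda>n. X ((s \<circ> r') n) (from_nat k))"
      by (auto simp: convergent_def comp_def)
  qed
  have "convergent (\<lambda>n. X (diagseq n) i)" for i
  proof -
    have "convergent (\<lambda>n. X ((diagseq \<circ> ((+) (Suc (to_nat i)))) n) (from_nat (to_nat i)))"
    proof (rule diagseq_holds)
      fix r s :: "nat \<Rightarrow> nat" and k assume "strict_mono r" "convergent (\<lambda>n. X (s n) (from_nat k))"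
      then show "convergent (\<lambda>n. X ((s \<circ> r) n) (from_nat k))"
        using convergent_subseq_convergent[of "\<lambda>n. X (s n) (from_nat k)" r] by (simp add: comp_def)
    qed
    then have "convergent (\<lambda>n. X (diagseq (n + Suc (to_nat i))) i)" by (simp add: comp_def add.commute)
    then show ?thesis by (rule convergent_ignore_initial_segment[THEN iffD1])
  qed
  then show ?thesis
    using subseq_diagseq
    by (intro exI[of _ diagseq] exI[of _ "\<lambda>i. lim (\<lambda>n. X (diagseq n) i)"]) (simp add: convergent_LIMSEQ_iff)
qed

section \<open>Boundedness of the variances\<close>

lemma abs_min_square_le_1:
  fixes x :: real
  assumes "K > 0"
  shows "\<bar>(min (\<bar>x\<bar> / K) 1)\<^sup>2\<bar> \<le> 1"
proof -
  have "0 \<le> min (\<bar>x\<bar> / K) 1" using assms by simp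
  then have "(min (\<bar>x\<bar> / K) 1)\<^sup>2 \<le> 1" by (intro power_le_one) auto
  then show ?thesis by simp
qed

text \<open>Paley-Zygmund for a continuous functional in place of a probability, so that convergence
  in law can be applied to it. With \<open>v\<close> the variance and
  \<open>z = F^2 / (27 * v)\<close>, the parabola \<open>2 * z - z^2\<close> is at most 1 and at
  most \<open>F^2 / K^2\<close>, hence below the truncated square. By the fourth moment bound its
  mean is at least \<open>2 / 27 - 27 / 27^2 = 1 / 27\<close>; the scale 27 is the one that
  maximises this value.\<close>

lemma chaos_small_ball:
  assumes L: "orthonormal_rows L" and S: "finite S" and K: "0 < K" "K\<^sup>2 \<le> 2 * (\<Sum>j\<in>S. (l i j)\<^sup>2)"
  shows "1 / 27 \<le> (\<integral>w. (min (\<bar>chaos l L S i w\<bar> / K) 1)\<^sup>2 \<partial>gauss_seq)"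
proof -
  let ?F = "chaos l L S i"
  define v where "v = (\<integral>w. (?F w)\<^sup>2 \<partial>gauss_seq)"
  have Kv: "K\<^sup>2 \<le> v" unfolding v_def using K chaos_second_moment[OF L S] by simp
  then have v: "v > 0" using K by (meson less_le_trans zero_less_power)
  have pw: "2 / (27 * v) * (?F w)\<^sup>2 - 1 / (27 * v)\<^sup>2 * (?F w) ^ 4 \<le> (min (\<bar>?F w\<bar> / K) 1)\<^sup>2" for w
  proof -
    define z where "z = (?F w)\<^sup>2 / (27 * v)"
    have z0: "z \<ge> 0" using v by (simp add: z_def)
    have eq: "2 / (27 * v) * (?F w)\<^sup>2 - 1 / (27 * v)\<^sup>2 * (?F w) ^ 4 = 2 * z - z\<^sup>2"
      by (simp add: z_def power_divide field_simps flip: power_mult)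
    show ?thesis
    proof (cases "\<bar>?F w\<bar> / K \<le> 1")
      case True
      have "2 * z - z\<^sup>2 \<le> 2 * z" by simp
      also have "\<dots> \<le> (?F w)\<^sup>2 / v" using v by (simp add: z_def field_simps)
      also have "\<dots> \<le> (?F w)\<^sup>2 / K\<^sup>2" using Kv K by (intro divide_left_mono) (auto intro!: mult_pos_pos v)
      also have "\<dots> = (min (\<bar>?F w\<bar> / K) 1)\<^sup>2" using True by (simp add: power_divide)
      finally show ?thesis unfolding eq .
    next
      case False
      have "2 * z - z\<^sup>2 \<le> 1" using zero_le_power2[of "z - 1"] by (simp add: power2_diff)
      then show ?thesis unfolding eq using False by (simp add: min_def)
    qed
  qed
  have "1 / 27 = 2 / (27 * v) * v - 1 / (27 * v)\<^sup>2 * (27 * v\<^sup>2)"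
    using v by (simp add: field_simps power2_eq_square)
  also have "\<dots> \<le> 2 / (27 * v) * (\<integral>w. (?F w)\<^sup>2 \<partial>gauss_seq) - 1 / (27 * v)\<^sup>2 * (\<integral>w. ?F w ^ 4 \<partial>gauss_seq)"
    using chaos_fourth_moment[OF L S, of l i] v unfolding v_def[symmetric] by (intro diff_mono mult_left_mono) auto
  also have "\<dots> = (\<integral>w. 2 / (27 * v) * (?F w)\<^sup>2 - 1 / (27 * v)\<^sup>2 * ?F w ^ 4 \<partial>gauss_seq)"
    by (subst Bochner_Integration.integral_diff) (auto intro!: temperate_integrable)
  also have "\<dots> \<le> (\<integral>w. (min (\<bar>?F w\<bar> / K) 1)\<^sup>2 \<partial>gauss_seq)"
  proof (intro integral_mono pw)
    have m: "?F \<in> borel_measurable gauss_seq" by (rule temperate_measurable) auto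
    have "\<bar>(min (\<bar>?F w\<bar> / K) 1)\<^sup>2\<bar> \<le> 1" for w
      by (rule abs_min_square_le_1[OF K(1)])
    then show "integrable gauss_seq (\<lambda>w. (min (\<bar>?F w\<bar> / K) 1)\<^sup>2)"
      using m by (intro gauss_seq.integrable_const_bound[of _ 1]) auto
  qed (intro temperate_integrable; auto)
  finally show ?thesis .
qed

text \<open>With \<open>K \<ge> 1\<close> the Lipschitz constant does not depend on
  \<open>K\<close>: the truncation contributes 1, squaring numbers in \<open>[0, 1]\<close> the
  factor 2.\<close>

lemma min_square_lipschitz:
  fixes x y :: real
  assumes "K \<ge> 1"
  shows "\<bar>(min (\<bar>x\<bar> / K) 1)\<^sup>2 - (min (\<bar>y\<bar> / K) 1)\<^sup>2\<bar> \<le> 2 * \<bar>x - y\<bar>"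
proof -
  define a b where "a = min (\<bar>x\<bar> / K) 1" and "b = min (\<bar>y\<bar> / K) 1"
  have ab: "0 \<le> a" "a \<le> 1" "0 \<le> b" "b \<le> 1" using assms by (auto simp: a_def b_def)
  have "\<bar>a - b\<bar> \<le> \<bar>\<bar>x\<bar> / K - \<bar>y\<bar> / K\<bar>" unfolding a_def b_def by linarith
  also have "\<dots> = \<bar>\<bar>x\<bar> - \<bar>y\<bar>\<bar> / K" using assms by (simp add: abs_divide flip: diff_divide_distrib)
  also have "\<dots> \<le> \<bar>x - y\<bar> / 1" using assms by (intro frac_le) auto
  finally have 1: "\<bar>a - b\<bar> \<le> \<bar>x - y\<bar>" by simp
  have "\<bar>a\<^sup>2 - b\<^sup>2\<bar> = \<bar>a + b\<bar> * \<bar>a - b\<bar>" by (simp add: power2_eq_square algebra_simps flip: abs_mult)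
  also have "\<dots> \<le> 2 * \<bar>x - y\<bar>" using ab 1 by (intro mult_mono) auto
  finally show ?thesis by (simp add: a_def b_def)
qed

text \<open>The situation after the reduction to finite sorted sums on one space. Convergence is
  stated for bounded Lipschitz functions because the comparison with the original vectors is
  available for these.\<close>

locale chaos_sequence =
  fixes l :: "nat \<Rightarrow> 'k::finite \<Rightarrow> nat \<Rightarrow> real" and L :: "nat \<Rightarrow> 'k \<times> nat \<Rightarrow> nat \<Rightarrow> real" and J :: "nat \<Rightarrow> nat"
    and \<mu> :: "(real ^ 'k) measure"
  assumes ortho: "\<And>n. orthonormal_rows (L n)"
    and supp: "\<And>n i j. J n \<le> j \<Longrightarrow> l n i j = 0"
    and dec: "\<And>n i a b. a \<le> b \<Longrightarrow> \<bar>l n i b\<bar> \<le> \<bar>l n i a\<bar>"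
    and prob: "prob_space \<mu>" and sets_mu: "sets \<mu> = sets borel"
    and conv: "\<And>(f :: real ^ 'k \<Rightarrow> real) B c. continuous_on UNIV f \<Longrightarrow> (\<And>x. \<bar>f x\<bar> \<le> B) \<Longrightarrow> c \<ge> 0 \<Longrightarrow>
      (\<And>x y. \<bar>f x - f y\<bar> \<le> c * (\<Sum>i\<in>UNIV. \<bar>x $ i - y $ i\<bar>)) \<Longrightarrow>
      (\<lambda>n. \<integral>w. f (\<chi> i. chaos (l n) (L n) {..<J n} i w) \<partial>gauss_seq) \<longlonglongrightarrow> (\<integral>x. f x \<partial>\<mu>)"
begin

sublocale mu: prob_space \<mu> by (rule prob)

declare sets_mu [measurable_cong]

text \<open>If the variances were unbounded, \<open>chaos_small_ball\<close> would apply infinitely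
  often at every scale \<open>K\<close>. In the limit the truncated second moment at scale
  \<open>K\<close> would be at least \<open>1 / 27\<close> under \<open>\<mu>\<close> for all
  \<open>K\<close>, whereas dominated convergence makes it tend to zero as \<open>K\<close>
  grows.\<close>

lemma variance_bounded_component: "\<exists>C. \<forall>n. (\<Sum>j<J n. (l n i j)\<^sup>2) \<le> C"
proof (rule ccontr)
  assume unb: "\<not> ?thesis"
  define v where "v n = (\<Sum>j<J n. (l n i j)\<^sup>2)" for n
  have freq: "\<exists>n\<ge>n0. C < v n" for n0 C
  proof (rule ccontr)
    assume "\<not> ?thesis"
    then have le: "v n \<le> C" if "n \<ge> n0" for n using that by force
    have "v n \<le> max C (Max (v ` {..n0}))" for n
      using le[of n] by (cases "n \<ge> n0") (auto simp: le_max_iff_disj)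
    with unb show False unfolding v_def by blast
  qed
  have lower_bd: "1 / 27 \<le> (\<integral>x. (min (\<bar>x $ i\<bar> / K) 1)\<^sup>2 \<partial>\<mu>)" if K: "K \<ge> 1" for K
  proof (rule ccontr)
    let ?f = "\<lambda>x :: real ^ 'k. (min (\<bar>x $ i\<bar> / K) 1)\<^sup>2"
    assume neg: "\<not> ?thesis"
    have lim: "(\<lambda>n. \<integral>w. ?f (\<chi> i. chaos (l n) (L n) {..<J n} i w) \<partial>gauss_seq) \<longlonglongrightarrow> (\<integral>x. ?f x \<partial>\<mu>)"
    proof (rule conv[where B = 1 and c = 2])
      show "continuous_on UNIV ?f" using K by (intro continuous_intros) auto
      show "\<bar>?f x\<bar> \<le> 1" for x
        using K by (intro abs_min_square_le_1) auto
      show "\<bar>?f x - ?f y\<bar> \<le> 2 * (\<Sum>i\<in>UNIV. \<bar>x $ i - y $ i\<bar>)" for x y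
      proof -
        have "\<bar>x $ i - y $ i\<bar> \<le> (\<Sum>i\<in>UNIV. \<bar>x $ i - y $ i\<bar>)"
          by (rule member_le_sum) auto
        then show ?thesis using min_square_lipschitz[OF K, of "x $ i" "y $ i"] by linarith
      qed
    qed simp
    have "\<forall>\<^sub>F n in sequentially. (\<integral>w. ?f (\<chi> i. chaos (l n) (L n) {..<J n} i w) \<partial>gauss_seq) < 1 / 27"
      using neg by (intro order_tendstoD(2)[OF lim]) auto
    then obtain n0 where n0: "\<And>n. n \<ge> n0 \<Longrightarrow> (\<integral>w. ?f (\<chi> i. chaos (l n) (L n) {..<J n} i w) \<partial>gauss_seq) < 1 / 27"
      by (auto simp: eventually_sequentially)
    obtain n where n: "n \<ge> n0" "K\<^sup>2 < v n" using freq by blast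
    have "K\<^sup>2 \<le> 2 * v n" using n(2) zero_le_power2[of K] by linarith
    then show False
      using chaos_small_ball[OF ortho, of "{..<J n}" K "l n" i n] n0[OF n(1)] K by (simp add: v_def)
  qed
  have "(\<lambda>m. \<integral>x. (min (\<bar>x $ i\<bar> / real (Suc m)) 1)\<^sup>2 \<partial>\<mu>) \<longlonglongrightarrow> (\<integral>x. 0 \<partial>\<mu>)"
  proof (rule integral_dominated_convergence[where w = "\<lambda>_. 1"])
    show "AE x in \<mu>. (\<lambda>m. (min (\<bar>x $ i\<bar> / real (Suc m)) 1)\<^sup>2) \<longlonglongrightarrow> 0"
    proof (intro AE_I2)
      fix x :: "real ^ 'k"
      have "(\<lambda>m. \<bar>x $ i\<bar> / real (Suc m)) \<longlonglongrightarrow> 0"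
        using LIMSEQ_Suc[OF lim_const_over_n] by (simp add: comp_def)
      then have "(\<lambda>m. (min (\<bar>x $ i\<bar> / real (Suc m)) 1)\<^sup>2) \<longlonglongrightarrow> (min 0 1)\<^sup>2"
        by (intro tendsto_intros)
      then show "(\<lambda>m. (min (\<bar>x $ i\<bar> / real (Suc m)) 1)\<^sup>2) \<longlonglongrightarrow> 0" by simp
    qed
    show "AE x in \<mu>. norm ((min (\<bar>x $ i\<bar> / real (Suc m)) 1)\<^sup>2) \<le> 1" for m
      using abs_min_square_le_1[of "real (Suc m)"] by (intro AE_I2) (simp del: of_nat_Suc)
  qed auto
  then have "1 / 27 \<le> (\<integral>x. 0 \<partial>\<mu> :: real)"
    by (rule LIMSEQ_le_const) (use lower_bd in auto)
  then show False by simp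
qed

lemma variance_bounded:
  obtains C where "C \<ge> 1" "\<And>n i S. finite S \<Longrightarrow> (\<Sum>j\<in>S. (l n i j)\<^sup>2) \<le> C"
proof -
  obtain c where c: "\<And>i n. (\<Sum>j<J n. (l n i j)\<^sup>2) \<le> c i" using variance_bounded_component by metis
  define C where "C = max 1 (Max (range c))"
  have C: "c i \<le> C" for i unfolding C_def by (auto simp: le_max_iff_disj)
  have "(\<Sum>j\<in>S. (l n i j)\<^sup>2) \<le> C" if "finite S" for n i S
  proof -
    have "(\<Sum>j\<in>S. (l n i j)\<^sup>2) = (\<Sum>j\<in>S \<inter> {..<J n}. (l n i j)\<^sup>2)"
      using that supp[of n] by (intro sum.mono_neutral_right) (auto simp: not_less)
    also have "\<dots> \<le> (\<Sum>j<J n. (l n i j)\<^sup>2)" by (intro sum_mono2) auto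
    finally show ?thesis by (rule order_trans[OF _ order_trans[OF c C]])
  qed
  then show ?thesis using that[of C] by (simp add: C_def)
qed

text \<open>Test functions are real, so cosine and sine of the linear form are treated separately;
  both have Lipschitz constant \<open>T\<close> with respect to the sum of coordinate
  distances.\<close>

lemma char_convergence:
  "(\<lambda>n. \<integral>w. iexp (\<Sum>i\<in>UNIV. t i * chaos (l n) (L n) {..<J n} i w) \<partial>gauss_seq) \<longlonglongrightarrow> (\<integral>x. iexp (\<Sum>i\<in>UNIV. t i * x $ i) \<partial>\<mu>)"
proof -
  define T where "T = (\<Sum>i\<in>UNIV. \<bar>t i\<bar>)"
  define s where "s x = (\<Sum>i\<in>UNIV. t i * x $ i)" for x :: "real ^ 'k"
  have T0: "T \<ge> 0" unfolding T_def by (intro sum_nonneg) auto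
  have sl: "\<bar>s x - s y\<bar> \<le> T * (\<Sum>i\<in>UNIV. \<bar>x $ i - y $ i\<bar>)" for x y
  proof -
    have "\<bar>s x - s y\<bar> = \<bar>\<Sum>i\<in>UNIV. t i * (x $ i - y $ i)\<bar>"
      by (simp add: s_def right_diff_distrib sum_subtractf)
    also have "\<dots> \<le> (\<Sum>i\<in>UNIV. \<bar>t i\<bar> * \<bar>x $ i - y $ i\<bar>)"
      by (rule order_trans[OF sum_abs]) (simp add: abs_mult)
    also have "\<dots> \<le> (\<Sum>i\<in>UNIV. T * \<bar>x $ i - y $ i\<bar>)"
      unfolding T_def by (intro sum_mono mult_right_mono member_le_sum) auto
    finally show ?thesis by (simp add: sum_distrib_left)
  qed
  have cs: "continuous_on UNIV s" unfolding s_def[abs_def] by (intro continuous_intros)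
  have [measurable]: "s \<in> borel_measurable borel" using cs by (rule borel_measurable_continuous_onI)
  have c: "(\<lambda>n. \<integral>w. cos (s (\<chi> i. chaos (l n) (L n) {..<J n} i w)) \<partial>gauss_seq) \<longlonglongrightarrow> (\<integral>x. cos (s x) \<partial>\<mu>)"
    by (rule conv[where B = 1 and c = T])
      (use T0 in \<open>auto intro!: continuous_intros cs order_trans[OF cos_lipschitz sl]\<close>)
  have d: "(\<lambda>n. \<integral>w. sin (s (\<chi> i. chaos (l n) (L n) {..<J n} i w)) \<partial>gauss_seq) \<longlonglongrightarrow> (\<integral>x. sin (s x) \<partial>\<mu>)"
    by (rule conv[where B = 1 and c = T])
      (use T0 in \<open>auto intro!: continuous_intros cs order_trans[OF sin_lipschitz sl]\<close>)
  have [measurable]: "(\<lambda>w. \<chi> i. chaos (l n) (L n) {..<J n} i w) \<in> borel_measurable gauss_seq" for n by measurable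
  have "(\<lambda>n. \<integral>w. iexp (s (\<chi> i. chaos (l n) (L n) {..<J n} i w)) \<partial>gauss_seq) \<longlonglongrightarrow> (\<integral>x. iexp (s x) \<partial>\<mu>)"
    by (subst gauss_seq.iexp_expectation_split, measurable, subst mu.iexp_expectation_split, measurable)
      (intro tendsto_intros c d)
  then show ?thesis by (simp add: s_def)
qed

text \<open>The infinite series is not formed yet: the conclusion speaks of truncations only, but
  with \<open>l'\<close>, \<open>L'\<close>, \<open>K'\<close> common to all \<open>t\<close>. Two
  extractions suffice. The first runs along \<open>n\<close> and treats the factors
  \<open>K n M\<close> for all \<open>M\<close> at once; the second runs along \<open>M\<close> and
  concerns only their limits, since the head does not depend on \<open>M\<close>.\<close>

lemma chaos_limit_char:
  obtains l' :: "'k \<Rightarrow> nat \<Rightarrow> real" and L' :: "'k \<times> nat \<Rightarrow> nat \<Rightarrow> real" and K' :: "'k \<Rightarrow> nat \<Rightarrow> real"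
  where "orthonormal_rows L'" "\<And>i. summable (\<lambda>j. (l' i j)\<^sup>2)" "lower K'"
    "\<And>t. (\<lambda>N. exp (- (\<Sum>b<kdim TYPE('k). (\<Sum>i\<in>UNIV. t i * K' i b)\<^sup>2) / 2) *\<^sub>R
        (\<integral>w. iexp (\<Sum>i\<in>UNIV. t i * chaos l' L' {..<N} i w) \<partial>gauss_seq)) \<longlonglongrightarrow> (\<integral>x. iexp (\<Sum>i\<in>UNIV. t i * x $ i) \<partial>\<mu>)"
proof -
  obtain C where C: "C \<ge> 1" "\<And>n i S. finite S \<Longrightarrow> (\<Sum>j\<in>S. (l n i j)\<^sup>2) \<le> C" by (rule variance_bounded) blast
  \<comment> \<open>If \<open>M \<le> j\<close>, the \<open>M + 1\<close> squares at positions
    \<open>0\<close> to \<open>M\<close> all dominate the one at \<open>j\<close>, and together they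
    are at most \<open>C\<close>.\<close>
  define \<delta> where "\<delta> M = sqrt (C / real (Suc M))" for M
  have \<delta>0: "\<delta> M > 0" for M using C(1) by (simp add: \<delta>_def)
  have l\<delta>: "\<bar>l n i j\<bar> \<le> \<delta> M" if "M \<le> j" for n i j M
  proof -
    have "real (Suc M) * (l n i j)\<^sup>2 = (\<Sum>a\<in>{..M}. (l n i j)\<^sup>2)" by simp
    also have "\<dots> \<le> (\<Sum>a\<in>{..M}. (l n i a)\<^sup>2)"
    proof (rule sum_mono)
      fix a assume "a \<in> {..M}"
      then have "\<bar>l n i j\<bar> \<le> \<bar>l n i a\<bar>" using that by (intro dec) auto
      then show "(l n i j)\<^sup>2 \<le> (l n i a)\<^sup>2" by (simp add: abs_le_square_iff)
    qed
    also have "\<dots> \<le> C" by (rule C(2)) simp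
    finally have "(l n i j)\<^sup>2 \<le> C / real (Suc M)" by (simp add: field_simps)
    then show ?thesis unfolding \<delta>_def by (rule real_le_rsqrt[of "\<bar>l n i j\<bar>", unfolded power2_abs])
  qed
  \<comment> \<open>The head coefficients are replaced by their uniform bound
    \<open>\<delta> 0\<close>, which makes the error independent of \<open>n\<close>; for fixed
    \<open>N\<close> it vanishes with \<open>\<delta> M\<close>.\<close>
  define E where "E t N M = 2 * \<delta> M * sqrt ((\<Sum>i\<in>UNIV. (t i)\<^sup>2) * real CARD('k) + 1) *
     ((\<Sum>i\<in>UNIV. \<Sum>j<N. \<bar>t i\<bar> * \<delta> 0) + sqrt (2 * (\<Sum>i\<in>UNIV. (t i)\<^sup>2) * real CARD('k) * C))" for t :: "'k \<Rightarrow> real" and N M :: nat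
  define \<phi> where "\<phi> n t = (\<integral>w. iexp (\<Sum>i\<in>UNIV. t i * chaos (l n) (L n) {..<J n} i w) \<partial>gauss_seq)" for n t
  define h where "h n N t = (\<integral>w. iexp (\<Sum>i\<in>UNIV. t i * chaos (l n) (L n) {..<N} i w) \<partial>gauss_seq)" for n N t
  define q where "q K t = exp (- (\<Sum>b<kdim TYPE('k). (\<Sum>i\<in>UNIV. t i * K i b)\<^sup>2) / 2)" for K :: "'k \<Rightarrow> nat \<Rightarrow> real" and t
  have "\<exists>K. lower K \<and> (\<forall>i b. (K i b)\<^sup>2 \<le> 2 * C) \<and> (\<forall>t N. N \<le> M \<longrightarrow>
     norm (\<phi> n t - q K t *\<^sub>R h n N t) \<le> sqrt (2 * (\<Sum>i\<in>UNIV. (t i)\<^sup>2) * (\<Sum>i\<in>UNIV. \<Sum>j\<in>{N..<M}. (l n i j)\<^sup>2)) + E t N M)" for n M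
  proof -
    obtain K :: "'k \<Rightarrow> nat \<Rightarrow> real" where K: "lower K" "\<And>i b. (K i b)\<^sup>2 \<le> 2 * C"
    "\<And>t N \<delta>. N \<le> M \<Longrightarrow> \<delta> > 0 \<Longrightarrow> (\<And>i j. M \<le> j \<Longrightarrow> \<bar>l n i j\<bar> \<le> \<delta>) \<Longrightarrow>
      norm ((\<integral>w. iexp (\<Sum>i\<in>UNIV. t i * chaos (l n) (L n) ({..<N} \<union> {M..<J n}) i w) \<partial>gauss_seq) -
       exp (- (\<Sum>b<kdim TYPE('k). (\<Sum>i\<in>UNIV. t i * K i b)\<^sup>2) / 2) *\<^sub>R
       (\<integral>w. iexp (\<Sum>i\<in>UNIV. t i * chaos (l n) (L n) {..<N} i w) \<partial>gauss_seq))
      \<le> 2 * \<delta> * sqrt ((\<Sum>i\<in>UNIV. (t i)\<^sup>2) * real CARD('k) + 1) *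
        ((\<Sum>i\<in>UNIV. \<Sum>j<N. \<bar>t i * l n i j\<bar>) + sqrt (2 * (\<Sum>i\<in>UNIV. (t i)\<^sup>2) * real CARD('k) * C))"
      by (rule chaos_tail_gaussian[OF ortho[of n], where M = M and J = "J n" and l = "l n" and C = C]) (use C(2) in auto)
    show ?thesis
    proof (intro exI[of _ K] conjI allI impI K)
      fix t :: "'k \<Rightarrow> real" and N assume NM: "N \<le> M"
      let ?\<psi> = "\<integral>w. iexp (\<Sum>i\<in>UNIV. t i * chaos (l n) (L n) ({..<N} \<union> {M..<J n}) i w) \<partial>gauss_seq"
      \<comment> \<open>If \<open>M\<close> exceeds \<open>J n\<close>, the surplus indices carry
        zero coefficients, so the union stands for the full sum in every case.\<close>
      have "chaos (l n) (L n) ({..<M} \<union> {M..<J n}) i w = chaos (l n) (L n) {..<J n} i w" for i w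
        unfolding chaos_def by (intro sum.mono_neutral_right) (auto simp: supp not_less)
      then have 1: "norm (?\<psi> - \<phi> n t) \<le> sqrt (2 * (\<Sum>i\<in>UNIV. (t i)\<^sup>2) * (\<Sum>i\<in>UNIV. \<Sum>j\<in>{N..<M}. (l n i j)\<^sup>2))"
        using chaos_iexp_middle[OF ortho[of n] NM, where t = t and l = "l n" and J = "J n"] by (simp add: \<phi>_def)
      have "(\<Sum>i\<in>UNIV. \<Sum>j<N. \<bar>t i * l n i j\<bar>) \<le> (\<Sum>i\<in>UNIV. \<Sum>j<N. \<bar>t i\<bar> * \<delta> 0)"
        unfolding abs_mult by (intro sum_mono mult_left_mono l\<delta>) auto
      then have "2 * \<delta> M * sqrt ((\<Sum>i\<in>UNIV. (t i)\<^sup>2) * real CARD('k) + 1) *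
        ((\<Sum>i\<in>UNIV. \<Sum>j<N. \<bar>t i * l n i j\<bar>) + sqrt (2 * (\<Sum>i\<in>UNIV. (t i)\<^sup>2) * real CARD('k) * C)) \<le> E t N M"
        unfolding E_def using \<delta>0[of M] by (intro mult_left_mono add_right_mono) (auto intro!: mult_nonneg_nonneg add_nonneg_nonneg sum_nonneg)
      moreover have "norm (?\<psi> - q K t *\<^sub>R h n N t) \<le> 2 * \<delta> M * sqrt ((\<Sum>i\<in>UNIV. (t i)\<^sup>2) * real CARD('k) + 1) *
        ((\<Sum>i\<in>UNIV. \<Sum>j<N. \<bar>t i * l n i j\<bar>) + sqrt (2 * (\<Sum>i\<in>UNIV. (t i)\<^sup>2) * real CARD('k) * C))"
        unfolding q_def h_def by (rule K(3)[OF NM \<delta>0]) (rule l\<delta>)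
      ultimately have 2: "norm (?\<psi> - q K t *\<^sub>R h n N t) \<le> E t N M" by simp
      have "\<phi> n t - q K t *\<^sub>R h n N t = (?\<psi> - q K t *\<^sub>R h n N t) - (?\<psi> - \<phi> n t)" by simp
      then show "norm (\<phi> n t - q K t *\<^sub>R h n N t) \<le> sqrt (2 * (\<Sum>i\<in>UNIV. (t i)\<^sup>2) * (\<Sum>i\<in>UNIV. \<Sum>j\<in>{N..<M}. (l n i j)\<^sup>2)) + E t N M"
        using 1 2 norm_triangle_ineq4[of "?\<psi> - q K t *\<^sub>R h n N t" "?\<psi> - \<phi> n t"] by simp
    qed
  qed
  then obtain K where K: "\<And>n M. lower (K n M)" "\<And>n M i b. (K n M i b)\<^sup>2 \<le> 2 * C"
    "\<And>n M t N. N \<le> M \<Longrightarrow> norm (\<phi> n t - q (K n M) t *\<^sub>R h n N t) \<le>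
       sqrt (2 * (\<Sum>i\<in>UNIV. (t i)\<^sup>2) * (\<Sum>i\<in>UNIV. \<Sum>j\<in>{N..<M}. (l n i j)\<^sup>2)) + E t N M"
    by metis
  have KB: "\<bar>K n M i b\<bar> \<le> sqrt (2 * C)" for n M i b
    using K(2)[of n M i b] by (intro real_le_rsqrt) simp
  have lowL: "L n a b = 0" if "to_nat a < b" for n a b
    using ortho[of n] that unfolding orthonormal_rows_def lower_def by blast
  have LB: "\<bar>L n ij b\<bar> \<le> 1" for n ij b
  proof (cases "b \<le> to_nat ij")
    case True
    obtain i j where ij: "ij = (i, j)" by (cases ij)
    have "(L n ij b)\<^sup>2 \<le> (\<Sum>b\<le>to_nat ij. (L n ij b)\<^sup>2)" using True by (intro member_le_sum) auto
    also have "\<dots> = 1" using ortho[of n] unfolding ij by (simp add: orthonormal_rows_def power2_eq_square)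
    finally show ?thesis by (simp add: abs_square_le_1)
  next
    case False
    then show ?thesis using lowL[of ij b n] by simp
  qed
  \<comment> \<open>Coefficients, triangular factors and the tail factors of every threshold
    \<open>M\<close> are joined into one family over a countable sum type, so that a single
    subsequence works for all of them.\<close>
  define X :: "nat \<Rightarrow> ('k \<times> nat) + (('k \<times> nat) \<times> nat) + (nat \<times> 'k \<times> nat) \<Rightarrow> real" where
    "X n z = (case z of Inl (i, j) \<Rightarrow> l n i j | Inr (Inl (a, b)) \<Rightarrow> L n a b | Inr (Inr (M, i, b)) \<Rightarrow> K n M i b)" for n z
  define B where "B = \<delta> 0 + 1 + sqrt (2 * C)"
  have "\<bar>l n i j\<bar> \<le> B" "\<bar>L n a b\<bar> \<le> B" "\<bar>K n M i b\<bar> \<le> B" for n i j a b M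
    using l\<delta>[of 0 j n i] LB[of n a b] KB[of n M i b] \<delta>0[of 0] C(1) real_sqrt_ge_zero[of "2 * C"]
    unfolding B_def by linarith+
  then have "\<bar>X n z\<bar> \<le> B" for n z by (auto simp: X_def split: sum.split)
  then have XB: "\<exists>B. \<forall>n. \<bar>X n z\<bar> \<le> B" for z by blast
  obtain r x where r: "strict_mono (r :: nat \<Rightarrow> nat)" "\<And>z. (\<lambda>n. X (r n) z) \<longlonglongrightarrow> x z"
    using convergent_diagonal_subsequence[of X, OF XB] by blast
  define l' where "l' i j = x (Inl (i, j))" for i j
  define L' where "L' a b = x (Inr (Inl (a, b)))" for a b
  define K1 where "K1 M i b = x (Inr (Inr (M, i, b)))" for M i b
  have liml: "(\<lambda>n. l (r n) i j) \<longlonglongrightarrow> l' i j" for i j using r(2)[of "Inl (i, j)"] by (simp add: X_def l'_def)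
  have limL: "(\<lambda>n. L (r n) a b) \<longlonglongrightarrow> L' a b" for a b using r(2)[of "Inr (Inl (a, b))"] by (simp add: X_def L'_def)
  have limK: "(\<lambda>n. K (r n) M i b) \<longlonglongrightarrow> K1 M i b" for M i b using r(2)[of "Inr (Inr (M, i, b))"] by (simp add: X_def K1_def)
  have K1B: "\<bar>K1 M i b\<bar> \<le> sqrt (2 * C)" for M i b
    by (rule LIMSEQ_le_const2[OF tendsto_rabs[OF limK]]) (use KB in auto)
  then have YB: "\<exists>B. \<forall>M. \<bar>K1 M (fst z) (snd z)\<bar> \<le> B" for z by blast
  obtain s y where s: "strict_mono (s :: nat \<Rightarrow> nat)" "\<And>z. (\<lambda>M. K1 (s M) (fst z) (snd z)) \<longlonglongrightarrow> y z"
    using convergent_diagonal_subsequence[of "\<lambda>M z. K1 M (fst z) (snd z)", OF YB] by blast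
  define K' where "K' i b = y (i, b)" for i b
  have limK1: "(\<lambda>M. K1 (s M) i b) \<longlonglongrightarrow> K' i b" for i b using s(2)[of "(i, b)"] by (simp add: K'_def)
  have lowK1: "K1 M i b = 0" if "to_nat i < b" for M i b
    using limK[of M i b] K(1) that by (simp add: lower_def LIMSEQ_const_iff)
  have lowK': "lower K'"
    unfolding lower_def
  proof (intro allI impI)
    fix i :: 'k and b assume "to_nat i < b"
    then show "K' i b = 0" using limK1[of i b] by (simp add: lowK1 LIMSEQ_const_iff)
  qed
  have lowL': "lower L'"
    unfolding lower_def
  proof (intro allI impI)
    fix a :: "'k \<times> nat" and b assume "to_nat a < b"
    then show "L' a b = 0" using limL[of a b] by (simp add: lowL LIMSEQ_const_iff)
  qed
  \<comment> \<open>The inner products are finite sums of fixed length by triangularity, so no mass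
    is lost and orthonormality passes to the limit.\<close>
  have orthoL': "orthonormal_rows L'"
    unfolding orthonormal_rows_def
  proof (intro conjI allI lowL')
    fix i :: 'k and j j'
    have "(\<lambda>n. \<Sum>b\<le>to_nat (i, j). L (r n) (i, j) b * L (r n) (i, j') b) \<longlonglongrightarrow> (\<Sum>b\<le>to_nat (i, j). L' (i, j) b * L' (i, j') b)"
      by (intro tendsto_intros limL)
    then show "(\<Sum>b\<le>to_nat (i, j). L' (i, j) b * L' (i, j') b) = (if j = j' then 1 else 0)"
      using ortho by (simp add: orthonormal_rows_def LIMSEQ_const_iff)
  qed
  have l'C: "(\<Sum>j\<in>S. (l' i j)\<^sup>2) \<le> C" if "finite S" for i S
    by (rule LIMSEQ_le_const2[where X = "\<lambda>n. \<Sum>j\<in>S. (l (r n) i j)\<^sup>2"])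
      (use C(2)[OF that] in \<open>auto intro!: tendsto_intros liml\<close>)
  have summ: "summable (\<lambda>j. (l' i j)\<^sup>2)" for i
    by (rule summableI_nonneg_bounded[of _ C]) (use l'C in auto)
  define \<phi>' where "\<phi>' t = (\<integral>x. iexp (\<Sum>i\<in>UNIV. t i * x $ i) \<partial>\<mu>)" for t
  define h' where "h' N t = (\<integral>w. iexp (\<Sum>i\<in>UNIV. t i * chaos l' L' {..<N} i w) \<partial>gauss_seq)" for N t
  have lim\<phi>: "(\<lambda>n. \<phi> (r n) t) \<longlonglongrightarrow> \<phi>' t" for t
    using LIMSEQ_subseq_LIMSEQ[OF char_convergence r(1)] by (simp add: \<phi>_def \<phi>'_def comp_def)
  have limh: "(\<lambda>n. h (r n) N t) \<longlonglongrightarrow> h' N t" for N t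
    unfolding h_def h'_def
  proof (rule integral_dominated_convergence[where w = "\<lambda>_. 1"])
    show "AE w in gauss_seq. (\<lambda>n. iexp (\<Sum>i\<in>UNIV. t i * chaos (l (r n)) (L (r n)) {..<N} i w)) \<longlonglongrightarrow>
       iexp (\<Sum>i\<in>UNIV. t i * chaos l' L' {..<N} i w)"
      unfolding chaos_def gvec_def by (intro AE_I2 tendsto_intros liml limL)
  qed auto
  have limq: "(\<lambda>n. q (K (r n) M) t) \<longlonglongrightarrow> q (K1 M) t" for M t
    unfolding q_def by (intro tendsto_intros limK) auto
  have limq1: "(\<lambda>M. q (K1 (s M)) t) \<longlonglongrightarrow> q K' t" for t
    unfolding q_def by (intro tendsto_intros limK1) auto
  \<comment> \<open>The middle sum of the limit coefficients is bounded by the whole remainder of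
    the convergent series, which no longer involves \<open>M\<close>.\<close>
  define \<rho> where "\<rho> N t = sqrt (2 * (\<Sum>i\<in>UNIV. (t i)\<^sup>2) * (\<Sum>i\<in>UNIV. \<Sum>j. (l' i (j + N))\<^sup>2))" for N and t :: "'k \<Rightarrow> real"
  have step1: "norm (\<phi>' t - q (K1 M) t *\<^sub>R h' N t) \<le> \<rho> N t + E t N M" if NM: "N \<le> M" for t N M
  proof -
    have "norm (\<phi>' t - q (K1 M) t *\<^sub>R h' N t) \<le> sqrt (2 * (\<Sum>i\<in>UNIV. (t i)\<^sup>2) * (\<Sum>i\<in>UNIV. \<Sum>j\<in>{N..<M}. (l' i j)\<^sup>2)) + E t N M"
    proof (rule LIMSEQ_le)
      show "(\<lambda>n. norm (\<phi> (r n) t - q (K (r n) M) t *\<^sub>R h (r n) N t)) \<longlonglongrightarrow> norm (\<phi>' t - q (K1 M) t *\<^sub>R h' N t)"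
        by (intro tendsto_intros lim\<phi> limh limq)
      show "(\<lambda>n. sqrt (2 * (\<Sum>i\<in>UNIV. (t i)\<^sup>2) * (\<Sum>i\<in>UNIV. \<Sum>j\<in>{N..<M}. (l (r n) i j)\<^sup>2)) + E t N M) \<longlonglongrightarrow>
         sqrt (2 * (\<Sum>i\<in>UNIV. (t i)\<^sup>2) * (\<Sum>i\<in>UNIV. \<Sum>j\<in>{N..<M}. (l' i j)\<^sup>2)) + E t N M"
        by (intro tendsto_intros liml)
    qed (use K(3)[OF NM] in auto)
    also have "(\<Sum>j\<in>{N..<M}. (l' i j)\<^sup>2) \<le> (\<Sum>j. (l' i (j + N))\<^sup>2)" for i
    proof -
      have "(\<Sum>j\<in>{N..<M}. (l' i j)\<^sup>2) = (\<Sum>j<M - N. (l' i (j + N))\<^sup>2)"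
        using NM by (intro sum.reindex_bij_witness[of _ "\<lambda>j. j + N" "\<lambda>j. j - N"]) auto
      also have "\<dots> \<le> (\<Sum>j. (l' i (j + N))\<^sup>2)"
        using summ[of i] by (intro sum_le_suminf) (auto simp: summable_iff_shift[of "\<lambda>j. (l' i j)\<^sup>2" N])
      finally show ?thesis .
    qed
    then have "sqrt (2 * (\<Sum>i\<in>UNIV. (t i)\<^sup>2) * (\<Sum>i\<in>UNIV. \<Sum>j\<in>{N..<M}. (l' i j)\<^sup>2)) \<le> \<rho> N t"
      unfolding \<rho>_def by (intro real_sqrt_le_mono mult_left_mono sum_mono) (auto intro!: sum_nonneg)
    finally show ?thesis by simp
  qed
  have \<delta>lim: "\<delta> \<longlonglongrightarrow> 0"
  proof -
    have "(\<lambda>M. C / real (Suc M)) \<longlonglongrightarrow> 0" using LIMSEQ_Suc[OF lim_const_over_n[of C]] by simp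
    from tendsto_real_sqrt[OF this] show ?thesis unfolding \<delta>_def[abs_def] by simp
  qed
  \<comment> \<open>Along \<open>s\<close>, the factor \<open>K1\<close> converges to
    \<open>K'\<close> and \<open>E\<close> vanishes, while \<open>h' N\<close> stays fixed; only the
    bound \<open>\<rho> N t\<close> for the discarded middle part is left.\<close>
  have step2: "norm (\<phi>' t - q K' t *\<^sub>R h' N t) \<le> \<rho> N t" for t N
  proof (rule LIMSEQ_le)
    show "(\<lambda>M. norm (\<phi>' t - q (K1 (s M)) t *\<^sub>R h' N t)) \<longlonglongrightarrow> norm (\<phi>' t - q K' t *\<^sub>R h' N t)"
      by (intro tendsto_intros limq1)
    have "(\<lambda>M. \<rho> N t + E t N M) \<longlonglongrightarrow> \<rho> N t + 0"
      unfolding E_def by (intro tendsto_add tendsto_const tendsto_mult_left_zero tendsto_mult_right_zero \<delta>lim)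
    from LIMSEQ_subseq_LIMSEQ[OF this s(1)] show "(\<lambda>M. \<rho> N t + E t N (s M)) \<longlonglongrightarrow> \<rho> N t" by (simp add: comp_def)
    have "norm (\<phi>' t - q (K1 (s M)) t *\<^sub>R h' N t) \<le> \<rho> N t + E t N (s M)" if "M \<ge> N" for M
      using that seq_suble[OF s(1), of M] by (intro step1) simp
    then show "\<exists>N'. \<forall>M\<ge>N'. norm (\<phi>' t - q (K1 (s M)) t *\<^sub>R h' N t) \<le> \<rho> N t + E t N (s M)" by blast
  qed
  have \<rho>lim: "(\<lambda>N. \<rho> N t) \<longlonglongrightarrow> 0" for t
  proof -
    have "(\<lambda>N. \<rho> N t) \<longlonglongrightarrow> sqrt (2 * (\<Sum>i\<in>UNIV. (t i)\<^sup>2) * (\<Sum>i\<in>(UNIV::'k set). 0))"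
      unfolding \<rho>_def by (intro tendsto_intros suminf_exist_split2 summ)
    then show ?thesis by simp
  qed
  have "(\<lambda>N. \<phi>' t - q K' t *\<^sub>R h' N t) \<longlonglongrightarrow> 0" for t
    by (rule Lim_null_comparison[OF _ \<rho>lim[of t]]) (use step2 in auto)
  then have "(\<lambda>N. \<phi>' t - (\<phi>' t - q K' t *\<^sub>R h' N t)) \<longlonglongrightarrow> \<phi>' t - 0" for t
    by (intro tendsto_intros)
  then have "(\<lambda>N. q K' t *\<^sub>R h' N t) \<longlonglongrightarrow> \<phi>' t" for t by simp
  from that[OF orthoL' summ lowK' this[unfolded \<phi>'_def q_def h'_def]] show ?thesis .
qed

end

section \<open>Realization of the limit law\<close>

text \<open>Completeness of \<open>L^2\<close> by hand. The second moment formula makes the partial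
  sums Cauchy, hence Cauchy in \<open>L^1\<close>, and a subsequence converges almost everywhere;
  Fatou then transfers the \<open>L^2\<close> estimate to the limit for the full sequence.\<close>

lemma chaos_L2_limit:
  assumes L: "orthonormal_rows L" and summ: "summable (\<lambda>j. (l i j)\<^sup>2)"
  shows "\<exists>f\<in>borel_measurable gauss_seq.
    (\<lambda>N. \<integral>\<^sup>+w. ennreal ((f w - chaos l L {..<N} i w)\<^sup>2) \<partial>gauss_seq) \<longlonglongrightarrow> 0"
proof -
  define s where "s N = chaos l L {..<N} i" for N
  have ts [intro!]: "temperate (s N)" for N unfolding s_def by auto
  have [measurable]: "s N \<in> borel_measurable gauss_seq" for N by (rule temperate_measurable) auto
  define T where "T N = 2 * (\<Sum>j. (l i (j + N))\<^sup>2)" for N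
  have T0: "T N \<ge> 0" for N
    unfolding T_def using summ by (auto intro!: suminf_nonneg simp: summable_iff_shift[of "\<lambda>j. (l i j)\<^sup>2" N])
  have Tlim: "T \<longlonglongrightarrow> 0" unfolding T_def[abs_def] by (intro tendsto_mult_right_zero suminf_exist_split2 summ)
  have le1: "(\<integral>w. (s b w - s a w)\<^sup>2 \<partial>gauss_seq) \<le> T N" if "N \<le> a" "a \<le> b" for N a b
  proof -
    have eq: "{..<b} = {..<a} \<union> {a..<b}" using ivl_disj_un_one(2)[OF that(2)] by simp
    have "s b w - s a w = chaos l L {a..<b} i w" for w
      unfolding s_def chaos_def eq by (subst sum.union_disjoint) auto
    then have "(\<integral>w. (s b w - s a w)\<^sup>2 \<partial>gauss_seq) = 2 * (\<Sum>j\<in>{a..<b}. (l i j)\<^sup>2)"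
      by (simp add: chaos_second_moment[OF L])
    also have "(\<Sum>j\<in>{a..<b}. (l i j)\<^sup>2) \<le> (\<Sum>j\<in>{N..<b}. (l i j)\<^sup>2)"
      using that by (intro sum_mono2) auto
    also have "\<dots> = (\<Sum>j<b - N. (l i (j + N))\<^sup>2)"
      using that by (intro sum.reindex_bij_witness[of _ "\<lambda>j. j + N" "\<lambda>j. j - N"]) auto
    also have "\<dots> \<le> (\<Sum>j. (l i (j + N))\<^sup>2)"
      using summ by (intro sum_le_suminf) (auto simp: summable_iff_shift[of "\<lambda>j. (l i j)\<^sup>2" N])
    finally show ?thesis by (simp add: T_def)
  qed
  have le: "(\<integral>w. (s b w - s a w)\<^sup>2 \<partial>gauss_seq) \<le> T N" if "N \<le> a" "N \<le> b" for N a b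
    using le1[of N a b] le1[of N b a] that by (cases "a \<le> b") (auto simp: power2_commute)
  obtain r where r: "strict_mono r" "AE w in gauss_seq. Cauchy (\<lambda>k. s (r k) w)"
  proof (rule cauchy_L1_AE_cauchy_subseq[of gauss_seq s])
    show "integrable gauss_seq (s N)" for N by (rule temperate_integrable) auto
    fix e :: real assume "e > 0"
    then have "\<forall>\<^sub>F N in sequentially. T N < e\<^sup>2" by (intro order_tendstoD(2)[OF Tlim]) auto
    then obtain N where N: "T N < e\<^sup>2" by (auto simp: eventually_sequentially)
    show "\<exists>N. \<forall>a\<ge>N. \<forall>b\<ge>N. (\<integral>w. norm (s a w - s b w) \<partial>gauss_seq) < e"
    proof (intro exI[of _ N] allI impI)
      fix a b assume ab: "N \<le> a" "N \<le> b"
      have "(\<integral>w. \<bar>s a w - s b w\<bar> \<partial>gauss_seq) \<le> sqrt (\<integral>w. (s a w - s b w)\<^sup>2 \<partial>gauss_seq)"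
        by (intro gauss_seq.expectation_abs_le_sqrt temperate_integrable) auto
      also have "\<dots> \<le> sqrt (T N)" using le[OF ab(2,1)] by simp
      also have "\<dots> < sqrt (e\<^sup>2)" using N by (intro real_sqrt_less_mono)
      also have "\<dots> = e" using \<open>e > 0\<close> by simp
      finally show "(\<integral>w. norm (s a w - s b w) \<partial>gauss_seq) < e" by simp
    qed
  qed blast
  define f where "f w = lim (\<lambda>k. s (r k) w)" for w
  have mf [measurable]: "f \<in> borel_measurable gauss_seq" unfolding f_def[abs_def] by measurable
  have conv: "AE w in gauss_seq. (\<lambda>k. s (r k) w) \<longlonglongrightarrow> f w"
    using r(2) by eventually_elim (simp add: f_def Cauchy_convergent_iff convergent_LIMSEQ_iff)
  have bd: "(\<integral>\<^sup>+w. ennreal ((f w - s N w)\<^sup>2) \<partial>gauss_seq) \<le> ennreal (T N)" for N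
  proof -
    have "(\<integral>\<^sup>+w. ennreal ((f w - s N w)\<^sup>2) \<partial>gauss_seq) = (\<integral>\<^sup>+w. liminf (\<lambda>k. ennreal ((s (r k) w - s N w)\<^sup>2)) \<partial>gauss_seq)"
    proof (rule nn_integral_cong_AE)
      show "AE w in gauss_seq. ennreal ((f w - s N w)\<^sup>2) = liminf (\<lambda>k. ennreal ((s (r k) w - s N w)\<^sup>2))"
        using conv
      proof eventually_elim
        case (elim w)
        then have "(\<lambda>k. ennreal ((s (r k) w - s N w)\<^sup>2)) \<longlonglongrightarrow> ennreal ((f w - s N w)\<^sup>2)"
          by (intro tendsto_intros)
        then show ?case by (intro lim_imp_Liminf[symmetric]) auto
      qed
    qed
    \<comment> \<open>Fatou's lemma, applied along the subsequence with \<open>N\<close>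
      fixed.\<close>
    also have "\<dots> \<le> liminf (\<lambda>k. \<integral>\<^sup>+w. ennreal ((s (r k) w - s N w)\<^sup>2) \<partial>gauss_seq)"
      by (rule nn_integral_liminf) measurable
    also have "\<dots> \<le> liminf (\<lambda>k. ennreal (T N))"
    proof (rule Liminf_mono, rule eventually_sequentiallyI[of N])
      fix k assume "N \<le> k"
      then have "N \<le> r k" using seq_suble[OF r(1), of k] by simp
      have "(\<integral>\<^sup>+w. ennreal ((s (r k) w - s N w)\<^sup>2) \<partial>gauss_seq) = ennreal (\<integral>w. (s (r k) w - s N w)\<^sup>2 \<partial>gauss_seq)"
        by (intro nn_integral_eq_integral temperate_integrable) auto
      then show "(\<integral>\<^sup>+w. ennreal ((s (r k) w - s N w)\<^sup>2) \<partial>gauss_seq) \<le> ennreal (T N)"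
        using le[of N N "r k"] \<open>N \<le> r k\<close> by (simp add: ennreal_leI)
    qed
    also have "\<dots> = ennreal (T N)" by (simp add: Liminf_const)
    finally show ?thesis .
  qed
  have "(\<lambda>N. \<integral>\<^sup>+w. ennreal ((f w - s N w)\<^sup>2) \<partial>gauss_seq) \<longlonglongrightarrow> 0"
  proof (rule tendsto_sandwich[OF _ _ tendsto_const])
    show "(\<lambda>N. ennreal (T N)) \<longlonglongrightarrow> 0" using tendsto_ennrealI[OF Tlim] by simp
  qed (use bd in auto)
  then show ?thesis using mf by (auto simp: s_def)
qed

section \<open>Transport of the structure along measure-preserving maps\<close>

lemma centered_gaussian_rv_distr:
  assumes T [measurable]: "T \<in> M \<rightarrow>\<^sub>M N" and D: "distr M N T = N" and X: "centered_gaussian_rv N X"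
  shows "centered_gaussian_rv M (\<lambda>x. X (T x))"
proof -
  have [measurable]: "X \<in> borel_measurable N" using X by (simp add: centered_gaussian_rv_def)
  have "AE x in M. X (T x) = 0" if "AE x in N. X x = 0"
    using that by (intro AE_distrD[OF T]) (unfold D)
  moreover have "distr M lborel (\<lambda>x. X (T x)) = distr N lborel X"
    using distr_distr[of X N lborel T M] by (simp add: D comp_def)
  ultimately show ?thesis using X by (auto simp: centered_gaussian_rv_def distributed_def)
qed

lemma jointly_gaussian_distr:
  assumes "T \<in> M \<rightarrow>\<^sub>M N" "distr M N T = N" "jointly_gaussian N g"
  shows "jointly_gaussian M (\<lambda>i x. g i (T x))"
  unfolding jointly_gaussian_def
  using assms(3) centered_gaussian_rv_distr[OF assms(1,2)] by (auto simp: jointly_gaussian_def)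

lemma chaos_vector_distr:
  assumes T [measurable]: "T \<in> M \<rightarrow>\<^sub>M N" and D: "distr M N T = N" and cv: "chaos_vector N g lam F"
  shows "chaos_vector M (\<lambda>ij x. g ij (T x)) lam (\<lambda>i x. F i (T x))"
proof -
  have nd: "distributed N lborel (g ij) (normal_density 0 1)" for ij
    using cv unfolding chaos_vector_def by blast
  then have [measurable]: "g ij \<in> borel_measurable N" for ij by (auto simp: distributed_def)
  have [measurable]: "F i \<in> borel_measurable N" for i using cv by (simp add: chaos_vector_def)
  have "distr M lborel (\<lambda>x. g ij (T x)) = distr N lborel (g ij)" for ij
    using distr_distr[of "g ij" N lborel T M] by (simp add: D comp_def)
  then have "distributed M lborel (\<lambda>x. g ij (T x)) (normal_density 0 1)" for ij
    using nd[of ij] by (simp add: distributed_def)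
  moreover have "(\<integral>x. g a (T x) * g b (T x) \<partial>M) = (\<integral>x. g a x * g b x \<partial>N)" for a b
    using integral_distr[OF T, of "\<lambda>x. g a x * g b x"] by (simp add: D)
  moreover have "(\<integral>\<^sup>+x. ennreal ((F i (T x) - (\<Sum>j<K. lam i j * ((g (i, j) (T x))\<^sup>2 - 1)))\<^sup>2) \<partial>M) =
      (\<integral>\<^sup>+x. ennreal ((F i x - (\<Sum>j<K. lam i j * ((g (i, j) x)\<^sup>2 - 1)))\<^sup>2) \<partial>N)" for i K
    using nn_integral_distr[OF T, of "\<lambda>x. ennreal ((F i x - (\<Sum>j<K. lam i j * ((g (i, j) x)\<^sup>2 - 1)))\<^sup>2)"] by (simp add: D)
  ultimately show ?thesis
    using cv jointly_gaussian_distr[OF T D, of g] unfolding chaos_vector_def by simp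
qed

lemma chaos_vector_gvec:
  assumes L: "orthonormal_rows L" and summ: "\<And>i. summable (\<lambda>j. (l i j)\<^sup>2)"
    and F: "\<And>i. F i \<in> borel_measurable gauss_seq"
      "\<And>i. (\<lambda>N. \<integral>\<^sup>+w. ennreal ((F i w - chaos l L {..<N} i w)\<^sup>2) \<partial>gauss_seq) \<longlonglongrightarrow> 0"
  shows "chaos_vector gauss_seq (gvec L) l F"
proof -
  have low: "lower L" using L by (simp add: orthonormal_rows_def)
  have "distributed gauss_seq lborel (gvec L ij) (normal_density 0 1)" for ij
  proof -
    obtain i j where "ij = (i, j)" by (cases ij)
    then have "(\<Sum>b\<le>to_nat ij. (L ij b)\<^sup>2) = 1"
      using L by (simp add: orthonormal_rows_def power2_eq_square)
    then show ?thesis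
      using distributed_gauss_seq_lincomb[of "{..to_nat ij}" "L ij"] by (simp add: gvec_def[abs_def])
  qed
  moreover have "(\<integral>w. gvec L (i, j) w * gvec L (i, j') w \<partial>gauss_seq) = 0" if "j \<noteq> j'" for i j j'
    using L that by (simp add: gvec_covariance[OF low] orthonormal_rows_def)
  ultimately show ?thesis
    unfolding chaos_vector_def using jointly_gaussian_gvec summ F by (auto simp: chaos_def)
qed

text \<open>The vector is replaced by its family of coordinates, where uniqueness is known, and
  recovered by the measurable inverse map \<open>\<lambda>z. \<chi> i. z i\<close>.\<close>

lemma vec_char_uniqueness:
  fixes M N :: "(real ^ 'k::finite) measure"
  assumes M: "prob_space M" "sets M = sets borel" and N: "prob_space N" "sets N = sets borel"
    and eq: "\<And>t. (\<integral>x. iexp (\<Sum>i\<in>UNIV. t i * x $ i) \<partial>M) = (\<integral>x. iexp (\<Sum>i\<in>UNIV. t i * x $ i) \<partial>N)"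
  shows "M = N"
proof -
  have [measurable]: "(\<lambda>x::real^'k. x $ i) \<in> borel_measurable borel" for i
    by (intro borel_measurable_continuous_onI continuous_intros)
  have m: "(\<lambda>x. x $ i) \<in> borel_measurable M" "(\<lambda>x. x $ i) \<in> borel_measurable N" for i
    using M(2) N(2) by (simp_all cong: measurable_cong_sets)
  have pi: "(\<lambda>x i. x $ i) \<in> borel \<rightarrow>\<^sub>M PiM (UNIV::'k set) (\<lambda>_. borel :: real measure)"
    by (rule measurable_PiM_single') (auto simp: space_PiM)
  have eqPi: "distr M (PiM UNIV (\<lambda>_. borel)) (\<lambda>x i. x $ i) = distr N (PiM UNIV (\<lambda>_. borel)) (\<lambda>x i. x $ i)"
  proof (rule char_eq_imp_distr_PiM_eq[OF M(1) N(1) m])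
    fix I :: "'k set" and t :: "'k \<Rightarrow> real" assume "finite I"
    have "(\<Sum>i\<in>UNIV. (if i \<in> I then t i else 0) * x $ i) = (\<Sum>i\<in>I. t i * x $ i)" for x :: "real ^ 'k"
      by (intro sum.mono_neutral_cong_right) auto
    then show "(\<integral>x. iexp (\<Sum>i\<in>I. t i * x $ i) \<partial>M) = (\<integral>x. iexp (\<Sum>i\<in>I. t i * x $ i) \<partial>N)"
      using eq[of "\<lambda>i. if i \<in> I then t i else 0"] by simp
  qed
  have mv: "(\<lambda>z. \<chi> i. z i) \<in> PiM (UNIV::'k set) (\<lambda>_. borel :: real measure) \<rightarrow>\<^sub>M borel" by measurable
  have id: "distr (distr K (PiM UNIV (\<lambda>_. borel)) (\<lambda>x i. x $ i)) borel (\<lambda>z. \<chi> i. z i) = K"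
    if K: "sets K = sets borel" for K :: "(real ^ 'k) measure"
  proof -
    have "(\<lambda>x i. x $ i) \<in> K \<rightarrow>\<^sub>M PiM (UNIV::'k set) (\<lambda>_. borel :: real measure)"
      using pi K by (simp cong: measurable_cong_sets)
    then have "distr (distr K (PiM UNIV (\<lambda>_. borel)) (\<lambda>x i. x $ i)) borel (\<lambda>z. \<chi> i. z i) = distr K borel (\<lambda>x. x)"
      by (subst distr_distr[OF mv]) (auto simp: comp_def)
    also have "\<dots> = distr K K (\<lambda>x. x)" by (intro distr_cong) (auto simp: K)
    finally show ?thesis by simp
  qed
  show ?thesis
    by (rule trans[OF id[OF M(2), symmetric] trans[OF arg_cong[OF eqPi, of "\<lambda>K. distr K borel (\<lambda>z. \<chi> i. z i)"] id[OF N(2)]]])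
qed

lemma gvec_char:
  fixes K :: "'k::finite \<Rightarrow> nat \<Rightarrow> real"
  assumes K: "lower K"
  shows "(\<integral>w. iexp (\<Sum>i\<in>UNIV. t i * gvec K i w) \<partial>gauss_seq) =
    of_real (exp (- (\<Sum>b<kdim TYPE('k). (\<Sum>i\<in>UNIV. t i * K i b)\<^sup>2) / 2))"
proof -
  have "(\<integral>w. (\<Sum>i\<in>UNIV. t i * gvec K i w)\<^sup>2 \<partial>gauss_seq) =
      (\<Sum>i\<in>UNIV. \<Sum>j\<in>UNIV. t i * t j * (\<integral>w. gvec K i w * gvec K j w \<partial>gauss_seq))"
    by (intro gauss_seq.lincomb_second_moment temperate_integrable temperate_measurable) auto
  also have "\<dots> = (\<Sum>b<kdim TYPE('k). (\<Sum>i\<in>UNIV. t i * K i b)\<^sup>2)"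
    unfolding gvec_covariance[OF K] lower_inner_eq[OF K to_nat_less_kdim] sum_lincomb_square ..
  finally have var: "(\<integral>w. (\<Sum>i\<in>UNIV. t i * gvec K i w)\<^sup>2 \<partial>gauss_seq) = (\<Sum>b<kdim TYPE('k). (\<Sum>i\<in>UNIV. t i * K i b)\<^sup>2)" .
  have "centered_gaussian_rv gauss_seq (\<lambda>w. \<Sum>i\<in>UNIV. t i * gvec K i w)"
    using jointly_gaussian_gvec[of K, unfolded jointly_gaussian_def, rule_format, of UNIV t] by simp
  from gauss_seq.centered_gaussian_rv_char(2)[OF this] show ?thesis unfolding var .
qed

lemma iexp_L2_limit:
  fixes F :: "'k::finite \<Rightarrow> (nat \<Rightarrow> real) \<Rightarrow> real"
  assumes F [measurable]: "\<And>i. F i \<in> borel_measurable gauss_seq"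
    and lim: "\<And>i. (\<lambda>N. \<integral>\<^sup>+w. ennreal ((F i w - chaos l L {..<N} i w)\<^sup>2) \<partial>gauss_seq) \<longlonglongrightarrow> 0"
  shows "(\<lambda>N. \<integral>w. iexp (\<Sum>i\<in>UNIV. t i * chaos l L {..<N} i w) \<partial>gauss_seq) \<longlonglongrightarrow>
     (\<integral>w. iexp (\<Sum>i\<in>UNIV. t i * F i w) \<partial>gauss_seq)"
proof (rule tendstoI)
  fix e :: real assume e: "e > 0"
  define T where "T = (\<Sum>i\<in>UNIV. \<bar>t i\<bar>)"
  have T: "T \<ge> 0" unfolding T_def by (intro sum_nonneg) auto
  \<comment> \<open>Each coordinate is approximated within \<open>d\<close> in \<open>L^2\<close>,
    for a total error of at most \<open>T * d\<close>; the added 1 covers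
    \<open>T = 0\<close>.\<close>
  define d where "d = e / (T + 1)"
  have d: "d > 0" using e T by (simp add: d_def)
  have Td: "T * d < e" using e T by (simp add: d_def field_simps)
  have mc [measurable]: "chaos l L S i \<in> borel_measurable gauss_seq" for S i by (rule temperate_measurable) auto
  have "\<forall>\<^sub>F N in sequentially. \<forall>i\<in>UNIV. (\<integral>\<^sup>+w. ennreal ((F i w - chaos l L {..<N} i w)\<^sup>2) \<partial>gauss_seq) < ennreal (d\<^sup>2)"
    using lim d by (intro eventually_ball_finite ballI order_tendstoD(2)) auto
  then show "\<forall>\<^sub>F N in sequentially. dist (\<integral>w. iexp (\<Sum>i\<in>UNIV. t i * chaos l L {..<N} i w) \<partial>gauss_seq)
     (\<integral>w. iexp (\<Sum>i\<in>UNIV. t i * F i w) \<partial>gauss_seq) < e"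
  proof eventually_elim
    case (elim N)
    let ?S = "chaos l L {..<N}"
    have le: "(\<integral>\<^sup>+w. ennreal ((F i w - ?S i w)\<^sup>2) \<partial>gauss_seq) \<le> ennreal (d\<^sup>2)" for i
      using elim by (simp add: less_imp_le)
    note i = gauss_seq.expectation_abs_le_of_nn_integral[OF _ le less_imp_le[OF d]]
    have int: "integrable gauss_seq (\<lambda>w. F i w - ?S i w)" for i by (rule i(1)) measurable
    have eq: "(\<Sum>i\<in>UNIV. t i * ?S i w) - (\<Sum>i\<in>UNIV. t i * F i w) = - (\<Sum>i\<in>UNIV. t i * (F i w - ?S i w))" for w
      by (simp add: right_diff_distrib sum_subtractf)
    have "dist (\<integral>w. iexp (\<Sum>i\<in>UNIV. t i * ?S i w) \<partial>gauss_seq) (\<integral>w. iexp (\<Sum>i\<in>UNIV. t i * F i w) \<partial>gauss_seq)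
      \<le> (\<integral>w. \<bar>(\<Sum>i\<in>UNIV. t i * ?S i w) - (\<Sum>i\<in>UNIV. t i * F i w)\<bar> \<partial>gauss_seq)"
      unfolding dist_norm
    proof (rule gauss_seq.norm_iexp_diff_le)
      show "integrable gauss_seq (\<lambda>w. (\<Sum>i\<in>UNIV. t i * ?S i w) - (\<Sum>i\<in>UNIV. t i * F i w))"
        unfolding eq by (intro integrable_minus Bochner_Integration.integrable_sum integrable_mult_right int)
    qed measurable
    also have "\<dots> \<le> (\<integral>w. (\<Sum>i\<in>UNIV. \<bar>t i\<bar> * \<bar>F i w - ?S i w\<bar>) \<partial>gauss_seq)"
    proof (rule integral_mono)
      show "integrable gauss_seq (\<lambda>w. \<bar>(\<Sum>i\<in>UNIV. t i * ?S i w) - (\<Sum>i\<in>UNIV. t i * F i w)\<bar>)"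
        unfolding eq by (intro integrable_abs integrable_minus Bochner_Integration.integrable_sum integrable_mult_right int)
      show "integrable gauss_seq (\<lambda>w. \<Sum>i\<in>UNIV. \<bar>t i\<bar> * \<bar>F i w - ?S i w\<bar>)"
        by (intro Bochner_Integration.integrable_sum integrable_mult_right integrable_abs int)
      show "\<bar>(\<Sum>i\<in>UNIV. t i * ?S i w) - (\<Sum>i\<in>UNIV. t i * F i w)\<bar> \<le> (\<Sum>i\<in>UNIV. \<bar>t i\<bar> * \<bar>F i w - ?S i w\<bar>)" for w
        unfolding eq abs_minus_cancel abs_mult[symmetric] by (rule sum_abs)
    qed
    also have "\<dots> = (\<Sum>i\<in>UNIV. \<bar>t i\<bar> * (\<integral>w. \<bar>F i w - ?S i w\<bar> \<partial>gauss_seq))"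
      using int by simp
    also have "\<dots> \<le> (\<Sum>i\<in>UNIV. \<bar>t i\<bar> * d)"
      by (intro sum_mono mult_left_mono i(2)) auto
    also have "\<dots> = T * d" by (simp add: T_def sum_distrib_right)
    finally show ?case using Td by linarith
  qed
qed

text \<open>The limit vector is to be realised on a space of real sequences, so two independent
  copies of the Gaussian sequence are coded as one: the even coordinates will carry
  \<open>F\<close>, the odd ones \<open>\<eta>\<close>.\<close>

definition interleave :: "(nat \<Rightarrow> real) \<times> (nat \<Rightarrow> real) \<Rightarrow> nat \<Rightarrow> real" where
  "interleave z b = (if even b then fst z (b div 2) else snd z (b div 2))"

definition gauss_seq2 :: "(nat \<Rightarrow> real) measure" where
  "gauss_seq2 = distr (gauss_seq \<Otimes>\<^sub>M gauss_seq) (PiM UNIV (\<lambda>_. borel)) interleave"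

definition evens :: "(nat \<Rightarrow> real) \<Rightarrow> nat \<Rightarrow> real" where "evens w b = w (2 * b)"
definition odds :: "(nat \<Rightarrow> real) \<Rightarrow> nat \<Rightarrow> real" where "odds w b = w (2 * b + 1)"

lemma measurable_to_gauss_seq:
  "f \<in> M \<rightarrow>\<^sub>M PiM UNIV (\<lambda>_. borel) \<Longrightarrow> f \<in> M \<rightarrow>\<^sub>M gauss_seq"
  by (simp add: measurable_cong_sets[OF refl sets_gauss_seq])

lemma measurable_interleave [measurable]:
  "interleave \<in> gauss_seq \<Otimes>\<^sub>M gauss_seq \<rightarrow>\<^sub>M PiM UNIV (\<lambda>_. borel)"
proof (rule measurable_PiM_single')
  fix b
  have "(\<lambda>z. fst z (b div 2)) \<in> borel_measurable (gauss_seq \<Otimes>\<^sub>M gauss_seq)"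
    "(\<lambda>z. snd z (b div 2)) \<in> borel_measurable (gauss_seq \<Otimes>\<^sub>M gauss_seq)"
    by measurable
  then show "(\<lambda>z. interleave z b) \<in> borel_measurable (gauss_seq \<Otimes>\<^sub>M gauss_seq)"
    unfolding interleave_def by (cases "even b") auto
qed (auto simp: space_PiM)

interpretation gauss_seq2: prob_space gauss_seq2
proof -
  interpret pair_prob_space gauss_seq gauss_seq ..
  show "prob_space gauss_seq2" unfolding gauss_seq2_def by (rule prob_space_distr) measurable
qed

lemma sets_gauss_seq2 [measurable_cong]: "sets gauss_seq2 = sets (PiM UNIV (\<lambda>_. borel))"
  by (simp add: gauss_seq2_def)

lemma measurable_evens [measurable]: "evens \<in> gauss_seq2 \<rightarrow>\<^sub>M gauss_seq"
  and measurable_odds [measurable]: "odds \<in> gauss_seq2 \<rightarrow>\<^sub>M gauss_seq"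
  unfolding evens_def[abs_def] odds_def[abs_def]
  by (intro measurable_to_gauss_seq measurable_PiM_single'; simp add: space_PiM)+

lemma evens_interleave [simp]: "evens (interleave z) = fst z"
  and odds_interleave [simp]: "odds (interleave z) = snd z"
  by (auto simp: evens_def odds_def interleave_def)

text \<open>\<open>odds\<close> and \<open>evens\<close> undo the interleaving, so their joint law
  is the product measure with its factors swapped, hence the same product. Both marginals and the
  independence follow from this identity.\<close>

lemma distr_gauss_seq2:
  "distr gauss_seq2 (gauss_seq \<Otimes>\<^sub>M gauss_seq) (\<lambda>w. (odds w, evens w)) = gauss_seq \<Otimes>\<^sub>M gauss_seq"
proof -
  interpret pair_prob_space gauss_seq gauss_seq ..
  have [measurable]: "evens \<in> PiM UNIV (\<lambda>_. borel) \<rightarrow>\<^sub>M gauss_seq" "odds \<in> PiM UNIV (\<lambda>_. borel) \<rightarrow>\<^sub>M gauss_seq"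
    using measurable_evens measurable_odds by (simp_all cong: measurable_cong_sets add: measurable_cong_sets[OF sets_gauss_seq2 refl])
  have "distr gauss_seq2 (gauss_seq \<Otimes>\<^sub>M gauss_seq) (\<lambda>w. (odds w, evens w)) =
    distr (gauss_seq \<Otimes>\<^sub>M gauss_seq) (gauss_seq \<Otimes>\<^sub>M gauss_seq) (\<lambda>z. (snd z, fst z))"
    unfolding gauss_seq2_def by (subst distr_distr) (auto simp: comp_def)
  then show ?thesis using distr_pair_swap by (simp add: case_prod_unfold)
qed

lemma distr_evens: "distr gauss_seq2 gauss_seq evens = gauss_seq"
  and distr_odds: "distr gauss_seq2 gauss_seq odds = gauss_seq"
proof -
  interpret pair_prob_space gauss_seq gauss_seq ..
  have fst: "distr (gauss_seq \<Otimes>\<^sub>M gauss_seq) gauss_seq fst = gauss_seq" by (rule gauss_seq.distr_pair_fst)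
  have snd: "distr (gauss_seq \<Otimes>\<^sub>M gauss_seq) gauss_seq snd = gauss_seq"
    by (subst distr_pair_swap, subst distr_distr) (auto simp: comp_def case_prod_unfold fst)
  have "distr gauss_seq2 gauss_seq evens = distr (distr gauss_seq2 (gauss_seq \<Otimes>\<^sub>M gauss_seq) (\<lambda>w. (odds w, evens w))) gauss_seq snd"
    "distr gauss_seq2 gauss_seq odds = distr (distr gauss_seq2 (gauss_seq \<Otimes>\<^sub>M gauss_seq) (\<lambda>w. (odds w, evens w))) gauss_seq fst"
    by (subst distr_distr; auto simp: comp_def)+
  then show "distr gauss_seq2 gauss_seq evens = gauss_seq" "distr gauss_seq2 gauss_seq odds = gauss_seq"
    by (simp_all add: distr_gauss_seq2 fst snd)
qed

lemma indep_odds_evens: "gauss_seq2.indep_var gauss_seq odds gauss_seq evens"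
  unfolding gauss_seq2.indep_var_distribution_eq by (simp add: distr_evens distr_odds distr_gauss_seq2)

theorem theorem1p2:
  fixes M :: "nat \<Rightarrow> 'a measure"
    and g :: "nat \<Rightarrow> 'k::finite \<times> nat \<Rightarrow> 'a \<Rightarrow> real"
    and lam :: "nat \<Rightarrow> 'k \<Rightarrow> nat \<Rightarrow> real"
    and F :: "nat \<Rightarrow> 'k \<Rightarrow> 'a \<Rightarrow> real"
    and \<mu> :: "(real ^ 'k) measure"
  assumes "\<And>n. prob_space (M n)"
    and "\<And>n. chaos_vector (M n) (g n) (lam n) (F n)"
    and "converges_in_law M (\<lambda>n \<omega>. \<chi> i. F n i \<omega>) \<mu>"
  shows "\<exists>(M' :: (nat \<Rightarrow> real) measure) g' lam' F' (\<eta> :: (nat \<Rightarrow> real) \<Rightarrow> real ^ 'k).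
           prob_space M' \<and> chaos_vector M' g' lam' F' \<and>
           jointly_gaussian M' (\<lambda>i \<omega>. \<eta> \<omega> $ i) \<and>
           prob_space.indep_var M' borel \<eta> borel (\<lambda>\<omega>. \<chi> i. F' i \<omega>) \<and>
           distr M' borel (\<lambda>\<omega>. \<eta> \<omega> + (\<chi> i. F' i \<omega>)) = \<mu>"
proof -
  have mF: "F n i \<in> borel_measurable (M n)" for n i using assms(2)[of n] by (simp add: chaos_vector_def)
  \<comment> \<open>All that the approximation provides at tolerance \<open>1 / (n + 1)\<close> is
    packed into one predicate, so that a single choice yields \<open>J\<close>, \<open>l\<close> and
    \<open>L\<close> for every \<open>n\<close>. Since the tolerance tends to zero, the models have
    the same limits on bounded Lipschitz functions.\<close>
  define A where "A n J l L \<longleftrightarrow> orthonormal_rows L \<and> (\<forall>i j. J \<le> j \<longrightarrow> l i j = 0) \<and> (\<forall>i a b. a \<le> b \<longrightarrow> \<bar>l i b\<bar> \<le> \<bar>l i a\<bar>) \<and>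
    (\<forall>f :: real ^ 'k \<Rightarrow> real. \<forall>B c. f \<in> borel_measurable borel \<longrightarrow> (\<forall>x. \<bar>f x\<bar> \<le> B) \<longrightarrow> c \<ge> 0 \<longrightarrow>
      (\<forall>x y. \<bar>f x - f y\<bar> \<le> c * (\<Sum>i\<in>UNIV. \<bar>x $ i - y $ i\<bar>)) \<longrightarrow>
      \<bar>(\<integral>x. f (\<chi> i. F n i x) \<partial>M n) - (\<integral>w. f (\<chi> i. chaos l L {..<J} i w) \<partial>gauss_seq)\<bar> \<le> c * (real CARD('k) * (1 / real (Suc n))))"
    for n J l L
  have "\<exists>J l L. A n J l L" for n
    unfolding A_def by (rule chaos_vector_approx[OF assms(1,2)]) simp
  then obtain J l L where A: "\<And>n. A n (J n) (l n) (L n)" by metis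
  have conv: "(\<lambda>n. \<integral>w. f (\<chi> i. chaos (l n) (L n) {..<J n} i w) \<partial>gauss_seq) \<longlonglongrightarrow> (\<integral>x. f x \<partial>\<mu>)"
    if f: "continuous_on UNIV f" and B: "\<And>x. \<bar>f x\<bar> \<le> B" and c: "c \<ge> 0"
      and lip: "\<And>x y. \<bar>f x - f y\<bar> \<le> c * (\<Sum>i\<in>UNIV. \<bar>x $ i - y $ i\<bar>)" for f :: "real ^ 'k \<Rightarrow> real" and B c
  proof -
    have mf [measurable]: "f \<in> borel_measurable borel" using f by (rule borel_measurable_continuous_onI)
    have "bounded (range f)" using B by (auto simp: bounded_iff)
    then have "(\<lambda>n. \<integral>x. f x \<partial>distr (M n) borel (\<lambda>\<omega>. \<chi> i. F n i \<omega>)) \<longlonglongrightarrow> (\<integral>x. f x \<partial>\<mu>)"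
      using assms(3) f unfolding converges_in_law_def by blast
    then have lim: "(\<lambda>n. \<integral>x. f (\<chi> i. F n i x) \<partial>M n) \<longlonglongrightarrow> (\<integral>x. f x \<partial>\<mu>)"
      by (subst (asm) integral_distr) (auto intro!: borel_measurable_vec_lambda mF)
    have null: "(\<lambda>n. (\<integral>x. f (\<chi> i. F n i x) \<partial>M n) - (\<integral>w. f (\<chi> i. chaos (l n) (L n) {..<J n} i w) \<partial>gauss_seq)) \<longlonglongrightarrow> 0"
    proof (rule Lim_null_comparison)
      have "\<bar>(\<integral>x. f (\<chi> i. F n i x) \<partial>M n) - (\<integral>w. f (\<chi> i. chaos (l n) (L n) {..<J n} i w) \<partial>gauss_seq)\<bar>
         \<le> c * (real CARD('k) * (1 / real (Suc n)))" for n
        using A[of n] mf B c lip unfolding A_def by blast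
      then show "\<forall>\<^sub>F n in sequentially. norm ((\<integral>x. f (\<chi> i. F n i x) \<partial>M n) - (\<integral>w. f (\<chi> i. chaos (l n) (L n) {..<J n} i w) \<partial>gauss_seq))
         \<le> c * (real CARD('k) * (1 / real (Suc n)))" by simp
      show "(\<lambda>n. c * (real CARD('k) * (1 / real (Suc n)))) \<longlonglongrightarrow> 0"
        by (intro tendsto_mult_right_zero LIMSEQ_Suc[OF lim_const_over_n])
    qed
    from tendsto_diff[OF lim null] show ?thesis by simp
  qed
  interpret cs: chaos_sequence l L J \<mu>
  proof (rule chaos_sequence.intro)
    show "orthonormal_rows (L n)" for n using A[of n] unfolding A_def by blast
    show "l n i j = 0" if "J n \<le> j" for n i j using A[of n] that unfolding A_def by blast
    show "\<bar>l n i b\<bar> \<le> \<bar>l n i a\<bar>" if "a \<le> b" for n i a b using A[of n] that unfolding A_def by blast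
    show "prob_space \<mu>" "sets \<mu> = sets borel" using assms(3) unfolding converges_in_law_def by blast+
  qed (rule conv)
  obtain l' :: "'k \<Rightarrow> nat \<Rightarrow> real" and L' K'
    where L': "orthonormal_rows L'" and l': "\<And>i. summable (\<lambda>j. (l' i j)\<^sup>2)" and K': "lower K'" and
    lim: "\<And>t. (\<lambda>N. exp (- (\<Sum>b<kdim TYPE('k). (\<Sum>i\<in>UNIV. t i * K' i b)\<^sup>2) / 2) *\<^sub>R
        (\<integral>w. iexp (\<Sum>i\<in>UNIV. t i * chaos l' L' {..<N} i w) \<partial>gauss_seq)) \<longlonglongrightarrow> (\<integral>x. iexp (\<Sum>i\<in>UNIV. t i * x $ i) \<partial>\<mu>)"
    by (rule cs.chaos_limit_char) (rule that, assumption+)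
  have "\<forall>i. \<exists>f. f \<in> borel_measurable gauss_seq \<and> (\<lambda>N. \<integral>\<^sup>+w. ennreal ((f w - chaos l' L' {..<N} i w)\<^sup>2) \<partial>gauss_seq) \<longlonglongrightarrow> 0"
    using chaos_L2_limit[of L' l', OF L' l'] by blast
  from choice[OF this] obtain F' where F': "\<And>i. F' i \<in> borel_measurable gauss_seq"
      "\<And>i. (\<lambda>N. \<integral>\<^sup>+w. ennreal ((F' i w - chaos l' L' {..<N} i w)\<^sup>2) \<partial>gauss_seq) \<longlonglongrightarrow> 0"
    by blast
  note [measurable] = F'(1)
  \<comment> \<open>The Gaussian part reads the odd coordinates and the chaos part the even ones;
    their independence is thus built into the space.\<close>
  define \<eta> where "\<eta> w = (\<chi> i. gvec K' i (odds w))" for w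
  define F2 where "F2 i w = F' i (evens w)" for i w
  have mK [measurable]: "gvec K' i \<in> borel_measurable gauss_seq" for i by (rule temperate_measurable) auto
  have m\<eta> [measurable]: "\<eta> \<in> borel_measurable gauss_seq2" unfolding \<eta>_def[abs_def] by measurable
  have mF2 [measurable]: "F2 i \<in> borel_measurable gauss_seq2" for i unfolding F2_def[abs_def] by measurable
  have cv: "chaos_vector gauss_seq2 (\<lambda>ij w. gvec L' ij (evens w)) l' F2"
    unfolding F2_def by (intro chaos_vector_distr[OF measurable_evens distr_evens] chaos_vector_gvec L' l' F')
  have jg: "jointly_gaussian gauss_seq2 (\<lambda>i w. \<eta> w $ i)"
    unfolding \<eta>_def using jointly_gaussian_distr[OF measurable_odds distr_odds jointly_gaussian_gvec[of K']] by simp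
  have ind: "gauss_seq2.indep_var borel \<eta> borel (\<lambda>w. \<chi> i. F2 i w)"
  proof -
    have "gauss_seq2.indep_var borel ((\<lambda>w. \<chi> i. gvec K' i w) \<circ> odds) borel ((\<lambda>w. \<chi> i. F' i w) \<circ> evens)"
      by (rule gauss_seq2.indep_var_compose[OF indep_odds_evens]) measurable
    then show ?thesis by (simp add: comp_def \<eta>_def[abs_def] F2_def)
  qed
  have "distr gauss_seq2 borel (\<lambda>w. \<eta> w + (\<chi> i. F2 i w)) = \<mu>"
  proof (rule vec_char_uniqueness)
    have [measurable]: "(\<lambda>x::real^'k. x $ i) \<in> borel_measurable borel" for i
      by (intro borel_measurable_continuous_onI continuous_intros)
    have mS [measurable]: "(\<lambda>w. \<eta> w + (\<chi> i. F2 i w)) \<in> borel_measurable gauss_seq2" by measurable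
    show "prob_space (distr gauss_seq2 borel (\<lambda>w. \<eta> w + (\<chi> i. F2 i w)))"
      by (rule gauss_seq2.prob_space_distr[OF mS])
    show "prob_space \<mu>" "sets \<mu> = sets borel" using assms(3) by (auto simp: converges_in_law_def)
    show "sets (distr gauss_seq2 borel (\<lambda>w. \<eta> w + (\<chi> i. F2 i w))) = sets borel" by simp
    fix t :: "'k \<Rightarrow> real"
    let ?E = "\<lambda>x :: real ^ 'k. iexp (\<Sum>i\<in>UNIV. t i * x $ i)"
    have mE [measurable]: "?E \<in> borel_measurable borel" by measurable
    have indE: "gauss_seq2.indep_var borel (?E \<circ> \<eta>) borel (?E \<circ> (\<lambda>w. \<chi> i. F2 i w))"
      by (rule gauss_seq2.indep_var_compose[OF ind mE mE])
    have "(\<integral>x. ?E x \<partial>distr gauss_seq2 borel (\<lambda>w. \<eta> w + (\<chi> i. F2 i w))) = (\<integral>w. ?E (\<eta> w + (\<chi> i. F2 i w)) \<partial>gauss_seq2)"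
      by (rule integral_distr[OF mS mE])
    also have "\<dots> = (\<integral>w. (?E \<circ> \<eta>) w * (?E \<circ> (\<lambda>w. \<chi> i. F2 i w)) w \<partial>gauss_seq2)"
      by (simp add: distrib_left sum.distrib exp_add)
    also have "\<dots> = (\<integral>w. (?E \<circ> \<eta>) w \<partial>gauss_seq2) * (\<integral>w. (?E \<circ> (\<lambda>w. \<chi> i. F2 i w)) w \<partial>gauss_seq2)"
      by (rule gauss_seq2.indep_var_lebesgue_integral[OF indE])
        (auto simp: comp_def intro!: gauss_seq2.integrable_const_bound[of _ 1])
    also have "(\<integral>w. (?E \<circ> \<eta>) w \<partial>gauss_seq2) = (\<integral>w. iexp (\<Sum>i\<in>UNIV. t i * gvec K' i w) \<partial>distr gauss_seq2 gauss_seq odds)"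
      by (subst integral_distr) (auto simp: \<eta>_def comp_def)
    also have "\<dots> = of_real (exp (- (\<Sum>b<kdim TYPE('k). (\<Sum>i\<in>UNIV. t i * K' i b)\<^sup>2) / 2))"
      unfolding distr_odds by (rule gvec_char[OF K'])
    also have "(\<integral>w. (?E \<circ> (\<lambda>w. \<chi> i. F2 i w)) w \<partial>gauss_seq2) = (\<integral>w. iexp (\<Sum>i\<in>UNIV. t i * F' i w) \<partial>distr gauss_seq2 gauss_seq evens)"
      by (subst integral_distr) (auto simp: F2_def comp_def)
    \<comment> \<open>Both sides are limits of the same truncated expressions: the left side by
      \<open>L^2\<close> convergence of the truncations, the right side by the choice of
      \<open>l'\<close>, \<open>L'\<close> and \<open>K'\<close>.\<close>
    also have "of_real (exp (- (\<Sum>b<kdim TYPE('k). (\<Sum>i\<in>UNIV. t i * K' i b)\<^sup>2) / 2)) * \<dots> = (\<integral>x. ?E x \<partial>\<mu>)"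
      unfolding distr_evens scaleR_conv_of_real[symmetric]
      by (rule LIMSEQ_unique[OF tendsto_scaleR[OF tendsto_const iexp_L2_limit[OF F']] lim])
    finally show "(\<integral>x. ?E x \<partial>distr gauss_seq2 borel (\<lambda>w. \<eta> w + (\<chi> i. F2 i w))) = (\<integral>x. ?E x \<partial>\<mu>)" .
  qed
  with cv jg ind gauss_seq2.prob_space_axioms show ?thesis by blast
qed

end
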